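(* The generating function $$F_3(z,p_1,p_2,\dots)=\sum_{n\ge1}\sum_{\alpha\vdash n}h^3(\alpha)\frac{z^n}{n!}\frac{1}{\mu^3(\alpha)!}p_\alpha$$ satisfies $$\frac13\sum_{i,j,k\ge1}\Big((i+j+k)p_ip_jp_k\frac{\partial F_3}{\partial p_{i+j+k}}+ijk\,p_{i+j+k}\frac{\partial F_3}{\partial p_i}\frac{\partial F_3}{\partial p_j}\frac{\partial F_3}{\partial p_k}+3(i+j)k\,p_ip_{j+k}\frac{\partial F_3}{\partial p_{i+j}}\frac{\partial F_3}{\partial p_k}\Big)-\frac12\Big(z\frac{\partial F_3}{\partial z}+\sum_{i\ge1}p_i\frac{\partial F_3}{\partial p_i}-2F_3\Big)=0.$$
   Context: Products of permutations are composed right to left; disjoint cycle decompositions include fixed points as $1$-cycles. For a partition $\alpha=(\alpha_1,\dots,\alpha_l)$ of $n$ (notation $\alpha\vdash n$), $l(\alpha)=l$, $p_\alpha=p_{\alpha_1}\cdots p_{\alpha_l}$ where $p_1,p_2,\dots$ are indeterminates, and $\mu^3(\alpha)=\frac{n+l(\alpha)-2}{2}$; when a permutation of type $\alpha$ can be written as a product of $3$-cycles generating a group transitive on $\{1,\dots,n\}$, $\mu^3(\alpha)$ is the minimal number of $3$-cycles in such a product. $h^3(\alpha)$ is the number of tuples $(\delta_1,\dots,\delta_k,\sigma)$ where $\sigma\in S_n$ has cycle type $\alpha$, the $\delta_i\in S_n$ are $3$-cycles with $\delta_1\cdots\delta_k=\sigma$, the group generated by $\delta_1,\dots,\delta_k$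 acts transitively on $\{1,\dots,n\}$, and $k$ is minimal with these properties (so $k=\mu^3(\alpha)$); if no such tuple exists, $h^3(\alpha)=0$ and the corresponding term of $F_3$ is $0$. $F_3$ is regarded as a formal power series in $z$ with coefficients polynomials in the $p_i$. *)

theory Defs
  imports
    "HOL-Analysis.Infinite_Sum"
    "HOL-Algebra.Sym_Groups"
    "HOL-Combinatorics.Orbits"
    "HOL-Library.Poly_Mapping"
    "HOL-Computational_Algebra.Formal_Power_Series"
begin

section \<open>Minimal transitive factorizations into 3-cycles\<close>

definition partitions_of :: "nat \<Rightarrow> nat multiset set" where
  "partitions_of n = {\<alpha>. 0 \<notin># \<alpha> \<and> sum_mset \<alpha> = n}"

text \<open>The sum over \<open>partitions_of n\<close> in the generating function is a finite one.\<close>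

lemma finite_partitions_of: "finite (partitions_of n)"
proof (rule finite_subset)
  show "finite (\<Union>k\<le>n. {\<alpha>. set_mset \<alpha> \<subseteq> {..n} \<and> size \<alpha> = k})"
    using finite_multisets_of_size[of "{..n}"] by (auto simp: multisets_of_size_def)
  have "size \<alpha> \<le> sum_mset \<alpha>" if "0 \<notin># \<alpha>" for \<alpha> :: "nat multiset"
    using that by (induction \<alpha>) auto
  moreover have "x \<le> sum_mset \<alpha>" if "x \<in># \<alpha>" for x and \<alpha> :: "nat multiset"
    using that by (metis le_add1 sum_mset.remove)
  ultimately show "partitions_of n \<subseteq> (\<Union>k\<le>n. {\<alpha>. set_mset \<alpha> \<subseteq> {..n} \<and> size \<alpha> = k})"
    unfolding partitions_of_def by auto
qed

text \<open>One part for each orbit of \<open>\<sigma>\<close> on \<open>{1..n}\<close>; a fixed point contributes a part \<open>1\<close>.\<close>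

definition cycle_type :: "nat \<Rightarrow> (nat \<Rightarrow> nat) \<Rightarrow> nat multiset" where
  "cycle_type n \<sigma> = image_mset card (mset_set (orbit \<sigma> ` {1..n}))"

definition transitive_factorizations :: "nat multiset \<Rightarrow> ((nat \<Rightarrow> nat) list \<times> (nat \<Rightarrow> nat)) set" where
  "transitive_factorizations \<alpha> = (let n = sum_mset \<alpha> in
     {(\<delta>s, \<sigma>). set \<delta>s \<subseteq> three_cycles n
        \<and> \<sigma> permutes {1..n} \<and> cycle_type n \<sigma> = \<alpha>
        \<and> foldr (\<circ>) \<delta>s id = \<sigma>
        \<and> (\<forall>x\<in>{1..n}. \<forall>y\<in>{1..n}. \<exists>g\<in>generate (sym_group n) (set \<delta>s). g x = y)})"

definition h3 :: "nat multiset \<Rightarrow> nat" where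
  "h3 \<alpha> = card {(\<delta>s, \<sigma>) \<in> transitive_factorizations \<alpha>.
     \<forall>(\<delta>s', \<sigma>') \<in> transitive_factorizations \<alpha>. length \<delta>s \<le> length \<delta>s'}"

text \<open>
  If \<open>sum_mset \<alpha> + size \<alpha>\<close> is odd, then a permutation of type \<open>\<alpha>\<close> is odd, hence not a product
  of 3-cycles and \<open>h3 \<alpha> = 0\<close>; so the rounding performed by \<open>div\<close> never matters. The
  subtraction is not truncated for a partition of a positive number.
\<close>

definition mu3 :: "nat multiset \<Rightarrow> nat" where
  "mu3 \<alpha> = (sum_mset \<alpha> + size \<alpha> - 2) div 2"


section \<open>Power series in \<open>z\<close> over the polynomials in \<open>p\<^sub>1, p\<^sub>2, \<dots>\<close>\<close>

text \<open>
  A polynomial maps exponent vectors to coefficients; multiplication of \<open>poly_mapping\<close> is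
  convolution. The variable with index \<open>0\<close> exists in the type but is never used.
\<close>

type_synonym ppoly = "(nat \<Rightarrow>\<^sub>0 nat) \<Rightarrow>\<^sub>0 rat"

definition scalar :: "rat \<Rightarrow> ppoly" where
  "scalar c = Poly_Mapping.single 0 c"

definition p_var :: "nat \<Rightarrow> ppoly" where
  "p_var i = Poly_Mapping.single (Poly_Mapping.single i 1) 1"

text \<open>If \<open>p_var i\<close> does not occur in a monomial \<open>m\<close>, then the summand for \<open>m\<close> vanishes.\<close>

definition partial_ppoly :: "nat \<Rightarrow> ppoly \<Rightarrow> ppoly" where
  "partial_ppoly i f = (\<Sum>m\<in>Poly_Mapping.keys f.
     Poly_Mapping.single (m - Poly_Mapping.single i 1)
       (of_nat (Poly_Mapping.lookup m i) * Poly_Mapping.lookup f m))"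

definition partial :: "nat \<Rightarrow> ppoly fps \<Rightarrow> ppoly fps" where
  "partial i F = Abs_fps (\<lambda>n. partial_ppoly i (fps_nth F n))"

definition F3 :: "ppoly fps" where
  "F3 = Abs_fps (\<lambda>n. if n = 0 then 0 else
     \<Sum>\<alpha>\<in>partitions_of n. scalar (of_nat (h3 \<alpha>) * (1 / fact n) * (1 / fact (mu3 \<alpha>)))
       * (\<Prod>i\<in>#\<alpha>. p_var i))"

text \<open>Polynomials and scalars as constant power series in \<open>z\<close>.\<close>

abbreviation p_fps :: "nat \<Rightarrow> ppoly fps" where
  "p_fps i \<equiv> fps_const (p_var i)"

abbreviation scalar_fps :: "rat \<Rightarrow> ppoly fps" where
  "scalar_fps c \<equiv> fps_const (scalar c)"

text \<open>
  Infinite sums of power series (\<open>has_sum\<close>) are unconditional sums in the \<open>z\<close>-adic topology (the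
  library's metric on \<open>fps\<close>): for each \<open>n\<close>, the coefficient of \<open>z ^ n\<close> of the finite partial
  sums is eventually constant.
\<close>

end

theory Submission
  imports Defs
begin

text \<open>
  Remove the first 3-cycle \<open>\<delta> = (a b c)\<close> from a minimal transitive factorization of \<open>\<sigma>\<close>. By the
  Riemann--Hurwitz inequality the minimal factorizations are those of genus 0, and this leaves three
  possibilities for the product \<open>\<sigma>'\<close> of the remaining factors. Either they are still transitive and \<open>\<delta>\<close>
  cuts one cycle of \<open>\<sigma>'\<close> into three; or they have two transitivity classes, two of the points \<open>a\<close>, \<open>b\<close>,
  \<open>c\<close> lie on the same cycle in one class, and \<open>\<delta>\<close> cuts this cycle and joins a piece to a cycle of the
  other class; or there are three classes and \<open>\<delta>\<close> joins three cycles. In each case the restriction to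
  every class is again a factorization of genus 0. The three cases give the three summands of the cubic sum: the
  exponential generating functions in \<open>z\<close> account for the choice of the classes, and the division by
  \<open>\<mu>\<^sup>3(\<alpha>)!\<close> for the shuffles of the factors belonging to different classes. The Euler operator in
  the last term counts the factors, since \<open>n + l(\<alpha>) - 2 = 2 \<mu>\<^sup>3(\<alpha>)\<close>.
\<close>

section \<open>Orbits of a permutation multiplied by a 3-cycle\<close>

text \<open>The number \<open>h3\<close> counts factorizations of least length, and the
  Riemann-Hurwitz bound alone does not exclude that the least length exceeds \<open>mu3\<close>. So
  planar factorizations must be shown to exist for every type that occurs; they are built by running
  the same three operations forwards.

  The factors belonging to a class move an arbitrary subset, not an interval of numbers. Hence
  everything is stated for a finite set \<open>S\<close>, with transitivity expressed by invariant
  sets, which restrict to subsets more easily than generated groups do. Conjugation by bijections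
  then shows that only the size of \<open>S\<close> matters.

  A 3-cycle is written by three triples \<open>(a, b, c)\<close>; this is the origin of 1/3. The
  coefficient 3 of the mixed term appears because any of the three points may be the one in a
  different class. Removing a factor turns \<open>1 / k!\<close> into \<open>1 / (k - 1)!\<close>,
  so each list is counted \<open>k\<close> times, as the Euler terms require. The triple is ordered
  and each of its points marks a cycle, so the sums over \<open>i\<close>, \<open>j\<close>,
  \<open>k\<close> need no correction for symmetry.\<close>

definition orbits :: "('a \<Rightarrow> 'a) \<Rightarrow> 'a set \<Rightarrow> 'a set set" where
  "orbits \<sigma> S = orbit \<sigma> ` S"

text \<open>The product of transpositions to which \<open>cycle_of_list [a, b, c]\<close> unfolds,
  which makes the comparison with \<open>three_cycles\<close> immediate.\<close>

definition cyc3 :: "'a \<Rightarrow> 'a \<Rightarrow> 'a \<Rightarrow> 'a \<Rightarrow> 'a" where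
  "cyc3 a b c = transpose a b \<circ> transpose b c"

lemma cyc3_simps:
  assumes "distinct [a, b, c]"
  shows "cyc3 a b c a = b" "cyc3 a b c b = c" "cyc3 a b c c = a"
  using assms by (auto simp: cyc3_def transpose_def)

lemma cyc3_other: "x \<notin> {a, b, c} \<Longrightarrow> cyc3 a b c x = x"
  by (auto simp: cyc3_def transpose_def)

lemma cyc3_rotate: "distinct [a, b, c] \<Longrightarrow> cyc3 b c a = cyc3 a b c"
  by (auto simp: cyc3_def transpose_def fun_eq_iff)

lemma cyc3_permutes: "a \<in> S \<Longrightarrow> b \<in> S \<Longrightarrow> c \<in> S \<Longrightarrow> cyc3 a b c permutes S"
  unfolding cyc3_def by (intro permutes_compose permutes_swap_id)

lemma permutes_imp_permutation: "finite S \<Longrightarrow> \<sigma> permutes S \<Longrightarrow> permutation \<sigma>"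
  by (auto simp: permutation_permutes)

lemma orbit_self: "finite S \<Longrightarrow> \<sigma> permutes S \<Longrightarrow> a \<in> orbit \<sigma> a"
  by (intro permutation_self_in_orbit permutes_imp_permutation)

lemma orbit_eq:
  assumes "finite S" "\<sigma> permutes S" "b \<in> orbit \<sigma> a"
  shows "orbit \<sigma> b = orbit \<sigma> a"
  using cyclic_on_orbit[OF assms(2,1)] assms(3) by (rule orbit_cyclic_eq3)

lemma orbits_disjoint:
  assumes "finite S" "\<sigma> permutes S" "orbit \<sigma> a \<noteq> orbit \<sigma> b"
  shows "orbit \<sigma> a \<inter> orbit \<sigma> b = {}"
  using assms(3) orbit_eq[OF assms(1,2)] by blast

lemma orbit_subset_of_permutes: "\<sigma> permutes S \<Longrightarrow> a \<in> S \<Longrightarrow> orbit \<sigma> a \<subseteq> S"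
  by (rule permutes_orbit_subset)

lemma finite_orbit_permutes: "finite S \<Longrightarrow> \<sigma> permutes S \<Longrightarrow> finite (orbit \<sigma> a)"
  by (intro finite_orbit orbit_self)

lemma card_orbit_pos: "finite S \<Longrightarrow> \<sigma> permutes S \<Longrightarrow> card (orbit \<sigma> a) > 0"
  using finite_orbit_permutes[of S \<sigma> a] orbit_self[of S \<sigma> a] by (auto simp: card_gt_0_iff)

text \<open>The size of a cycle is the first return time of any of its points. Segments of a cycle
  thereby become intervals of exponents.\<close>

lemma orbit_enum:
  assumes "finite S" "\<sigma> permutes S"
  shows "inj_on (\<lambda>i. (\<sigma> ^^ i) a) {..<card (orbit \<sigma> a)}"
    and "orbit \<sigma> a = (\<lambda>i. (\<sigma> ^^ i) a) ` {..<card (orbit \<sigma> a)}"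
    and "(\<sigma> ^^ card (orbit \<sigma> a)) a = a"
proof -
  have a: "a \<in> orbit \<sigma> a" by (rule orbit_self[OF assms])
  let ?n = "funpow_dist1 \<sigma> a a"
  have inj: "inj_on (\<lambda>i. (\<sigma> ^^ i) a) {0..<?n}" by (rule inj_on_funpow_dist1[OF a])
  have eq: "orbit \<sigma> a = (\<lambda>i. (\<sigma> ^^ i) a) ` {0..<?n}" by (rule orbit_conv_funpow_dist1[OF a])
  have card: "card (orbit \<sigma> a) = ?n" using card_image[OF inj] by (subst eq) simp
  show "inj_on (\<lambda>i. (\<sigma> ^^ i) a) {..<card (orbit \<sigma> a)}"
    unfolding card using inj by (simp add: atLeast0LessThan)
  show "orbit \<sigma> a = (\<lambda>i. (\<sigma> ^^ i) a) ` {..<card (orbit \<sigma> a)}"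
    unfolding card using eq by (simp add: atLeast0LessThan)
  show "(\<sigma> ^^ card (orbit \<sigma> a)) a = a"
    unfolding card by (rule funpow_dist1_prop[OF a])
qed

text \<open>A closed walk exhausts the orbit of each of its points. The changed cycles of the
  products below are found by writing down such walks.\<close>

lemma orbit_successively:
  assumes "successively (\<lambda>x y. f x = y) xs" "xs \<noteq> []" "f (last xs) = hd xs" "y \<in> set xs"
  shows "orbit f y = set xs"
proof -
  have nth: "f (xs ! i) = xs ! (Suc i)" if "Suc i < length xs" for i
    using assms(1) that by (auto simp: successively_conv_nth)
  have pow: "(f ^^ i) (hd xs) = xs ! i" if "i < length xs" for i
    using that by (induction i) (auto simp: hd_conv_nth nth assms(2))
  have "f (xs ! (length xs - 1)) = xs ! 0"
    using assms(2,3) by (simp add: last_conv_nth hd_conv_nth)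
  then have closed: "f x \<in> set xs" if x: "x \<in> set xs" for x
  proof -
    obtain i where i: "i < length xs" "x = xs ! i" using x unfolding in_set_conv_nth by blast
    show ?thesis
    proof (cases "Suc i < length xs")
      case False
      then have "i = length xs - 1" using i by simp
      then show ?thesis using \<open>f (xs ! (length xs - 1)) = xs ! 0\<close> i assms(2) by simp
    qed (use nth i in simp)
  qed
  have sub: "orbit f (hd xs) \<subseteq> set xs"
  proof
    fix x assume "x \<in> orbit f (hd xs)"
    then show "x \<in> set xs" by induction (use closed assms(2) in auto)
  qed
  have self: "hd xs \<in> orbit f (hd xs)"
  proof -
    have "f ((f ^^ (length xs - 1)) (hd xs)) = hd xs"
      using assms(2,3) by (simp add: pow last_conv_nth)
    then have "(f ^^ Suc (length xs - 1)) (hd xs) = hd xs" by simp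
    then have "\<exists>n. hd xs = (f ^^ n) (hd xs) \<and> 0 < n" by (intro exI[of _ "Suc (length xs - 1)"]) simp
    then show ?thesis unfolding orbit_altdef by simp
  qed
  have "set xs \<subseteq> orbit f (hd xs)"
  proof
    fix x assume "x \<in> set xs"
    then obtain i where "i < length xs" "x = xs ! i" unfolding in_set_conv_nth by blast
    then have "x = (f ^^ i) (hd xs)" using pow by simp
    then show "x \<in> orbit f (hd xs)" unfolding orbit_altdef_self_in[OF self] by blast
  qed
  with sub have "orbit f (hd xs) = set xs" by blast
  moreover have "hd xs \<in> set xs" using assms(2) by simp
  ultimately have "cyclic_on f (set xs)" unfolding cyclic_on_def by blast
  then show ?thesis using assms(4) by (rule orbit_cyclic_eq3)
qed

lemma successively_map_upt:
  assumes "\<And>t. p \<le> t \<Longrightarrow> Suc t < q \<Longrightarrow> f (g t) = g (Suc t)"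
  shows "successively (\<lambda>x y. f x = y) (map g [p..<q])"
  using assms by (auto simp: successively_conv_nth)

text \<open>A union \<open>Z\<close> of cycles of \<open>\<sigma>\<close> is never entered from
  outside, so the orbits of the remaining points are untouched and only those in \<open>Z\<close>
  have to be recomputed.\<close>

lemma orbits_replace:
  assumes "finite S" "\<sigma> permutes S" "Z \<subseteq> S" "\<And>x. x \<in> Z \<Longrightarrow> orbit \<sigma> x \<subseteq> Z"
    and "\<And>x. x \<in> S - Z \<Longrightarrow> \<tau> x = \<sigma> x"
  shows "orbits \<tau> S = orbits \<sigma> (S - Z) \<union> orbits \<tau> Z"
proof -
  have "orbit \<tau> x = orbit \<sigma> x" if "x \<in> S - Z" for x
  proof (rule orbit_cong)
    show "x \<in> orbit \<sigma> x" by (rule orbit_self[OF assms(1,2)])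
    fix s assume s: "s \<in> orbit \<sigma> x"
    then have "s \<in> S" using that orbit_subset_of_permutes[OF assms(2)] by blast
    moreover have "s \<notin> Z"
      using that assms(4)[of s] orbit_eq[OF assms(1,2) s] orbit_self[OF assms(1,2), of x] by auto
    ultimately show "\<tau> s = \<sigma> s" using assms(5) by blast
  qed
  then have "orbits \<tau> (S - Z) = orbits \<sigma> (S - Z)" unfolding orbits_def by (intro image_cong) auto
  moreover have "orbits \<tau> S = orbits \<tau> (S - Z) \<union> orbits \<tau> Z"
    using assms(3) unfolding orbits_def by blast
  ultimately show ?thesis by simp
qed

lemma image_const_eq: "A \<noteq> {} \<Longrightarrow> (\<And>y. y \<in> A \<Longrightarrow> f y = B) \<Longrightarrow> f ` A = {B}"
  by auto

section \<open>Effect of a 3-cycle on the cycles of a permutation\<close>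

context
  fixes S :: "'a set" and \<sigma> :: "'a \<Rightarrow> 'a"
  assumes fin: "finite S" and perm: "\<sigma> permutes S"
begin

text \<open>Left multiplication changes the image only of the points that \<open>\<sigma>\<close>
  sends to \<open>a\<close>, \<open>b\<close> or \<open>c\<close>, and these predecessors lie on the
  cycles of \<open>a\<close>, \<open>b\<close>, \<open>c\<close>.\<close>

lemma orbits_cyc3_mult_replace:
  assumes "{a, b, c} \<subseteq> S" "Z = orbit \<sigma> a \<union> orbit \<sigma> b \<union> orbit \<sigma> c"
  shows "orbits (cyc3 a b c \<circ> \<sigma>) S = orbits \<sigma> (S - Z) \<union> orbits (cyc3 a b c \<circ> \<sigma>) Z"
proof (rule orbits_replace[OF fin perm])
  show "Z \<subseteq> S" using assms orbit_subset_of_permutes[OF perm] by auto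
  show "orbit \<sigma> x \<subseteq> Z" if "x \<in> Z" for x using that orbit_eq[OF fin perm] assms(2) by auto
  fix x assume x: "x \<in> S - Z"
  have "\<sigma> x \<in> orbit \<sigma> x" by (rule orbit.base)
  then have "orbit \<sigma> (\<sigma> x) = orbit \<sigma> x" by (rule orbit_eq[OF fin perm])
  then have "\<sigma> x \<notin> {a, b, c}" using x assms(2) orbit_self[OF fin perm, of x] by auto
  then show "(cyc3 a b c \<circ> \<sigma>) x = \<sigma> x" by (simp add: cyc3_other)
qed

text \<open>Only images are altered, so the starting point of a segment may itself be
  \<open>a\<close>, \<open>b\<close> or \<open>c\<close>; hence the strict bound
  \<open>p < t\<close>.\<close>

lemma successively_trail:
  assumes "q \<le> card (orbit \<sigma> x)"
    and "\<And>t. p < t \<Longrightarrow> t < q \<Longrightarrow> (\<sigma> ^^ t) x \<notin> {a, b, c}"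
  shows "successively (\<lambda>u v. (cyc3 a b c \<circ> \<sigma>) u = v) (map (\<lambda>t. (\<sigma> ^^ t) x) [p..<q])"
proof (rule successively_map_upt)
  fix t assume "p \<le> t" "Suc t < q"
  then have "(\<sigma> ^^ Suc t) x \<notin> {a, b, c}" by (intro assms(2)) auto
  then show "(cyc3 a b c \<circ> \<sigma>) ((\<sigma> ^^ t) x) = (\<sigma> ^^ Suc t) x" by (simp add: cyc3_other)
qed

lemma funpow_eq_iff:
  "s < card (orbit \<sigma> x) \<Longrightarrow> t < card (orbit \<sigma> x) \<Longrightarrow> (\<sigma> ^^ s) x = (\<sigma> ^^ t) x \<longleftrightarrow> s = t"
  using orbit_enum(1)[OF fin perm, of x] by (auto simp: inj_on_def)

lemma funpow_in: "(\<sigma> ^^ t) x \<in> orbit \<sigma> x"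
  using orbit_altdef_self_in[OF orbit_self[OF fin perm]] by auto

lemma funpow_last: "p < q \<Longrightarrow> \<sigma> (last (map (\<lambda>t. (\<sigma> ^^ t) x) [p..<q])) = (\<sigma> ^^ q) x"
  by (cases q) (auto simp: last_map)

lemma set_trail: "set (map (\<lambda>t. (\<sigma> ^^ t) x) [0..<card (orbit \<sigma> x)]) = orbit \<sigma> x"
  using orbit_enum(2)[OF fin perm, of x] by (auto simp: atLeast0LessThan)

text \<open>The segments begin at \<open>a\<close>, \<open>c\<close>, \<open>b\<close> in this
  order. Where \<open>\<sigma>\<close> would step from the end of one to the beginning of the next,
  the 3-cycle sends it back (\<open>c\<close> to \<open>a\<close>, \<open>b\<close> to
  \<open>c\<close>, \<open>a\<close> to \<open>b\<close>), so each segment closes up.\<close>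

lemma orbits_cut_three:
  assumes a: "a \<in> S" and ijk: "0 < i" "0 < j" "0 < k" "i + j + k = card (orbit \<sigma> a)"
    and c: "c = (\<sigma> ^^ i) a" and b: "b = (\<sigma> ^^ (i + j)) a"
  obtains X Y Z where "orbits (cyc3 a b c \<circ> \<sigma>) S = orbits \<sigma> (S - orbit \<sigma> a) \<union> {X, Y, Z}"
    "card X = i" "card Y = j" "card Z = k" "X \<union> Y \<union> Z = orbit \<sigma> a"
    "X \<inter> Y = {}" "X \<inter> Z = {}" "Y \<inter> Z = {}"
    "distinct [a, b, c]" "b \<in> orbit \<sigma> a" "c \<in> orbit \<sigma> a"
proof -
  let ?f = "\<lambda>t. (\<sigma> ^^ t) a" and ?\<tau> = "cyc3 a b c \<circ> \<sigma>"
  define m where "m = card (orbit \<sigma> a)"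
  note ijk = ijk[folded m_def]
  note enum = orbit_enum[OF fin perm, of a, folded m_def]
  define seg where "seg p q = map ?f [p..<q]" for p q
  have inj: "?f s = ?f t \<longleftrightarrow> s = t" if "s < m" "t < m" for s t using funpow_eq_iff[of s a t] that by (simp add: m_def)
  have a0: "a = ?f 0" by simp
  have dist: "distinct [a, b, c]" using ijk inj[of 0 i] inj[of 0 "i + j"] inj[of i "i + j"] by (auto simp: b c)
  have b_in: "b \<in> orbit \<sigma> a" and c_in: "c \<in> orbit \<sigma> a" using funpow_in b c by auto
  have notin: "?f t \<notin> {a, b, c}" if "t \<noteq> 0" "t \<noteq> i" "t \<noteq> i + j" "t < m" for t
    using that ijk inj[of t 0] inj[of t i] inj[of t "i + j"] by (auto simp: b c)
  have orb: "orbit ?\<tau> y = set (seg p q)"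
    if "p < q" "q \<le> m" "y \<in> set (seg p q)" "\<And>t. p < t \<Longrightarrow> t < q \<Longrightarrow> t \<noteq> i \<and> t \<noteq> i + j"
      "cyc3 a b c (?f q) = ?f p" for p q y
  proof (rule orbit_successively)
    show "successively (\<lambda>x y. ?\<tau> x = y) (seg p q)"
      unfolding seg_def by (rule successively_trail) (use that notin m_def in \<open>auto simp del: insert_iff\<close>)
    show "?\<tau> (last (seg p q)) = hd (seg p q)"
      using funpow_last[OF that(1), of a] that(1,5) unfolding seg_def by (simp add: hd_map)
  qed (use that in \<open>auto simp: seg_def\<close>)
  have f_m: "?f m = a" by (rule enum(3))
  have im: "cyc3 a b c (?f i) = ?f 0" "cyc3 a b c (?f (i + j)) = ?f i" "cyc3 a b c (?f m) = ?f (i + j)"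
    using cyc3_simps[OF dist] unfolding f_m by (simp_all add: b[symmetric] c[symmetric])
  have ne: "seg 0 i \<noteq> []" "seg i (i + j) \<noteq> []" "seg (i + j) m \<noteq> []" using ijk by (auto simp: seg_def)
  have "orbit ?\<tau> ` set (seg 0 i) = {set (seg 0 i)}"
    using ne by (intro image_const_eq orb im) (use ijk in auto)
  moreover have "orbit ?\<tau> ` set (seg i (i + j)) = {set (seg i (i + j))}"
    using ne by (intro image_const_eq orb im) (use ijk in auto)
  moreover have "orbit ?\<tau> ` set (seg (i + j) m) = {set (seg (i + j) m)}"
    using ne by (intro image_const_eq orb im) (use ijk in auto)
  ultimately have orb_seg: "orbit ?\<tau> ` (set (seg 0 i) \<union> set (seg i (i + j)) \<union> set (seg (i + j) m))
      = {set (seg 0 i), set (seg i (i + j)), set (seg (i + j) m)}"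
    unfolding image_Un by auto
  have "{0..<i} \<union> {i..<i+j} \<union> {i+j..<m} = {..<m}" using ijk by auto
  then have "?f ` {0..<i} \<union> ?f ` {i..<i+j} \<union> ?f ` {i+j..<m} = ?f ` {..<m}"
    by (simp only: image_Un[symmetric])
  then have un: "set (seg 0 i) \<union> set (seg i (i + j)) \<union> set (seg (i + j) m) = orbit \<sigma> a"
    unfolding seg_def set_map set_upt by (rule trans) (rule enum(2)[symmetric])
  have orbs: "orbits ?\<tau> (orbit \<sigma> a) = {set (seg 0 i), set (seg i (i + j)), set (seg (i + j) m)}"
    using orb_seg unfolding orbits_def un .
  have card: "card (set (seg p q)) = q - p" if "q \<le> m" for p q
  proof -
    have "inj_on ?f {p..<q}" using that inj by (intro inj_onI) auto
    then show ?thesis by (simp add: seg_def card_image)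
  qed
  have disj: "set (seg p q) \<inter> set (seg p' q') = {}" if "q \<le> p'" "q' \<le> m" for p q p' q'
  proof -
    have "?f s \<noteq> ?f t" if "s < q" "t < q'" "p' \<le> t" for s t
      using that \<open>q \<le> p'\<close> \<open>q' \<le> m\<close> inj[of s t] by auto
    then show ?thesis by (fastforce simp: seg_def)
  qed
  have "{a, b, c} \<subseteq> S" using a b_in c_in orbit_subset_of_permutes[OF perm a] by auto
  then have "orbits ?\<tau> S = orbits \<sigma> (S - orbit \<sigma> a) \<union> orbits ?\<tau> (orbit \<sigma> a)"
    using orbit_eq[OF fin perm b_in] orbit_eq[OF fin perm c_in] by (intro orbits_cyc3_mult_replace) auto
  then have "orbits ?\<tau> S = orbits \<sigma> (S - orbit \<sigma> a) \<union> {set (seg 0 i), set (seg i (i + j)), set (seg (i + j) m)}"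
    unfolding orbs .
  then show ?thesis
  proof (rule that)
    show "card (set (seg 0 i)) = i" "card (set (seg i (i + j))) = j" "card (set (seg (i + j) m)) = k"
      using card[of i 0] card[of "i + j" i] card[of m "i + j"] ijk by simp_all
    show "set (seg 0 i) \<inter> set (seg i (i + j)) = {}" "set (seg 0 i) \<inter> set (seg (i + j) m) = {}"
      "set (seg i (i + j)) \<inter> set (seg (i + j) m) = {}"
      using ijk by (intro disj; simp)+
  qed (fact un dist b_in c_in)+
qed

text \<open>Here \<open>b\<close> comes before \<open>c\<close>. The end of each segment is
  redirected to the beginning of a different one, so the three remain a single cycle.\<close>

lemma orbits_no_cut:
  assumes a: "a \<in> S" and ij: "0 < i" "i < j" "j < card (orbit \<sigma> a)"
    and b: "b = (\<sigma> ^^ i) a" and c: "c = (\<sigma> ^^ j) a"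
  shows "orbits (cyc3 a b c \<circ> \<sigma>) S = orbits \<sigma> (S - orbit \<sigma> a) \<union> {orbit \<sigma> a}"
proof -
  let ?f = "\<lambda>t. (\<sigma> ^^ t) a" and ?\<tau> = "cyc3 a b c \<circ> \<sigma>"
  define m where "m = card (orbit \<sigma> a)"
  note ij = ij[folded m_def]
  note enum = orbit_enum[OF fin perm, of a, folded m_def]
  define seg where "seg p q = map ?f [p..<q]" for p q
  have inj: "?f s = ?f t \<longleftrightarrow> s = t" if "s < m" "t < m" for s t using funpow_eq_iff[of s a t] that by (simp add: m_def)
  have dist: "distinct [a, b, c]" using ij inj[of 0 i] inj[of 0 j] inj[of i j] by (auto simp: b c)
  have b_in: "b \<in> orbit \<sigma> a" and c_in: "c \<in> orbit \<sigma> a" using funpow_in b c by auto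
  have notin: "?f t \<notin> {a, b, c}" if "t \<noteq> 0" "t \<noteq> i" "t \<noteq> j" "t < m" for t
    using that ij inj[of t 0] inj[of t i] inj[of t j] by (auto simp: b c)
  have f_m: "?f m = a" by (rule enum(3))
  have steps: "successively (\<lambda>x y. ?\<tau> x = y) (seg p q)"
    if "q \<le> m" "\<And>t. p < t \<Longrightarrow> t < q \<Longrightarrow> t \<noteq> i \<and> t \<noteq> j" for p q
    unfolding seg_def by (rule successively_trail) (use that notin m_def in \<open>auto simp del: insert_iff\<close>)
  have last: "?\<tau> (last (seg p q)) = cyc3 a b c (?f q)" if "p < q" for p q
    using funpow_last[OF that, of a] unfolding seg_def by simp
  have ne: "seg 0 i \<noteq> []" "seg i j \<noteq> []" "seg j m \<noteq> []" using ij by (auto simp: seg_def)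
  have hd: "hd (seg p q) = ?f p" if "p < q" for p q using that by (simp add: seg_def hd_map)
  \<comment> \<open>The first segment would step to \<open>b\<close> and is sent to
    \<open>c\<close>; the last would step to \<open>a\<close> and is sent to \<open>b\<close>. So
    the second and third segments change places.\<close>
  let ?xs = "seg 0 i @ seg j m @ seg i j"
  have im: "cyc3 a b c (?f i) = ?f j" "cyc3 a b c (?f m) = ?f i" "cyc3 a b c (?f j) = ?f 0"
    using cyc3_simps[OF dist] unfolding f_m by (simp_all add: b[symmetric] c[symmetric])
  have joins: "?\<tau> (last (seg 0 i)) = ?f j" "?\<tau> (last (seg j m)) = ?f i" "?\<tau> (last (seg i j)) = ?f 0"
    using last[of 0 i] last[of j m] last[of i j] ij unfolding im by simp_all
  have "successively (\<lambda>x y. ?\<tau> x = y) (seg 0 i)" "successively (\<lambda>x y. ?\<tau> x = y) (seg i j)"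
    "successively (\<lambda>x y. ?\<tau> x = y) (seg j m)"
    using ij by (intro steps; auto)+
  then have "successively (\<lambda>x y. ?\<tau> x = y) ?xs"
    unfolding successively_append_iff
    using joins ne hd[of i j] hd[of j m] ij by (simp del: comp_apply)
  moreover have "?\<tau> (last ?xs) = hd ?xs"
    using joins hd[of 0 i] ne ij by (simp del: comp_apply)
  ultimately have orb: "orbit ?\<tau> y = set ?xs" if "y \<in> set ?xs" for y
    using ne that by (intro orbit_successively) auto
  have "{0..<i} \<union> ({j..<m} \<union> {i..<j}) = {..<m}" using ij by auto
  then have "?f ` {0..<i} \<union> (?f ` {j..<m} \<union> ?f ` {i..<j}) = ?f ` {..<m}"
    by (simp only: image_Un[symmetric])
  then have un: "orbit \<sigma> a = set ?xs"
    unfolding seg_def set_map set_upt set_append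
    by (intro trans[OF enum(2)]) (rule sym)
  have orbs: "orbits ?\<tau> (orbit \<sigma> a) = {orbit \<sigma> a}"
    unfolding un orbits_def using ne by (intro image_const_eq orb) auto
  have "{a, b, c} \<subseteq> S" using a b_in c_in orbit_subset_of_permutes[OF perm a] by auto
  then show ?thesis unfolding orbs[symmetric]
    using orbit_eq[OF fin perm b_in] orbit_eq[OF fin perm c_in] by (intro orbits_cyc3_mult_replace) auto
qed

text \<open>The segment from \<open>a\<close> to just before \<open>b\<close> is continued along the
  whole cycle of \<open>c\<close> and returns to \<open>a\<close>; the segment starting at
  \<open>b\<close> closes up. So a piece of length \<open>d\<close> moves from one cycle to the
  other.\<close>

lemma orbits_cut_join:
  assumes a: "a \<in> S" and d: "0 < d" "d < card (orbit \<sigma> a)" and b: "b = (\<sigma> ^^ d) a"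
    and c: "c \<in> S" "orbit \<sigma> c \<noteq> orbit \<sigma> a"
  obtains X Y where
    "orbits (cyc3 a b c \<circ> \<sigma>) S = orbits \<sigma> (S - (orbit \<sigma> a \<union> orbit \<sigma> c)) \<union> {X, Y}"
    "card X = card (orbit \<sigma> a) - d" "card Y = d + card (orbit \<sigma> c)"
    "X \<union> Y = orbit \<sigma> a \<union> orbit \<sigma> c" "X \<inter> Y = {}"
proof -
  let ?f = "\<lambda>t. (\<sigma> ^^ t) a" and ?g = "\<lambda>t. (\<sigma> ^^ t) c" and ?\<tau> = "cyc3 a b c \<circ> \<sigma>"
  define m where "m = card (orbit \<sigma> a)"
  define k where "k = card (orbit \<sigma> c)"
  note d = d[folded m_def]
  note enum = orbit_enum[OF fin perm, of a, folded m_def]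
  note enumc = orbit_enum[OF fin perm, of c, folded k_def]
  define seg where "seg p q = map ?f [p..<q]" for p q
  define segc where "segc = map ?g [0..<k]"
  have inj: "?f s = ?f t \<longleftrightarrow> s = t" if "s < m" "t < m" for s t using funpow_eq_iff[of s a t] that by (simp add: m_def)
  have injc: "?g s = ?g t \<longleftrightarrow> s = t" if "s < k" "t < k" for s t using funpow_eq_iff[of s c t] that by (simp add: k_def)
  have disj: "orbit \<sigma> a \<inter> orbit \<sigma> c = {}" by (rule orbits_disjoint[OF fin perm]) (use c in auto)
  have b_in: "b \<in> orbit \<sigma> a" using funpow_in b by auto
  have f_in: "?f t \<in> orbit \<sigma> a" and g_in: "?g t \<in> orbit \<sigma> c" for t by (rule funpow_in)+
  have a_in: "a \<in> orbit \<sigma> a" and c_in: "c \<in> orbit \<sigma> c" by (rule orbit_self[OF fin perm])+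
  have k: "0 < k" unfolding k_def by (rule card_orbit_pos[OF fin perm])
  have dist: "distinct [a, b, c]" using d inj[of 0 d] a_in b_in c_in disj by (auto simp: b)
  have notin: "?f t \<notin> {a, b, c}" if "t \<noteq> 0" "t \<noteq> d" "t < m" for t
    using that d inj[of t 0] inj[of t d] f_in[of t] c_in disj by (auto simp: b)
  have notin': "?g t \<notin> {a, b, c}" if "t \<noteq> 0" "t < k" for t
    using that k injc[of t 0] g_in[of t] a_in b_in disj by auto
  have f_m: "?f m = a" and g_k: "?g k = c" by (rule enum(3) enumc(3))+
  have steps: "successively (\<lambda>x y. ?\<tau> x = y) (seg p q)"
    if "q \<le> m" "\<And>t. p < t \<Longrightarrow> t < q \<Longrightarrow> t \<noteq> d" for p q
    unfolding seg_def by (rule successively_trail) (use that notin m_def in \<open>auto simp del: insert_iff\<close>)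
  have stepsc: "successively (\<lambda>x y. ?\<tau> x = y) segc"
    unfolding segc_def by (rule successively_trail) (use notin' k_def in \<open>auto simp del: insert_iff\<close>)
  have last: "?\<tau> (last (seg p q)) = cyc3 a b c (?f q)" if "p < q" for p q
    using funpow_last[OF that, of a] unfolding seg_def by simp
  have lastc: "?\<tau> (last segc) = a"
    using funpow_last[OF k, of c] cyc3_simps[OF dist] g_k unfolding segc_def by simp
  have hdc: "hd segc = c" using k by (simp add: segc_def hd_map)
  have ne: "seg 0 d \<noteq> []" "seg d m \<noteq> []" "segc \<noteq> []" using d k by (auto simp: seg_def segc_def)
  have hd: "hd (seg p q) = ?f p" if "p < q" for p q using that by (simp add: seg_def hd_map)
  have im: "cyc3 a b c (?f d) = c" "cyc3 a b c (?f m) = ?f d"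
    using cyc3_simps[OF dist] unfolding f_m by (simp_all add: b[symmetric])
  have joins: "?\<tau> (last (seg 0 d)) = c" "?\<tau> (last (seg d m)) = ?f d"
    using last[of 0 d] last[of d m] d unfolding im by simp_all
  have s: "successively (\<lambda>x y. ?\<tau> x = y) (seg 0 d)" "successively (\<lambda>x y. ?\<tau> x = y) (seg d m)"
    using d by (intro steps; auto)+
  have "successively (\<lambda>x y. ?\<tau> x = y) (seg 0 d @ segc)"
    unfolding successively_append_iff using s stepsc joins hdc by (simp del: comp_apply)
  moreover have "?\<tau> (last (seg 0 d @ segc)) = hd (seg 0 d @ segc)"
    using lastc hd[of 0 d] ne d by (simp del: comp_apply)
  ultimately have orb1: "orbit ?\<tau> y = set (seg 0 d @ segc)" if "y \<in> set (seg 0 d @ segc)" for y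
    using ne that by (intro orbit_successively) simp_all
  have orb2: "orbit ?\<tau> y = set (seg d m)" if "y \<in> set (seg d m)" for y
    using that ne s joins hd[of d m] d by (intro orbit_successively) (simp_all del: comp_apply)
  have "orbit ?\<tau> ` set (seg d m) = {set (seg d m)}"
    using ne by (intro image_const_eq orb2) auto
  moreover have "orbit ?\<tau> ` set (seg 0 d @ segc) = {set (seg 0 d @ segc)}"
    using ne by (intro image_const_eq orb1) auto
  ultimately have orb_seg: "orbit ?\<tau> ` (set (seg d m) \<union> set (seg 0 d @ segc))
      = {set (seg d m), set (seg 0 d @ segc)}"
    unfolding image_Un[of _ "set (seg d m)"] by auto
  have "{0..<d} \<union> {d..<m} = {..<m}" using d by auto
  then have "?f ` {0..<d} \<union> ?f ` {d..<m} = ?f ` {..<m}"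
    by (simp only: image_Un[symmetric])
  then have un: "orbit \<sigma> a = set (seg 0 d) \<union> set (seg d m)"
    unfolding seg_def set_map set_upt by (intro trans[OF enum(2)]) (rule sym)
  have unc: "orbit \<sigma> c = set segc" unfolding segc_def k_def by (rule set_trail[symmetric])
  have Un: "set (seg d m) \<union> set (seg 0 d @ segc) = orbit \<sigma> a \<union> orbit \<sigma> c"
    using un unc by auto
  have orbs: "orbits ?\<tau> (orbit \<sigma> a \<union> orbit \<sigma> c) = {set (seg d m), set (seg 0 d @ segc)}"
    using orb_seg unfolding orbits_def Un .
  have card: "card (set (seg p q)) = q - p" if "q \<le> m" for p q
  proof -
    have "inj_on ?f {p..<q}" using that inj by (intro inj_onI) auto
    then show ?thesis by (simp add: seg_def card_image)
  qed
  have "?f s \<noteq> ?f t" if "s < d" "t < m" "d \<le> t" for s t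
    using that inj[of s t] by auto
  then have disj1: "set (seg 0 d) \<inter> set (seg d m) = {}" by (fastforce simp: seg_def)
  have disj2: "set (seg 0 d) \<inter> set segc = {}" "set (seg d m) \<inter> set segc = {}"
    using disj unfolding un unc by auto
  have "card (set (seg 0 d) \<union> set segc) = card (set (seg 0 d)) + card (set segc)"
    using disj2 by (intro card_Un_disjoint) auto
  then have cardY: "card (set (seg 0 d @ segc)) = d + k"
    using card[of d 0] d by (simp add: unc[symmetric] k_def)
  have sub: "{a, b, c} \<subseteq> S" using a b_in c orbit_subset_of_permutes[OF perm a] by auto
  have "orbits ?\<tau> S = orbits \<sigma> (S - (orbit \<sigma> a \<union> orbit \<sigma> c)) \<union> {set (seg d m), set (seg 0 d @ segc)}"
    unfolding orbs[symmetric]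
    using orbit_eq[OF fin perm b_in] by (intro orbits_cyc3_mult_replace[OF sub]) auto
  then show ?thesis
  proof (rule that)
    show "card (set (seg d m)) = card (orbit \<sigma> a) - d" using card[of m d] by (simp add: m_def)
    show "card (set (seg 0 d @ segc)) = d + card (orbit \<sigma> c)" using cardY by (simp add: k_def)
    show "set (seg d m) \<inter> set (seg 0 d @ segc) = {}" using disj1 disj2 by auto
  qed (fact Un)
qed

text \<open>Each of the three cycles is traversed in full; where it would return to its beginning,
  the 3-cycle switches to the next one.\<close>

lemma orbits_join_three:
  assumes abc: "a \<in> S" "b \<in> S" "c \<in> S"
    and ne: "orbit \<sigma> a \<noteq> orbit \<sigma> b" "orbit \<sigma> a \<noteq> orbit \<sigma> c" "orbit \<sigma> b \<noteq> orbit \<sigma> c"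
  defines "Z \<equiv> orbit \<sigma> a \<union> orbit \<sigma> b \<union> orbit \<sigma> c"
  shows "orbits (cyc3 a b c \<circ> \<sigma>) S = orbits \<sigma> (S - Z) \<union> {Z}"
proof -
  let ?\<tau> = "cyc3 a b c \<circ> \<sigma>"
  define seg where "seg x = map (\<lambda>t. (\<sigma> ^^ t) x) [0..<card (orbit \<sigma> x)]" for x
  have disj: "orbit \<sigma> a \<inter> orbit \<sigma> b = {}" "orbit \<sigma> a \<inter> orbit \<sigma> c = {}" "orbit \<sigma> b \<inter> orbit \<sigma> c = {}"
    by (rule orbits_disjoint[OF fin perm]; use ne in blast)+
  have self: "x \<in> orbit \<sigma> x" for x by (rule orbit_self[OF fin perm])
  have pos: "0 < card (orbit \<sigma> x)" for x by (rule card_orbit_pos[OF fin perm])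
  have dist: "distinct [a, b, c]" using ne by auto
  have steps: "successively (\<lambda>x y. ?\<tau> x = y) (seg x)" if "x \<in> {a, b, c}" for x
    unfolding seg_def
  proof (rule successively_trail)
    fix t assume t: "0 < t" "t < card (orbit \<sigma> x)"
    have "(\<sigma> ^^ t) x \<in> orbit \<sigma> x" by (rule funpow_in)
    moreover have "(\<sigma> ^^ t) x \<noteq> x" using funpow_eq_iff[of t x 0] t pos[of x] by auto
    ultimately show "(\<sigma> ^^ t) x \<notin> {a, b, c}" using that disj self[of a] self[of b] self[of c] by auto
  qed simp
  have last: "?\<tau> (last (seg x)) = cyc3 a b c x" for x
    using funpow_last[OF pos, of x x] orbit_enum(3)[OF fin perm, of x] unfolding seg_def by simp
  have hd: "hd (seg x) = x" and seg_ne: "seg x \<noteq> []" for x using pos by (auto simp: seg_def hd_map)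
  let ?xs = "seg a @ seg b @ seg c"
  have "successively (\<lambda>x y. ?\<tau> x = y) ?xs" unfolding successively_append_iff
    using steps last hd seg_ne cyc3_simps[OF dist] by auto
  moreover have "?\<tau> (last ?xs) = hd ?xs" using last hd seg_ne cyc3_simps[OF dist] by auto
  ultimately have orb: "orbit ?\<tau> y = set ?xs" if "y \<in> set ?xs" for y
    using seg_ne that by (intro orbit_successively) auto
  have Z: "Z = set ?xs" unfolding Z_def seg_def using set_trail by auto
  have orbs: "orbits ?\<tau> Z = {Z}" unfolding Z orbits_def using seg_ne by (intro image_const_eq orb) auto
  show ?thesis unfolding orbs[symmetric]
    by (rule orbits_cyc3_mult_replace) (use abc in \<open>auto simp: Z_def\<close>)
qed

end


section \<open>Connected lists of 3-cycles\<close>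

definition supp :: "('a \<Rightarrow> 'a) \<Rightarrow> 'a set" where
  "supp d = {x. d x \<noteq> x}"

text \<open>Takes the place of \<open>three_cycles n\<close>, since transitivity classes are
  arbitrary sets of points.\<close>

definition tri :: "'a set \<Rightarrow> ('a \<Rightarrow> 'a) set" where
  "tri S = {cyc3 a b c | a b c. distinct [a, b, c] \<and> {a, b, c} \<subseteq> S}"

abbreviation prodl :: "('a \<Rightarrow> 'a) list \<Rightarrow> 'a \<Rightarrow> 'a" where
  "prodl ds \<equiv> foldr (\<circ>) ds id"

lemma supp_cyc3: "distinct [a, b, c] \<Longrightarrow> supp (cyc3 a b c) = {a, b, c}"
  by (auto simp: supp_def cyc3_def transpose_def)

lemma triE:
  assumes "d \<in> tri S"
  obtains a b c where "d = cyc3 a b c" "distinct [a, b, c]" "a \<in> S" "b \<in> S" "c \<in> S"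
  using assms by (auto simp: tri_def)

lemma triI: "distinct [a, b, c] \<Longrightarrow> {a, b, c} \<subseteq> S \<Longrightarrow> cyc3 a b c \<in> tri S"
  unfolding tri_def by blast

lemma supp_tri: "d \<in> tri S \<Longrightarrow> supp d \<subseteq> S \<and> supp d \<noteq> {}"
  by (elim triE) (simp add: supp_cyc3)

lemma tri_permutes: "d \<in> tri S \<Longrightarrow> d permutes S"
  by (elim triE) (simp add: cyc3_permutes)

lemma tri_supp_subset: "d \<in> tri S \<Longrightarrow> supp d \<subseteq> A \<Longrightarrow> d \<in> tri A"
  by (elim triE) (auto simp: supp_cyc3 intro!: triI)

lemma tri_mono: "A \<subseteq> S \<Longrightarrow> tri A \<subseteq> tri S"
  unfolding tri_def by blast

lemma tri_disjoint: "A \<inter> B = {} \<Longrightarrow> tri A \<inter> tri B = {}"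
  using supp_tri by blast

lemma finite_tri: "finite S \<Longrightarrow> finite (tri S)"
proof -
  assume "finite S"
  then have "finite ((\<lambda>(a, b, c). cyc3 a b c) ` (S \<times> S \<times> S))" by simp
  moreover have "tri S \<subseteq> (\<lambda>(a, b, c). cyc3 a b c) ` (S \<times> S \<times> S)"
    unfolding tri_def by (force simp: image_iff)
  ultimately show ?thesis by (rule finite_subset[rotated])
qed

lemma prodl_Cons: "prodl (d # ds) x = d (prodl ds x)"
  by simp

lemma prodl_permutes: "set ds \<subseteq> tri S \<Longrightarrow> prodl ds permutes S"
  by (induction ds) (auto intro: permutes_compose tri_permutes permutes_id simp: id_def[symmetric])

text \<open>As a 3-cycle permutes its support transitively, this is invariance under every factor.
  It speaks of supports only and so passes easily to sublists.\<close>

definition invariant :: "('a \<Rightarrow> 'a) list \<Rightarrow> 'a set \<Rightarrow> bool" where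
  "invariant ds A \<longleftrightarrow> (\<forall>d\<in>set ds. supp d \<subseteq> A \<or> supp d \<inter> A = {})"

text \<open>Transitivity of the generated group in terms of its invariant sets. The empty list is
  connected on a single point, which makes fixed points legitimate classes.\<close>

definition conn :: "'a set \<Rightarrow> ('a \<Rightarrow> 'a) list \<Rightarrow> bool" where
  "conn S ds \<longleftrightarrow> S \<noteq> {} \<and> set ds \<subseteq> tri S \<and> (\<forall>A\<subseteq>S. A \<noteq> {} \<longrightarrow> invariant ds A \<longrightarrow> A = S)"

definition restr :: "'a set \<Rightarrow> ('a \<Rightarrow> 'a) list \<Rightarrow> ('a \<Rightarrow> 'a) list" where
  "restr A ds = filter (\<lambda>d. supp d \<subseteq> A) ds"

lemma conn_nonempty: "conn S ds \<Longrightarrow> S \<noteq> {}"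
  and conn_tri: "conn S ds \<Longrightarrow> set ds \<subseteq> tri S"
  and connD: "conn S ds \<Longrightarrow> A \<subseteq> S \<Longrightarrow> A \<noteq> {} \<Longrightarrow> invariant ds A \<Longrightarrow> A = S"
  by (auto simp: conn_def)

lemma invariant_Int: "invariant ds A \<Longrightarrow> invariant ds B \<Longrightarrow> invariant ds (A \<inter> B)"
  unfolding invariant_def by blast

lemma invariant_Un: "invariant ds A \<Longrightarrow> invariant ds B \<Longrightarrow> invariant ds (A \<union> B)"
  unfolding invariant_def by blast

lemma invariant_Diff: "set ds \<subseteq> tri S \<Longrightarrow> invariant ds A \<Longrightarrow> invariant ds (S - A)"
  unfolding invariant_def using supp_tri by fast

lemma invariant_restr:
  "invariant ds A \<Longrightarrow> A' \<subseteq> A \<Longrightarrow> invariant (restr A ds) A' \<longleftrightarrow> invariant ds A'"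
  unfolding invariant_def restr_def by auto blast

lemma restr_tri: "set ds \<subseteq> tri S \<Longrightarrow> set (restr A ds) \<subseteq> tri A"
  unfolding restr_def using tri_supp_subset by auto

text \<open>The partial products of the restricted list keep the point in \<open>A\<close>, where
  the omitted factors act trivially.\<close>

lemma prodl_restr:
  assumes "set ds \<subseteq> tri S" "invariant ds A" "x \<in> A"
  shows "prodl ds x = prodl (restr A ds) x"
  using assms(1,2)
proof (induction ds)
  case (Cons d ds)
  have perm: "prodl (restr A ds) permutes A" using Cons.prems restr_tri by (intro prodl_permutes) auto
  have "set ds \<subseteq> tri S" "invariant ds A" using Cons.prems by (auto simp: invariant_def)
  then have IH: "prodl ds x = prodl (restr A ds) x" by (rule Cons.IH)
  have in_A: "prodl (restr A ds) x \<in> A" using permutes_in_image[OF perm] assms(3) by blast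
  show ?case
  proof (cases "supp d \<subseteq> A")
    case False
    then have "supp d \<inter> A = {}" using Cons.prems by (auto simp: invariant_def)
    then have "d (prodl (restr A ds) x) = prodl (restr A ds) x" using in_A by (auto simp: supp_def)
    then show ?thesis using False IH unfolding prodl_Cons by (simp only: restr_def filter.simps if_False)
  next
    case True
    then show ?thesis using IH unfolding restr_def filter.simps if_P[OF True] prodl_Cons by (rule_tac arg_cong)
  qed
qed (simp add: restr_def)

text \<open>The support of a 3-cycle is nonempty, so it cannot lie in \<open>A\<close> and in
  \<open>S - A\<close> at once: the factors fall into two sublists, each keeping its order.\<close>

lemma shuffle_of_invariant:
  assumes "set ds \<subseteq> tri S" "invariant ds A"
  shows "ds \<in> shuffles (restr A ds) (restr (S - A) ds)"
proof -
  have "filter (\<lambda>d. \<not> supp d \<subseteq> A) ds = restr (S - A) ds"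
    unfolding restr_def
  proof (rule filter_cong)
    fix d assume "d \<in> set ds"
    then show "(\<not> supp d \<subseteq> A) = (supp d \<subseteq> S - A)"
      using assms supp_tri[of d S] unfolding invariant_def by blast
  qed simp
  then show ?thesis using partition_in_shuffles[of ds "\<lambda>d. supp d \<subseteq> A"] by (simp add: restr_def)
qed

lemma orbit_cong_on:
  assumes "finite A" "\<tau> permutes A" "\<And>x. x \<in> A \<Longrightarrow> \<sigma> x = \<tau> x" "a \<in> A"
  shows "orbit \<sigma> a = orbit \<tau> a"
  using assms orbit_subset_of_permutes[OF assms(2,4)] by (intro orbit_cong orbit_self) auto

section \<open>Shuffles of lists on two disjoint sets\<close>

context
  fixes A B :: "'a set" and d1 d2 ds :: "('a \<Rightarrow> 'a) list"
  assumes finA: "finite A" and finB: "finite B" and disj: "A \<inter> B = {}" and d1: "set d1 \<subseteq> tri A"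
    and d2: "set d2 \<subseteq> tri B" and ds: "ds \<in> shuffles d1 d2"
begin

lemma shuffle_tri: "set ds \<subseteq> tri (A \<union> B)"
  using set_shuffles[OF ds] d1 d2 tri_mono[of A "A \<union> B"] tri_mono[of B "A \<union> B"] by auto

lemma shuffle_invariant: "invariant ds A" "invariant ds B"
proof -
  have "supp d \<subseteq> A \<or> supp d \<subseteq> B" if "d \<in> set ds" for d
    using that set_shuffles[OF ds] d1 d2 supp_tri by fast
  then show "invariant ds A" "invariant ds B" unfolding invariant_def using disj by blast+
qed

text \<open>\<open>tri A\<close> and \<open>tri B\<close> are disjoint, so every factor of a shuffle
  betrays the list that it comes from. Hence a shuffle determines both lists.\<close>

lemma shuffle_restr: "restr A ds = d1" "restr B ds = d2"
proof -
  have disj': "set d1 \<inter> set d2 = {}" using d1 d2 tri_disjoint[OF disj] by blast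
  have "restr A ds = filter (\<lambda>d. d \<in> set d1) ds" unfolding restr_def
  proof (rule filter_cong)
    fix d assume "d \<in> set ds"
    then have "d \<in> set d1 \<or> d \<in> set d2" using set_shuffles[OF ds] by auto
    then show "(supp d \<subseteq> A) = (d \<in> set d1)" using d1 d2 supp_tri disj by fast
  qed simp
  then show "restr A ds = d1" using filter_shuffles_disjoint1[OF disj' ds] by simp
  have "restr B ds = filter (\<lambda>d. d \<in> set d2) ds" unfolding restr_def
  proof (rule filter_cong)
    fix d assume "d \<in> set ds"
    then have "d \<in> set d1 \<or> d \<in> set d2" using set_shuffles[OF ds] by auto
    then show "(supp d \<subseteq> B) = (d \<in> set d2)" using d1 d2 supp_tri disj by fast
  qed simp
  then show "restr B ds = d2" using filter_shuffles_disjoint2[OF disj' ds] by simp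
qed

lemma orbit_shuffle:
  shows "a \<in> A \<Longrightarrow> orbit (prodl ds) a = orbit (prodl d1) a"
    and "b \<in> B \<Longrightarrow> orbit (prodl ds) b = orbit (prodl d2) b"
proof -
  show "orbit (prodl ds) a = orbit (prodl d1) a" if "a \<in> A"
    using prodl_restr[OF shuffle_tri shuffle_invariant(1)] that
    by (intro orbit_cong_on[OF finA prodl_permutes[OF d1]]) (auto simp: shuffle_restr)
  show "orbit (prodl ds) b = orbit (prodl d2) b" if "b \<in> B"
    using prodl_restr[OF shuffle_tri shuffle_invariant(2)] that
    by (intro orbit_cong_on[OF finB prodl_permutes[OF d2]]) (auto simp: shuffle_restr)
qed

lemma orbits_shuffle_sub:
  shows "A' \<subseteq> A \<Longrightarrow> orbits (prodl ds) A' = orbits (prodl d1) A'"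
    and "B' \<subseteq> B \<Longrightarrow> orbits (prodl ds) B' = orbits (prodl d2) B'"
  unfolding orbits_def using orbit_shuffle by (intro image_cong; auto)+

lemma orbits_shuffle: "orbits (prodl ds) (A \<union> B) = orbits (prodl d1) A \<union> orbits (prodl d2) B"
  using orbits_shuffle_sub(1)[OF order_refl] orbits_shuffle_sub(2)[OF order_refl]
  by (simp add: orbits_def image_Un)

lemma orbits_subset_Pow: "orbits (prodl d1) A \<subseteq> Pow A - {{}}" "orbits (prodl d2) B \<subseteq> Pow B - {{}}"
  unfolding orbits_def
  using orbit_subset_of_permutes[OF prodl_permutes[OF d1]] orbit_subset_of_permutes[OF prodl_permutes[OF d2]]
    orbit_nonempty by fast+

lemma orbits_shuffle_disjoint: "orbits (prodl d1) A \<inter> orbits (prodl d2) B = {}"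
  using orbits_subset_Pow disj by blast

lemma card_orbits_shuffle:
  "card (orbits (prodl ds) (A \<union> B)) = card (orbits (prodl d1) A) + card (orbits (prodl d2) B)"
  unfolding orbits_shuffle using orbits_shuffle_disjoint finA finB
  by (intro card_Un_disjoint) (auto simp: orbits_def)

end

section \<open>Transitivity classes of a list of 3-cycles\<close>

definition component :: "'a set \<Rightarrow> ('a \<Rightarrow> 'a) list \<Rightarrow> 'a \<Rightarrow> 'a set" where
  "component S ds a = \<Inter>{A. A \<subseteq> S \<and> a \<in> A \<and> invariant ds A}"

lemma component_subset: "a \<in> A \<Longrightarrow> invariant ds A \<Longrightarrow> A \<subseteq> S \<Longrightarrow> component S ds a \<subseteq> A"
  unfolding component_def by blast

lemma component_self: "a \<in> component S ds a"
  unfolding component_def by blast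

context
  fixes S :: "'a set" and ds
  assumes ds: "set ds \<subseteq> tri S"
begin

lemma invariant_whole: "invariant ds S"
  using ds supp_tri unfolding invariant_def by fast

lemma component_subset_whole: "a \<in> S \<Longrightarrow> component S ds a \<subseteq> S"
  by (rule component_subset[OF _ invariant_whole]) auto

lemma component_invariant: "invariant ds (component S ds a)"
  unfolding invariant_def component_def by blast

text \<open>The complement of a class is again invariant. A class based at a point outside another
  class therefore avoids it completely.\<close>

lemma component_eq:
  assumes "a \<in> S" "b \<in> S" "component S ds a \<inter> component S ds b \<noteq> {}"
  shows "component S ds a = component S ds b"
proof -
  have sub: "component S ds x \<subseteq> component S ds y"
    if "x \<in> S" "y \<in> S" "component S ds x \<inter> component S ds y \<noteq> {}" for x y
  proof (cases "x \<in> component S ds y")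
    case True
    then show ?thesis
      by (rule component_subset[OF _ component_invariant component_subset_whole[OF that(2)]])
  next
    case False
    then have "component S ds x \<subseteq> S - component S ds y"
      using component_invariant that(1) ds by (intro component_subset invariant_Diff) auto
    then show ?thesis using that(3) by blast
  qed
  show ?thesis using sub[of a b] sub[of b a] assms by blast
qed

lemma conn_component:
  assumes "a \<in> S"
  shows "conn (component S ds a) (restr (component S ds a) ds)"
  unfolding conn_def
proof (intro conjI allI impI)
  let ?C = "component S ds a"
  show "?C \<noteq> {}" using component_self[of a S ds] by blast
  show "set (restr ?C ds) \<subseteq> tri ?C" by (rule restr_tri[OF ds])
  fix A assume A: "A \<subseteq> ?C" "A \<noteq> {}" "invariant (restr ?C ds) A"
  have inv: "invariant ds A" using A invariant_restr[OF component_invariant] by blast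
  have sub: "A \<subseteq> S" using A component_subset_whole[OF assms] by blast
  show "A = ?C"
  proof (cases "a \<in> A")
    case True
    then show ?thesis using A component_subset[OF _ inv sub] by blast
  next
    case False
    then have "?C \<subseteq> S - A" using inv assms ds by (intro component_subset invariant_Diff) auto
    then show ?thesis using A by blast
  qed
qed

text \<open>Serves to read off the classes from a given shuffle, and hence to prove that the
  decomposition of a list is unique.\<close>

lemma component_unique:
  assumes "A \<subseteq> S" "a \<in> A" "invariant ds A" "conn A (restr A ds)"
  shows "A = component S ds a"
proof
  show sub: "component S ds a \<subseteq> A" using assms by (intro component_subset)
  have "component S ds a \<noteq> {}" using component_self[of a S ds] by blast
  then have "component S ds a = A"
    using sub component_invariant[of a] invariant_restr[OF assms(3) sub]
    by (intro connD[OF assms(4)]) simp_all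
  then show "A \<subseteq> component S ds a" by simp
qed

end

definition shuffles3 :: "'a list \<Rightarrow> 'a list \<Rightarrow> 'a list \<Rightarrow> 'a list set" where
  "shuffles3 xs ys zs = (\<Union>ws\<in>shuffles ys zs. shuffles xs ws)"

text \<open>\<open>P\<close> is left open because the same splitting occurs twice: with
  \<open>conn\<close>, where the genus is arbitrary, and with \<open>is_planar\<close>. Among the
  three points, \<open>c\<close> is the isolated one.\<close>

definition split2 :: "('a set \<Rightarrow> ('a \<Rightarrow> 'a) list \<Rightarrow> bool) \<Rightarrow> 'a set \<Rightarrow> 'a \<Rightarrow> 'a \<Rightarrow> 'a \<Rightarrow> ('a \<Rightarrow> 'a) list \<Rightarrow> bool" where
  "split2 P S a b c ds \<longleftrightarrow> (\<exists>A d1 d2. A \<subseteq> S \<and> P A d1 \<and> P (S - A) d2 \<and> ds \<in> shuffles d1 d2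
     \<and> a \<in> A \<and> b \<in> A \<and> c \<in> S - A)"

definition split3 :: "('a set \<Rightarrow> ('a \<Rightarrow> 'a) list \<Rightarrow> bool) \<Rightarrow> 'a set \<Rightarrow> 'a \<Rightarrow> 'a \<Rightarrow> 'a \<Rightarrow> ('a \<Rightarrow> 'a) list \<Rightarrow> bool" where
  "split3 P S a b c ds \<longleftrightarrow> (\<exists>A B d1 d2 d3. A \<subseteq> S \<and> B \<subseteq> S - A \<and> P A d1 \<and> P B d2 \<and> P (S - A - B) d3
     \<and> ds \<in> shuffles3 d1 d2 d3 \<and> a \<in> A \<and> b \<in> B \<and> c \<in> S - A - B)"

lemma shuffles3E:
  assumes "ds \<in> shuffles3 d1 d2 d3"
  obtains d' where "d' \<in> shuffles d2 d3" "ds \<in> shuffles d1 d'"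
  using assms unfolding shuffles3_def by blast

lemma invariant_shuffle: "ds \<in> shuffles d1 d2 \<Longrightarrow> invariant ds A \<longleftrightarrow> invariant d1 A \<and> invariant d2 A"
  using set_shuffles[of ds d1 d2] unfolding invariant_def by auto

lemma invariant_Int_part:
  assumes "set d1 \<subseteq> tri A" "invariant d1 A'"
  shows "invariant d1 (A' \<inter> A)"
  by (rule invariant_Int[OF assms(2) invariant_whole[OF assms(1)]])

lemma conn_absorb:
  assumes "conn A d1" "invariant d1 A'" "A' \<inter> A \<noteq> {}"
  shows "A \<subseteq> A'"
  using connD[OF assms(1), of "A' \<inter> A"] invariant_Int_part[OF conn_tri[OF assms(1)] assms(2)] assms(3)
  by blast

lemma conn_ConsI:
  assumes abc: "distinct [a, b, c]" "{a, b, c} \<subseteq> S" and ds: "set ds \<subseteq> tri S"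
    and H: "\<And>A'. A' \<subseteq> S \<Longrightarrow> A' \<noteq> {} \<Longrightarrow> invariant ds A' \<Longrightarrow> {a, b, c} \<subseteq> A' \<or> {a, b, c} \<inter> A' = {} \<Longrightarrow> A' = S"
  shows "conn S (cyc3 a b c # ds)"
  unfolding conn_def
proof (intro conjI allI impI)
  show "set (cyc3 a b c # ds) \<subseteq> tri S" using abc(1) triI[OF abc] ds by simp
  show "S \<noteq> {}" using abc by auto
  fix A' assume "A' \<subseteq> S" "A' \<noteq> {}" "invariant (cyc3 a b c # ds) A'"
  then show "A' = S" using H supp_cyc3[OF abc(1)] unfolding invariant_def by simp
qed

text \<open>An invariant set swallows every class that it meets, and the support of the new factor
  has a point in each class. So it contains one point of the support, then the whole support, then
  all classes.\<close>

lemma conn_Cons_if: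
  assumes fin: "finite S" and abc: "distinct [a, b, c]" "{a, b, c} \<subseteq> S"
  shows "conn S ds \<Longrightarrow> conn S (cyc3 a b c # ds)"
    and "split2 conn S a b c ds \<Longrightarrow> conn S (cyc3 a b c # ds)"
    and "split3 conn S a b c ds \<Longrightarrow> conn S (cyc3 a b c # ds)"
proof -
  show "conn S (cyc3 a b c # ds)" if "conn S ds"
    by (rule conn_ConsI[OF abc conn_tri[OF that]]) (rule connD[OF that])
  show "conn S (cyc3 a b c # ds)" if "split2 conn S a b c ds"
  proof -
    from that obtain A d1 d2 where *: "A \<subseteq> S" "conn A d1" "conn (S - A) d2" "ds \<in> shuffles d1 d2"
      "a \<in> A" "b \<in> A" "c \<in> S - A" unfolding split2_def by blast
    show ?thesis
    proof (rule conn_ConsI[OF abc])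
      show "set ds \<subseteq> tri S"
        using set_shuffles[OF *(4)] conn_tri[OF *(2)] conn_tri[OF *(3)] tri_mono[of A S] tri_mono[of "S - A" S] *(1)
        by auto
      fix A' assume A': "A' \<subseteq> S" "A' \<noteq> {}" "invariant ds A'" "{a, b, c} \<subseteq> A' \<or> {a, b, c} \<inter> A' = {}"
      have 1: "A' \<inter> A \<noteq> {} \<Longrightarrow> A \<subseteq> A'" and 2: "A' \<inter> (S - A) \<noteq> {} \<Longrightarrow> S - A \<subseteq> A'"
        using conn_absorb[OF *(2)] conn_absorb[OF *(3)] A'(3) invariant_shuffle[OF *(4)] by blast+
      have "A' \<inter> A \<noteq> {} \<or> A' \<inter> (S - A) \<noteq> {}" using A' by blast
      then have "{a, b, c} \<subseteq> A'" using 1 2 A'(4) *(5-7) by blast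
      then show "A' = S" using 1 2 *(5-7) A'(1) by blast
    qed
  qed
  show "conn S (cyc3 a b c # ds)" if "split3 conn S a b c ds"
  proof -
    from that obtain A B d1 d2 d3 where *: "A \<subseteq> S" "B \<subseteq> S - A" "conn A d1" "conn B d2" "conn (S - A - B) d3"
      "ds \<in> shuffles3 d1 d2 d3" "a \<in> A" "b \<in> B" "c \<in> S - A - B" unfolding split3_def by blast
    obtain d' where d': "d' \<in> shuffles d2 d3" "ds \<in> shuffles d1 d'" by (rule shuffles3E[OF *(6)])
    show ?thesis
    proof (rule conn_ConsI[OF abc])
      have "tri A \<subseteq> tri S" "tri B \<subseteq> tri S" "tri (S - A - B) \<subseteq> tri S" by (rule tri_mono; use * in blast)+
      then show "set ds \<subseteq> tri S"
        using set_shuffles[OF d'(1)] set_shuffles[OF d'(2)] conn_tri[OF *(3)] conn_tri[OF *(4)] conn_tri[OF *(5)]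
        by blast
      fix A' assume A': "A' \<subseteq> S" "A' \<noteq> {}" "invariant ds A'" "{a, b, c} \<subseteq> A' \<or> {a, b, c} \<inter> A' = {}"
      have inv: "invariant d1 A'" "invariant d2 A'" "invariant d3 A'"
        using A'(3) invariant_shuffle[OF d'(1)] invariant_shuffle[OF d'(2)] by auto
      note 1 = conn_absorb[OF *(3) inv(1)] and 2 = conn_absorb[OF *(4) inv(2)] and 3 = conn_absorb[OF *(5) inv(3)]
      have "A' \<inter> A \<noteq> {} \<or> A' \<inter> B \<noteq> {} \<or> A' \<inter> (S - A - B) \<noteq> {}" using A'(1,2) by blast
      then have "a \<in> A' \<or> b \<in> A' \<or> c \<in> A'" using 1 2 3 *(7-9) by blast
      then have "{a, b, c} \<subseteq> A'" using A'(4) by blast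
      then have "A \<subseteq> A'" "B \<subseteq> A'" "S - A - B \<subseteq> A'" using 1 2 3 *(7-9) by blast+
      then show "A' = S" using A'(1) by blast
    qed
  qed
qed

lemma equality_cases:
  "(x = y \<and> y = z) \<or> (x = y \<and> x \<noteq> z) \<or> (y = z \<and> y \<noteq> x) \<or> (z = x \<and> z \<noteq> y) \<or> (x \<noteq> y \<and> y \<noteq> z \<and> x \<noteq> z)"
  by auto

text \<open>The union of the classes of \<open>a\<close>, \<open>b\<close>, \<open>c\<close> is
  invariant under the longer list and therefore equals \<open>S\<close>. So there are at most three
  classes, and the coincidences among them give the cases.\<close>

lemma conn_Cons_cases:
  assumes fin: "finite S" and abc: "distinct [a, b, c]" "{a, b, c} \<subseteq> S"
    and conn: "conn S (cyc3 a b c # ds)"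
  shows "conn S ds \<or> split2 conn S a b c ds \<or> split2 conn S b c a ds \<or> split2 conn S c a b ds
    \<or> split3 conn S a b c ds"
proof -
  have ds: "set ds \<subseteq> tri S" using conn_tri[OF conn] by simp
  define C where "C = component S ds"
  have self: "x \<in> C x" for x unfolding C_def by (rule component_self)
  have inv: "invariant ds (C x)" for x unfolding C_def by (rule component_invariant[OF ds])
  have sub: "C x \<subseteq> S" if "x \<in> S" for x unfolding C_def by (rule component_subset_whole[OF ds that])
  have eq: "C x = C y" if "x \<in> S" "y \<in> S" "C x \<inter> C y \<noteq> {}" for x y
    using component_eq[OF ds that[unfolded C_def]] unfolding C_def .
  have con: "conn (C x) (restr (C x) ds)" if "x \<in> S" for x
    unfolding C_def by (rule conn_component[OF ds that])
  have S: "C a \<union> C b \<union> C c = S"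
  proof (rule connD[OF conn])
    show "invariant (cyc3 a b c # ds) (C a \<union> C b \<union> C c)"
      using invariant_Un[OF invariant_Un[OF inv[of a] inv[of b]] inv[of c]] supp_cyc3[OF abc(1)] self
      unfolding invariant_def by auto
  qed (use sub abc self in auto)
  have two: "split2 conn S x y z ds"
    if "x \<in> S" "y \<in> S" "z \<in> S" "C x = C y" "C x \<noteq> C z" "C x \<union> C y \<union> C z = S" for x y z
  proof -
    have "C x \<inter> C z = {}" using eq[OF that(1,3)] that(5) by argo
    then have Sx: "S - C x = C z" using that(4,6) by auto
    have "ds \<in> shuffles (restr (C x) ds) (restr (C z) ds)"
      using shuffle_of_invariant[OF ds inv[of x]] unfolding Sx .
    moreover have "y \<in> C x" "z \<in> C z" using self[of y] self[of z] that by auto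
    ultimately show ?thesis unfolding split2_def
      using con[OF that(1)] con[OF that(3)] sub[OF that(1)] self[of x]
      by (intro exI[of _ "C x"] exI[of _ "restr (C x) ds"] exI[of _ "restr (C z) ds"]) (simp add: Sx)
  qed
  have abcS: "a \<in> S" "b \<in> S" "c \<in> S" using abc by auto
  from equality_cases[of "C a" "C b" "C c"] show ?thesis
  proof (elim disjE conjE)
    assume 1: "C a = C b" "C b = C c"
    then have "C a = S" using S by auto
    moreover have "restr S ds = ds" using ds supp_tri by (auto simp: restr_def filter_id_conv)
    ultimately show ?thesis using con[OF abcS(1)] by simp
  next
    assume 2: "C a = C b" "C a \<noteq> C c"
    then have "split2 conn S a b c ds" using two[of a b c] abcS S by simp
    then show ?thesis by simp
  next
    assume 3: "C b = C c" "C b \<noteq> C a"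
    then have "split2 conn S b c a ds" using two[of b c a] abcS S by (simp add: Un_ac)
    then show ?thesis by simp
  next
    assume 4: "C c = C a" "C c \<noteq> C b"
    then have "split2 conn S c a b ds" using two[of c a b] abcS S by (simp add: Un_ac)
    then show ?thesis by simp
  next
    assume 5: "C a \<noteq> C b" "C b \<noteq> C c" "C a \<noteq> C c"
    have disj: "C a \<inter> C b = {}" "C a \<inter> C c = {}" "C b \<inter> C c = {}"
      using eq[OF abcS(1,2)] eq[OF abcS(1,3)] eq[OF abcS(2,3)] 5 by argo+
    then have Sab: "S - C a - C b = C c" and B: "C b \<subseteq> S - C a" using S by blast+
    let ?d' = "restr (S - C a) ds"
    have "ds \<in> shuffles (restr (C a) ds) ?d'" by (rule shuffle_of_invariant[OF ds inv])
    moreover have inv': "invariant ds (S - C a)" by (rule invariant_Diff[OF ds inv])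
    have "?d' \<in> shuffles (restr (C b) ?d') (restr (S - C a - C b) ?d')"
      using inv[of b] B by (intro shuffle_of_invariant restr_tri[OF ds]) (simp add: invariant_restr[OF inv'])
    moreover have "restr X ?d' = restr X ds" if "X \<subseteq> S - C a" for X
      using that by (auto simp: restr_def intro!: filter_cong)
    then have "restr (C b) ?d' = restr (C b) ds" "restr (C c) ?d' = restr (C c) ds" using B Sab by blast+
    ultimately have "ds \<in> shuffles3 (restr (C a) ds) (restr (C b) ds) (restr (C c) ds)"
      unfolding shuffles3_def Sab by auto
    then have "split3 conn S a b c ds" unfolding split3_def
      using B con[OF abcS(1)] con[OF abcS(2)] con[OF abcS(3)] sub[OF abcS(1)] self
      by (intro exI[of _ "C a"] exI[of _ "C b"] exI[of _ "restr (C a) ds"] exI[of _ "restr (C b) ds"]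
        exI[of _ "restr (C c) ds"]) (simp add: Sab)
    then show ?thesis by blast
  qed
qed


section \<open>Genus zero\<close>

text \<open>
  Here \<open>a\<close>, \<open>c\<close>, \<open>b\<close> follow each other in this order along a cycle of \<open>\<sigma>\<close>. In the opposite
  cyclic order the product \<open>cyc3 a b c \<circ> \<sigma>\<close> does not cut the cycle: it only rearranges it.
\<close>

definition cut :: "('a \<Rightarrow> 'a) \<Rightarrow> 'a \<Rightarrow> 'a \<Rightarrow> 'a \<Rightarrow> bool" where
  "cut \<sigma> a b c \<longleftrightarrow> (\<exists>i j k. 0 < i \<and> 0 < j \<and> 0 < k \<and> i + j + k = card (orbit \<sigma> a)
     \<and> c = (\<sigma> ^^ i) a \<and> b = (\<sigma> ^^ (i + j)) a)"

text \<open>The prescribed length is \<open>mu3\<close> of the cycle type, put without subtraction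
  or division.\<close>

definition planar :: "'a set \<Rightarrow> ('a \<Rightarrow> 'a) list set" where
  "planar S = {ds. conn S ds \<and> 2 * length ds + 2 = card S + card (orbits (prodl ds) S)}"

section \<open>Change of the number of cycles\<close>

context
  fixes S :: "'a set" and \<sigma> :: "'a \<Rightarrow> 'a"
  assumes fin: "finite S" and perm: "\<sigma> permutes S"
begin

lemma orbits_Diff_disjoint:
  assumes "\<And>x. x \<in> Z \<Longrightarrow> orbit \<sigma> x \<subseteq> Z" "P \<subseteq> Pow Z - {{}}"
  shows "orbits \<sigma> (S - Z) \<inter> P = {}"
proof -
  have "orbit \<sigma> x \<inter> Z = {}" if "x \<in> S - Z" for x
  proof (rule ccontr)
    assume "orbit \<sigma> x \<inter> Z \<noteq> {}"
    then obtain y where y: "y \<in> orbit \<sigma> x" "y \<in> Z" by blast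
    then have "orbit \<sigma> x \<subseteq> Z" using assms(1)[of y] orbit_eq[OF fin perm y(1)] by simp
    then show False using that orbit_self[OF fin perm, of x] by blast
  qed
  then show ?thesis using assms(2) unfolding orbits_def by fast
qed

lemma card_orbits_Un:
  assumes "\<And>x. x \<in> Z \<Longrightarrow> orbit \<sigma> x \<subseteq> Z" "P \<subseteq> Pow Z - {{}}" "finite P"
  shows "card (orbits \<sigma> (S - Z) \<union> P) = card (orbits \<sigma> (S - Z)) + card P"
  using orbits_Diff_disjoint[OF assms(1,2)] assms(3) fin
  by (intro card_Un_disjoint) (auto simp: orbits_def)

lemma orbits_Diff_Un:
  "Z \<subseteq> S \<Longrightarrow> orbits \<sigma> S = orbits \<sigma> (S - Z) \<union> orbits \<sigma> Z"
  unfolding orbits_def by blast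

lemma orbits_orbit: "orbits \<sigma> (orbit \<sigma> a) = {orbit \<sigma> a}"
  unfolding orbits_def using orbit_eq[OF fin perm] orbit_nonempty[of \<sigma> a]
  by (intro image_const_eq) auto

lemma orbit_closed: "x \<in> orbit \<sigma> a \<Longrightarrow> orbit \<sigma> x \<subseteq> orbit \<sigma> a"
  using orbit_eq[OF fin perm] by blast

lemma orbits_Un: "orbits \<sigma> (A \<union> B) = orbits \<sigma> A \<union> orbits \<sigma> B"
  unfolding orbits_def by (rule image_Un)

lemma card_orbits_cyc3_same:
  assumes a: "a \<in> S" and dist: "distinct [a, b, c]" and bc: "b \<in> orbit \<sigma> a" "c \<in> orbit \<sigma> a"
  shows "card (orbits (cyc3 a b c \<circ> \<sigma>) S) = card (orbits \<sigma> S) + (if cut \<sigma> a b c then 2 else 0)"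
proof -
  let ?O = "orbit \<sigma> a"
  have sub: "?O \<subseteq> S" by (rule orbit_subset_of_permutes[OF perm a])
  have old: "card (orbits \<sigma> S) = card (orbits \<sigma> (S - ?O)) + 1"
    unfolding orbits_Diff_Un[OF sub] orbits_orbit
    using card_orbits_Un[OF orbit_closed, where P = "{?O}"] orbit_nonempty[of \<sigma> a] by simp
  show ?thesis
  proof (cases "cut \<sigma> a b c")
    case True
    then obtain i j k where ijk: "0 < i" "0 < j" "0 < k" "i + j + k = card ?O" "c = (\<sigma> ^^ i) a"
      "b = (\<sigma> ^^ (i + j)) a" unfolding cut_def by blast
    obtain X Y Z where new: "orbits (cyc3 a b c \<circ> \<sigma>) S = orbits \<sigma> (S - ?O) \<union> {X, Y, Z}"
      and XYZ: "card X = i" "card Y = j" "card Z = k" "X \<union> Y \<union> Z = ?O" "X \<inter> Y = {}" "X \<inter> Z = {}" "Y \<inter> Z = {}"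
      by (rule orbits_cut_three[OF fin perm a ijk]) blast
    have ne: "X \<noteq> {}" "Y \<noteq> {}" "Z \<noteq> {}" using XYZ ijk by auto
    have "{X, Y, Z} \<subseteq> Pow ?O - {{}}" using XYZ ne by blast
    then have "card (orbits (cyc3 a b c \<circ> \<sigma>) S) = card (orbits \<sigma> (S - ?O)) + card {X, Y, Z}"
      unfolding new using orbit_closed by (intro card_orbits_Un) auto
    moreover have "X \<noteq> Y" "X \<noteq> Z" "Y \<noteq> Z" using XYZ ne by auto
    ultimately show ?thesis using old True by simp
  next
    case False
    let ?m = "card ?O"
    obtain s t where st: "s < ?m" "t < ?m" "b = (\<sigma> ^^ s) a" "c = (\<sigma> ^^ t) a"
      using bc orbit_enum(2)[OF fin perm, of a] by (metis (no_types, lifting) imageE lessThan_iff)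
    have "s \<noteq> 0" "t \<noteq> 0" "s \<noteq> t" using st dist by (auto intro: ccontr)
    \<comment> \<open>With \<open>c\<close> before \<open>b\<close>, the gaps \<open>t\<close>,
      \<open>s - t\<close> and \<open>?m - s\<close> would form a cut.\<close>
    have "\<not> t < s"
    proof
      assume "t < s"
      then have "0 < t \<and> 0 < s - t \<and> 0 < ?m - s \<and> t + (s - t) + (?m - s) = ?m \<and> c = (\<sigma> ^^ t) a
        \<and> b = (\<sigma> ^^ (t + (s - t))) a"
        using st \<open>t \<noteq> 0\<close> by simp
      then show False using False unfolding cut_def by blast
    qed
    then have "0 < s" "s < t" using \<open>s \<noteq> 0\<close> \<open>s \<noteq> t\<close> by auto
    then have "orbits (cyc3 a b c \<circ> \<sigma>) S = orbits \<sigma> (S - ?O) \<union> {?O}"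
      using st by (intro orbits_no_cut[OF fin perm a])
    also have "\<dots> = orbits \<sigma> S" unfolding orbits_Diff_Un[OF sub] orbits_orbit ..
    finally show ?thesis using False by simp
  qed
qed

lemma card_orbits_cyc3_two:
  assumes a: "a \<in> S" and "a \<noteq> b" and b: "b \<in> orbit \<sigma> a" and c: "c \<in> S" "c \<notin> orbit \<sigma> a"
  shows "card (orbits (cyc3 a b c \<circ> \<sigma>) S) = card (orbits \<sigma> S)"
proof -
  let ?A = "orbit \<sigma> a" and ?C = "orbit \<sigma> c"
  have ne: "?C \<noteq> ?A" using c orbit_self[OF fin perm, of c] by blast
  have "?A \<union> ?C \<subseteq> S" using orbit_subset_of_permutes[OF perm] a c by blast
  then have "orbits \<sigma> S = orbits \<sigma> (S - (?A \<union> ?C)) \<union> orbits \<sigma> (?A \<union> ?C)"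
    by (rule orbits_Diff_Un)
  also have "orbits \<sigma> (?A \<union> ?C) = {?A, ?C}" unfolding orbits_Un orbits_orbit by (simp add: insert_commute)
  finally have eq: "orbits \<sigma> S = orbits \<sigma> (S - (?A \<union> ?C)) \<union> {?A, ?C}" .
  have closed: "orbit \<sigma> x \<subseteq> ?A \<union> ?C" if "x \<in> ?A \<union> ?C" for x using that orbit_closed by blast
  have "{?A, ?C} \<subseteq> Pow (?A \<union> ?C) - {{}}" using orbit_nonempty[of \<sigma>] by simp
  then have "card (orbits \<sigma> S) = card (orbits \<sigma> (S - (?A \<union> ?C))) + card {?A, ?C}"
    unfolding eq by (intro card_orbits_Un closed) auto
  then have old: "card (orbits \<sigma> S) = card (orbits \<sigma> (S - (?A \<union> ?C))) + 2" using ne by simp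
  obtain d where d: "d < card ?A" "b = (\<sigma> ^^ d) a"
    using b orbit_enum(2)[OF fin perm, of a] by (metis (no_types, lifting) imageE lessThan_iff)
  then have "0 < d" using \<open>a \<noteq> b\<close> by (auto intro: ccontr)
  obtain X Y where new: "orbits (cyc3 a b c \<circ> \<sigma>) S = orbits \<sigma> (S - (?A \<union> ?C)) \<union> {X, Y}"
    and XY: "card X = card ?A - d" "card Y = d + card ?C" "X \<union> Y = ?A \<union> ?C" "X \<inter> Y = {}"
    by (rule orbits_cut_join[OF fin perm a \<open>0 < d\<close> d c(1) ne]) blast
  have XY_ne: "X \<noteq> {}" "Y \<noteq> {}" using XY d \<open>0 < d\<close> by auto
  then have "{X, Y} \<subseteq> Pow (?A \<union> ?C) - {{}}" using XY by blast
  then have "card (orbits (cyc3 a b c \<circ> \<sigma>) S) = card (orbits \<sigma> (S - (?A \<union> ?C))) + card {X, Y}"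
    unfolding new by (intro card_orbits_Un closed) auto
  moreover have "X \<noteq> Y" using XY XY_ne by blast
  ultimately show ?thesis using old by simp
qed

lemma card_orbits_cyc3_three:
  assumes abc: "a \<in> S" "b \<in> S" "c \<in> S" and ne: "b \<notin> orbit \<sigma> a" "c \<notin> orbit \<sigma> a" "c \<notin> orbit \<sigma> b"
  shows "card (orbits (cyc3 a b c \<circ> \<sigma>) S) + 2 = card (orbits \<sigma> S)"
proof -
  let ?Z = "orbit \<sigma> a \<union> orbit \<sigma> b \<union> orbit \<sigma> c"
  have ne': "orbit \<sigma> a \<noteq> orbit \<sigma> b" "orbit \<sigma> a \<noteq> orbit \<sigma> c" "orbit \<sigma> b \<noteq> orbit \<sigma> c"
    using ne orbit_self[OF fin perm, of b] orbit_self[OF fin perm, of c] by auto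
  have sub: "?Z \<subseteq> S" using orbit_subset_of_permutes[OF perm] abc by blast
  have closed: "orbit \<sigma> x \<subseteq> ?Z" if "x \<in> ?Z" for x using that orbit_closed by blast
  have old_Z: "orbits \<sigma> ?Z = {orbit \<sigma> a, orbit \<sigma> b, orbit \<sigma> c}"
    unfolding orbits_Un orbits_orbit by (simp add: insert_commute)
  have "{orbit \<sigma> a, orbit \<sigma> b, orbit \<sigma> c} \<subseteq> Pow ?Z - {{}}"
    using orbit_nonempty[of \<sigma>] by auto
  then have "card (orbits \<sigma> S) = card (orbits \<sigma> (S - ?Z)) + card {orbit \<sigma> a, orbit \<sigma> b, orbit \<sigma> c}"
    unfolding orbits_Diff_Un[OF sub] old_Z using closed by (intro card_orbits_Un) auto
  moreover have "card (orbits (cyc3 a b c \<circ> \<sigma>) S) = card (orbits \<sigma> (S - ?Z)) + card {?Z}"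
    unfolding orbits_join_three[OF fin perm abc ne'] using closed orbit_nonempty[of \<sigma> a] by (intro card_orbits_Un) auto
  ultimately show ?thesis using ne' by simp
qed

end

section \<open>Additivity over the classes\<close>

lemma conn_prodl_permutes: "conn S ds \<Longrightarrow> prodl ds permutes S"
  by (rule prodl_permutes[OF conn_tri])

text \<open>Sizes, lengths and numbers of cycles add up over the classes. As \<open>c\<close> is in
  another class, it is on another cycle than \<open>a\<close> and \<open>b\<close>; only the
  relative position of \<open>a\<close> and \<open>b\<close> is open.\<close>

lemma split2_numbers:
  assumes fin: "finite S" and abc: "distinct [a, b, c]"
    and A: "A \<subseteq> S" "conn A d1" "conn (S - A) d2" "ds \<in> shuffles d1 d2" "a \<in> A" "b \<in> A" "c \<in> S - A"
  shows "card S = card A + card (S - A)" "length ds = length d1 + length d2"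
    "card (orbits (prodl ds) S) = card (orbits (prodl d1) A) + card (orbits (prodl d2) (S - A))"
    "b \<in> orbit (prodl ds) a \<Longrightarrow> card (orbits (prodl (cyc3 a b c # ds)) S) = card (orbits (prodl ds) S)"
    "b \<notin> orbit (prodl ds) a \<Longrightarrow> card (orbits (prodl (cyc3 a b c # ds)) S) + 2 = card (orbits (prodl ds) S)"
proof -
  have finA: "finite A" "finite (S - A)" using fin A(1) finite_subset by auto
  have un: "A \<union> (S - A) = S" and disj: "A \<inter> (S - A) = {}" using A(1) by auto
  note tri = conn_tri[OF A(2)] conn_tri[OF A(3)]
  note sh = finA disj tri A(4)
  show "card S = card A + card (S - A)" using card_Un_disjoint[OF finA disj] un by simp
  show "length ds = length d1 + length d2" by (rule length_shuffles[OF A(4)])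
  show "card (orbits (prodl ds) S) = card (orbits (prodl d1) A) + card (orbits (prodl d2) (S - A))"
    using card_orbits_shuffle[OF sh] unfolding un .
  have perm: "prodl ds permutes S" using shuffle_tri[OF sh] unfolding un by (rule prodl_permutes)
  have oA: "orbit (prodl ds) x \<subseteq> A" if "x \<in> A" for x
    using orbit_shuffle(1)[OF sh that] orbit_subset_of_permutes[OF prodl_permutes[OF tri(1)] that] by simp
  have cn: "c \<notin> orbit (prodl ds) a" "c \<notin> orbit (prodl ds) b" using oA A(5-7) by auto
  have S: "a \<in> S" "b \<in> S" "c \<in> S" using A by auto
  show "card (orbits (prodl (cyc3 a b c # ds)) S) = card (orbits (prodl ds) S)" if "b \<in> orbit (prodl ds) a"
    using card_orbits_cyc3_two[OF fin perm S(1) _ that S(3) cn(1)] abc by simp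
  show "card (orbits (prodl (cyc3 a b c # ds)) S) + 2 = card (orbits (prodl ds) S)" if "b \<notin> orbit (prodl ds) a"
    using card_orbits_cyc3_three[OF fin perm S that cn] by simp
qed

text \<open>Points of different classes lie on different cycles, so the new factor always joins
  three cycles. The later conclusions locate these cycles inside the classes, as the computation of
  the weights demands.\<close>

lemma split3_numbers:
  assumes fin: "finite S" and abc: "distinct [a, b, c]"
    and A: "A \<subseteq> S" "B \<subseteq> S - A" "conn A d1" "conn B d2" "conn (S - A - B) d3" "ds \<in> shuffles3 d1 d2 d3"
      "a \<in> A" "b \<in> B" "c \<in> S - A - B"
  shows "card S = card A + card B + card (S - A - B)" "length ds = length d1 + length d2 + length d3"
    "card (orbits (prodl ds) S) = card (orbits (prodl d1) A) + card (orbits (prodl d2) B)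
      + card (orbits (prodl d3) (S - A - B))"
    "card (orbits (prodl (cyc3 a b c # ds)) S) + 2 = card (orbits (prodl ds) S)"
    "orbit (prodl ds) a = orbit (prodl d1) a" "orbit (prodl ds) b = orbit (prodl d2) b"
    "orbit (prodl ds) c = orbit (prodl d3) c"
    "orbits (prodl ds) (S - (orbit (prodl ds) a \<union> orbit (prodl ds) b \<union> orbit (prodl ds) c))
      = orbits (prodl d1) (A - orbit (prodl d1) a) \<union> orbits (prodl d2) (B - orbit (prodl d2) b)
        \<union> orbits (prodl d3) (S - A - B - orbit (prodl d3) c)"
    "prodl ds permutes S"
    "b \<notin> orbit (prodl ds) a" "c \<notin> orbit (prodl ds) a" "c \<notin> orbit (prodl ds) b"
proof -
  let ?C = "S - A - B"
  obtain d' where d': "d' \<in> shuffles d2 d3" "ds \<in> shuffles d1 d'" by (rule shuffles3E[OF A(6)])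
  have finA: "finite A" "finite (S - A)" "finite B" "finite ?C"
    using fin finite_subset[OF A(1)] finite_subset[OF A(2)] by auto
  have un: "A \<union> (S - A) = S" and disj: "A \<inter> (S - A) = {}" using A(1) by auto
  have un': "B \<union> ?C = S - A" and disj': "B \<inter> ?C = {}" using A(2) by auto
  note tri = conn_tri[OF A(3)] conn_tri[OF A(4)] conn_tri[OF A(5)]
  note sh' = finA(3,4) disj' tri(2,3) d'(1)
  have tri': "set d' \<subseteq> tri (S - A)" using shuffle_tri[OF sh'] unfolding un' .
  note sh = finA(1,2) disj tri(1) tri' d'(2)
  show "card S = card A + card B + card ?C"
    using card_Un_disjoint[OF finA(1,2) disj] card_Un_disjoint[OF finA(3,4) disj'] un un' by simp
  show "length ds = length d1 + length d2 + length d3"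
    using length_shuffles[OF d'(1)] length_shuffles[OF d'(2)] by simp
  show "card (orbits (prodl ds) S) = card (orbits (prodl d1) A) + card (orbits (prodl d2) B)
      + card (orbits (prodl d3) ?C)"
    using card_orbits_shuffle[OF sh] card_orbits_shuffle[OF sh'] unfolding un un' by simp
  show perm: "prodl ds permutes S" using shuffle_tri[OF sh] unfolding un by (rule prodl_permutes)
  have oA: "orbit (prodl ds) x = orbit (prodl d1) x" "orbit (prodl d1) x \<subseteq> A" if "x \<in> A" for x
    using orbit_shuffle(1)[OF sh that] orbit_subset_of_permutes[OF prodl_permutes[OF tri(1)] that] by simp_all
  have oB: "orbit (prodl ds) x = orbit (prodl d2) x" "orbit (prodl d2) x \<subseteq> B" if "x \<in> B" for x
    using orbit_shuffle(2)[OF sh, of x] orbit_shuffle(1)[OF sh' that]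
      orbit_subset_of_permutes[OF prodl_permutes[OF tri(2)] that] that A(2) by auto
  have oC: "orbit (prodl ds) x = orbit (prodl d3) x" "orbit (prodl d3) x \<subseteq> ?C" if "x \<in> ?C" for x
    using orbit_shuffle(2)[OF sh, of x] orbit_shuffle(2)[OF sh' that]
      orbit_subset_of_permutes[OF prodl_permutes[OF tri(3)] that] that by auto
  show oa: "orbit (prodl ds) a = orbit (prodl d1) a" and ob: "orbit (prodl ds) b = orbit (prodl d2) b"
    and oc: "orbit (prodl ds) c = orbit (prodl d3) c"
    by (rule oA(1)[OF A(7)] oB(1)[OF A(8)] oC(1)[OF A(9)])+
  have sub: "orbit (prodl d1) a \<subseteq> A" "orbit (prodl d2) b \<subseteq> B" "orbit (prodl d3) c \<subseteq> ?C"
    by (rule oA(2)[OF A(7)] oB(2)[OF A(8)] oC(2)[OF A(9)])+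
  show ne: "b \<notin> orbit (prodl ds) a" "c \<notin> orbit (prodl ds) a" "c \<notin> orbit (prodl ds) b"
    using sub A(2,7-9) unfolding oa ob by blast+
  have "S - (orbit (prodl ds) a \<union> orbit (prodl ds) b \<union> orbit (prodl ds) c)
      = (A - orbit (prodl d1) a) \<union> (B - orbit (prodl d2) b) \<union> (?C - orbit (prodl d3) c)"
    unfolding oa ob oc using sub A(1,2) by blast
  then have eq: "orbits (prodl ds) (S - (orbit (prodl ds) a \<union> orbit (prodl ds) b \<union> orbit (prodl ds) c))
      = orbits (prodl ds) (A - orbit (prodl d1) a) \<union> orbits (prodl ds) (B - orbit (prodl d2) b)
        \<union> orbits (prodl ds) (?C - orbit (prodl d3) c)"
    unfolding orbits_def by (simp only: image_Un)
  have "orbits (prodl ds) (A - orbit (prodl d1) a) = orbits (prodl d1) (A - orbit (prodl d1) a)"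
    "orbits (prodl ds) (B - orbit (prodl d2) b) = orbits (prodl d2) (B - orbit (prodl d2) b)"
    "orbits (prodl ds) (?C - orbit (prodl d3) c) = orbits (prodl d3) (?C - orbit (prodl d3) c)"
    unfolding orbits_def using oA(1) oB(1) oC(1) by (intro image_cong; blast)+
  then show "orbits (prodl ds) (S - (orbit (prodl ds) a \<union> orbit (prodl ds) b \<union> orbit (prodl ds) c))
      = orbits (prodl d1) (A - orbit (prodl d1) a) \<union> orbits (prodl d2) (B - orbit (prodl d2) b)
        \<union> orbits (prodl d3) (?C - orbit (prodl d3) c)"
    unfolding eq by simp
  have S: "a \<in> S" "b \<in> S" "c \<in> S" using A by auto
  show "card (orbits (prodl (cyc3 a b c # ds)) S) + 2 = card (orbits (prodl ds) S)"
    using card_orbits_cyc3_three[OF fin perm S ne] by simp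
qed

text \<open>\<open>cut\<close> forces all three points onto one cycle and so describes exactly the
  gain of two cycles. If just two of the points share a cycle, a rotation of the 3-cycle brings them
  to the front.\<close>

lemma conn_cyc3_numbers:
  assumes fin: "finite S" and abc: "distinct [a, b, c]" "{a, b, c} \<subseteq> S" and conn: "conn S ds"
  shows "card (orbits (prodl (cyc3 a b c # ds)) S) = card (orbits (prodl ds) S) + 2 \<and> cut (prodl ds) a b c
    \<or> card (orbits (prodl (cyc3 a b c # ds)) S) = card (orbits (prodl ds) S) \<and> \<not> cut (prodl ds) a b c
    \<or> card (orbits (prodl (cyc3 a b c # ds)) S) + 2 = card (orbits (prodl ds) S) \<and> \<not> cut (prodl ds) a b c"
proof -
  let ?\<sigma> = "prodl ds"
  have perm: "?\<sigma> permutes S" by (rule conn_prodl_permutes[OF conn])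
  have S: "a \<in> S" "b \<in> S" "c \<in> S" using abc by auto
  have dist: "a \<noteq> b" "b \<noteq> c" "c \<noteq> a" using abc by auto
  have cutD: "b \<in> orbit ?\<sigma> a \<and> c \<in> orbit ?\<sigma> a" if "cut ?\<sigma> a b c"
    using that funpow_in[OF fin perm] unfolding cut_def by blast
  have sym: "x \<in> orbit ?\<sigma> y \<longleftrightarrow> y \<in> orbit ?\<sigma> x" for x y
    using orbit_eq[OF fin perm, of x y] orbit_eq[OF fin perm, of y x] orbit_self[OF fin perm, of x]
      orbit_self[OF fin perm, of y] by blast
  have trans: "x \<in> orbit ?\<sigma> z" if "x \<in> orbit ?\<sigma> y" "y \<in> orbit ?\<sigma> z" for x y z
    using that by (rule orbit_trans)
  have rot1: "prodl (cyc3 a b c # ds) = cyc3 b c a \<circ> ?\<sigma>" and rot2: "prodl (cyc3 a b c # ds) = cyc3 c a b \<circ> ?\<sigma>"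
    using cyc3_rotate[of a b c] cyc3_rotate[of b c a] abc(1) by auto
  consider "b \<in> orbit ?\<sigma> a" "c \<in> orbit ?\<sigma> a" | "b \<in> orbit ?\<sigma> a" "c \<notin> orbit ?\<sigma> a"
    | "b \<notin> orbit ?\<sigma> a" "c \<in> orbit ?\<sigma> a" | "b \<notin> orbit ?\<sigma> a" "c \<notin> orbit ?\<sigma> a" "c \<in> orbit ?\<sigma> b"
    | "b \<notin> orbit ?\<sigma> a" "c \<notin> orbit ?\<sigma> a" "c \<notin> orbit ?\<sigma> b"
    by argo
  then show ?thesis
  proof cases
    case 1
    then show ?thesis using card_orbits_cyc3_same[OF fin perm S(1) abc(1)] by (simp split: if_splits)
  next
    case 2
    then show ?thesis using card_orbits_cyc3_two[OF fin perm S(1) dist(1) _ S(3)] cutD by auto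
  next
    case 3
    have "card (orbits (cyc3 c a b \<circ> ?\<sigma>) S) = card (orbits ?\<sigma> S)"
      by (rule card_orbits_cyc3_two[OF fin perm S(3) dist(3) _ S(2)])
        (use 3 sym[of a c] trans[of b c a] in blast)+
    then show ?thesis using 3 cutD unfolding rot2 by blast
  next
    case 4
    have "card (orbits (cyc3 b c a \<circ> ?\<sigma>) S) = card (orbits ?\<sigma> S)"
      by (rule card_orbits_cyc3_two[OF fin perm S(2) dist(2) _ S(1)]) (use 4 sym[of a b] in blast)+
    then show ?thesis using 4 cutD unfolding rot1 by blast
  next
    case 5
    then show ?thesis using card_orbits_cyc3_three[OF fin perm S] cutD by auto
  qed
qed

text \<open>The bound contains a constant 2 for every class. After one more factor it is
  \<open>2 * k + 4\<close>. A single class starts from \<open>2 * k + 2\<close> and gains at most 2;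
  two classes start from \<open>2 * k + 4\<close> and gain nothing; three start from
  \<open>2 * k + 6\<close> and lose 2.\<close>

lemma bound_step1:
  fixes s l l' k :: nat
  assumes "even (s + l)" "s + l \<le> 2 * k + 2" "l' = l + 2 \<or> l' = l \<or> l' + 2 = l"
  shows "even (s + l') \<and> s + l' \<le> 2 * Suc k + 2"
  using assms by (elim disjE) auto

lemma bound_step2:
  fixes s l l' k :: nat
  assumes "even (s1 + l1)" "s1 + l1 \<le> 2 * k1 + 2" "even (s2 + l2)" "s2 + l2 \<le> 2 * k2 + 2"
    "s = s1 + s2" "k = k1 + k2" "l = l1 + l2" "l' = l \<or> l' + 2 = l"
  shows "even (s + l') \<and> s + l' \<le> 2 * Suc k + 2"
proof -
  have "s + l = (s1 + l1) + (s2 + l2)" using assms(5,7) by simp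
  then have "even (s + l)" using assms(1,3) by simp
  have "s + l = s + l' \<or> s + l = (s + l') + 2" using assms(8) by auto
  then have "even (s + l')" using \<open>even (s + l)\<close> even_add[of "s + l'" 2] by (elim disjE) auto
  moreover have "s + l' \<le> 2 * k + 4" using assms(2,4-8) by linarith
  ultimately show ?thesis by simp
qed

lemma bound_step3:
  fixes s l l' k :: nat
  assumes "even (s1 + l1)" "s1 + l1 \<le> 2 * k1 + 2" "even (s2 + l2)" "s2 + l2 \<le> 2 * k2 + 2"
    "even (s3 + l3)" "s3 + l3 \<le> 2 * k3 + 2"
    "s = s1 + s2 + s3" "k = k1 + k2 + k3" "l = l1 + l2 + l3" "l' + 2 = l"
  shows "even (s + l') \<and> s + l' \<le> 2 * Suc k + 2"
proof -
  have eq: "s + l' + 2 = (s1 + l1) + (s2 + l2) + (s3 + l3)" using assms(7,9,10) by simp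
  then have "even (s + l' + 2)" using assms(1,3,5) by simp
  then have "even (s + l')" unfolding even_add[of _ 2] by simp
  moreover have "s + l' \<le> 2 * k + 4" using eq assms(2,4,6,8) by linarith
  ultimately show ?thesis by simp
qed

text \<open>
  The Riemann--Hurwitz inequality; the difference of the two sides is twice the genus, so the
  lists in \<open>planar S\<close> are those of genus 0.
\<close>

lemma conn_bound:
  assumes "finite S" "conn S ds"
  shows "even (card S + card (orbits (prodl ds) S))"
    and "card S + card (orbits (prodl ds) S) \<le> 2 * length ds + 2"
proof -
  have "even (card S + card (orbits (prodl ds) S)) \<and> card S + card (orbits (prodl ds) S) \<le> 2 * length ds + 2"
    using assms
  proof (induction "length ds" arbitrary: S ds rule: less_induct)
    case less
    show ?case
    proof (cases ds)
      case Nil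
      \<comment> \<open>Without factors every singleton is invariant, so \<open>S\<close> is one
        point with one cycle, and the bound is attained.\<close>
      obtain x where x: "x \<in> S" using conn_nonempty[OF less.prems(2)] by blast
      have "{x} = S" using x by (intro connD[OF less.prems(2)]) (auto simp: Nil invariant_def)
      then have "card S = 1" by auto
      moreover have "orbits (prodl ds) S = {orbit (prodl ds) x}" using \<open>{x} = S\<close> by (auto simp: orbits_def)
      ultimately show ?thesis by simp
    next
      case (Cons d es)
      then have "d \<in> tri S" using conn_tri[OF less.prems(2)] by simp
      then obtain a b c where d: "d = cyc3 a b c" "distinct [a, b, c]" "{a, b, c} \<subseteq> S" by (auto elim!: triE)
      \<comment> \<open>Stated for \<open>x\<close>, \<open>y\<close>, \<open>z\<close> because the
        isolated point may be any of the three.\<close>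
      have two: ?thesis if sp: "split2 conn S x y z es" and d': "d = cyc3 x y z" "distinct [x, y, z]" for x y z
      proof -
        obtain A d1 d2 where *: "A \<subseteq> S" "conn A d1" "conn (S - A) d2" "es \<in> shuffles d1 d2"
          "x \<in> A" "y \<in> A" "z \<in> S - A" using sp unfolding split2_def by blast
        note n = split2_numbers[OF less.prems(1) d'(2) *]
        have fin: "finite A" "finite (S - A)" using less.prems(1) *(1) finite_subset by auto
        have "length d1 < length ds" "length d2 < length ds" using n(2) Cons by auto
        then have IH: "even (card A + card (orbits (prodl d1) A))"
          "card A + card (orbits (prodl d1) A) \<le> 2 * length d1 + 2"
          "even (card (S - A) + card (orbits (prodl d2) (S - A)))"
          "card (S - A) + card (orbits (prodl d2) (S - A)) \<le> 2 * length d2 + 2"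
          using less.hyps[OF _ fin(1) *(2)] less.hyps[OF _ fin(2) *(3)] by blast+
        have "card (orbits (prodl (cyc3 x y z # es)) S) = card (orbits (prodl es) S)
            \<or> card (orbits (prodl (cyc3 x y z # es)) S) + 2 = card (orbits (prodl es) S)"
          using n(4,5) by blast
        from bound_step2[OF IH n(1-3) this] show ?thesis unfolding Cons d'(1) by simp
      qed
      have "conn S es \<or> split2 conn S a b c es \<or> split2 conn S b c a es \<or> split2 conn S c a b es
        \<or> split3 conn S a b c es"
        using conn_Cons_cases[OF less.prems(1) d(2,3)] less.prems(2) unfolding Cons d(1) by blast
      then show ?thesis
      proof (elim disjE)
        assume "conn S es"
        have IH: "even (card S + card (orbits (prodl es) S))"
          "card S + card (orbits (prodl es) S) \<le> 2 * length es + 2"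
          using less.hyps[OF _ less.prems(1) \<open>conn S es\<close>] by (simp_all add: Cons)
        have "card (orbits (prodl (cyc3 a b c # es)) S) = card (orbits (prodl es) S) + 2
            \<or> card (orbits (prodl (cyc3 a b c # es)) S) = card (orbits (prodl es) S)
            \<or> card (orbits (prodl (cyc3 a b c # es)) S) + 2 = card (orbits (prodl es) S)"
          using conn_cyc3_numbers[OF less.prems(1) d(2,3) \<open>conn S es\<close>] by blast
        from bound_step1[OF IH this] show ?thesis unfolding Cons d(1) by simp
      next
        assume "split2 conn S a b c es"
        then show ?thesis by (rule two) (fact d)+
      next
        assume "split2 conn S b c a es"
        then show ?thesis by (rule two) (use d cyc3_rotate[of a b c] in auto)
      next
        assume "split2 conn S c a b es"
        then show ?thesis by (rule two) (use d cyc3_rotate[of a b c] cyc3_rotate[of b c a] in auto)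
      next
        assume "split3 conn S a b c es"
        then obtain A B d1 d2 d3 where *: "A \<subseteq> S" "B \<subseteq> S - A" "conn A d1" "conn B d2" "conn (S - A - B) d3"
          "es \<in> shuffles3 d1 d2 d3" "a \<in> A" "b \<in> B" "c \<in> S - A - B" unfolding split3_def by blast
        note n = split3_numbers(1-4)[OF less.prems(1) d(2) *]
        have fin: "finite A" "finite B" "finite (S - A - B)"
          using finite_subset[OF *(1) less.prems(1)] finite_subset[OF *(2)] less.prems(1) by auto
        have "length d1 < length ds" "length d2 < length ds" "length d3 < length ds" using n(2) Cons by auto
        then have IH: "even (card A + card (orbits (prodl d1) A))"
          "card A + card (orbits (prodl d1) A) \<le> 2 * length d1 + 2"
          "even (card B + card (orbits (prodl d2) B))"
          "card B + card (orbits (prodl d2) B) \<le> 2 * length d2 + 2"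
          "even (card (S - A - B) + card (orbits (prodl d3) (S - A - B)))"
          "card (S - A - B) + card (orbits (prodl d3) (S - A - B)) \<le> 2 * length d3 + 2"
          using less.hyps[OF _ fin(1) *(3)] less.hyps[OF _ fin(2) *(4)] less.hyps[OF _ fin(3) *(5)] by blast+
        from bound_step3[OF IH n] show ?thesis unfolding Cons d(1) by simp
      qed
    qed
  qed
  then show "even (card S + card (orbits (prodl ds) S))"
    and "card S + card (orbits (prodl ds) S) \<le> 2 * length ds + 2" by auto
qed

section \<open>Removing the first factor of a planar list\<close>

lemma planar_iff: "ds \<in> planar S \<longleftrightarrow> conn S ds \<and> 2 * length ds + 2 = card S + card (orbits (prodl ds) S)"
  by (simp add: planar_def)

abbreviation "is_planar S ds \<equiv> ds \<in> planar S"

lemma split_planar_imp_conn: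
  "split2 is_planar S a b c ds \<Longrightarrow> split2 conn S a b c ds"
  "split3 is_planar S a b c ds \<Longrightarrow> split3 conn S a b c ds"
  unfolding split2_def split3_def planar_iff by blast+

text \<open>The whole attains the bound only if both classes do and no cycle is lost. If
  \<open>b\<close> were on another cycle than \<open>a\<close>, three cycles would be joined and the
  total would fall short by 2.\<close>

lemma planar_split2:
  assumes fin: "finite S" and abc: "distinct [a, b, c]" "{a, b, c} \<subseteq> S"
  shows "cyc3 a b c # ds \<in> planar S \<Longrightarrow> split2 conn S a b c ds \<Longrightarrow>
      split2 is_planar S a b c ds \<and> b \<in> orbit (prodl ds) a"
    and "split2 is_planar S a b c ds \<Longrightarrow> b \<in> orbit (prodl ds) a \<Longrightarrow> cyc3 a b c # ds \<in> planar S"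
proof -
  show "split2 is_planar S a b c ds \<and> b \<in> orbit (prodl ds) a"
    if pl: "cyc3 a b c # ds \<in> planar S" and sp: "split2 conn S a b c ds"
  proof -
    obtain A d1 d2 where *: "A \<subseteq> S" "conn A d1" "conn (S - A) d2" "ds \<in> shuffles d1 d2"
      "a \<in> A" "b \<in> A" "c \<in> S - A" using sp unfolding split2_def by blast
    note n = split2_numbers[OF fin abc(1) *]
    have finA: "finite A" "finite (S - A)" using fin *(1) finite_subset by auto
    note b = conn_bound(2)[OF finA(1) *(2)] conn_bound(2)[OF finA(2) *(3)]
    have pl': "2 * length ds + 4 = card S + card (orbits (prodl (cyc3 a b c # ds)) S)"
      using pl unfolding planar_iff by simp
    have orb: "b \<in> orbit (prodl ds) a"
    proof (rule ccontr)
      assume "b \<notin> orbit (prodl ds) a"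
      from n(5)[OF this] n(1-3) b pl' show False by linarith
    qed
    then have "2 * length d1 + 2 = card A + card (orbits (prodl d1) A)"
      "2 * length d2 + 2 = card (S - A) + card (orbits (prodl d2) (S - A))"
      using n(4)[OF orb] n(1-3) b pl' by linarith+
    then have "d1 \<in> planar A" "d2 \<in> planar (S - A)" using * unfolding planar_iff by blast+
    then show ?thesis using orb * unfolding split2_def by blast
  qed
  show "cyc3 a b c # ds \<in> planar S"
    if sp: "split2 is_planar S a b c ds" and orb: "b \<in> orbit (prodl ds) a"
  proof -
    obtain A d1 d2 where *: "A \<subseteq> S" "d1 \<in> planar A" "d2 \<in> planar (S - A)" "ds \<in> shuffles d1 d2"
      "a \<in> A" "b \<in> A" "c \<in> S - A" using sp unfolding split2_def by blast
    note pl = *(2,3)[unfolded planar_iff]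
    note n = split2_numbers[OF fin abc(1) *(1) conjunct1[OF pl(1)] conjunct1[OF pl(2)] *(4-7)]
    have "conn S (cyc3 a b c # ds)" by (rule conn_Cons_if(2)[OF fin abc split_planar_imp_conn(1)[OF sp]])
    moreover have "2 * length (cyc3 a b c # ds) + 2 = card S + card (orbits (prodl (cyc3 a b c # ds)) S)"
    proof -
      have "2 * length ds + 4 = card S + card (orbits (prodl (cyc3 a b c # ds)) S)"
        using n(4)[OF orb] n(1-3) conjunct2[OF pl(1)] conjunct2[OF pl(2)] by linarith
      then show ?thesis by simp
    qed
    ultimately show ?thesis unfolding planar_iff by blast
  qed
qed

text \<open>Joining three cycles consumes exactly the surplus 2 that the third class brings, so the
  whole attains the bound if and only if every class does.\<close>

lemma planar_split3:
  assumes fin: "finite S" and abc: "distinct [a, b, c]" "{a, b, c} \<subseteq> S"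
  shows "cyc3 a b c # ds \<in> planar S \<Longrightarrow> split3 conn S a b c ds \<Longrightarrow> split3 is_planar S a b c ds"
    and "split3 is_planar S a b c ds \<Longrightarrow> cyc3 a b c # ds \<in> planar S"
proof -
  show "split3 is_planar S a b c ds"
    if pl: "cyc3 a b c # ds \<in> planar S" and sp: "split3 conn S a b c ds"
  proof -
    obtain A B d1 d2 d3 where *: "A \<subseteq> S" "B \<subseteq> S - A" "conn A d1" "conn B d2" "conn (S - A - B) d3"
      "ds \<in> shuffles3 d1 d2 d3" "a \<in> A" "b \<in> B" "c \<in> S - A - B" using sp unfolding split3_def by blast
    note n = split3_numbers(1-4)[OF fin abc(1) *]
    have finA: "finite A" "finite B" "finite (S - A - B)"
      using finite_subset[OF *(1) fin] finite_subset[OF *(2)] fin by auto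
    note b = conn_bound(2)[OF finA(1) *(3)] conn_bound(2)[OF finA(2) *(4)] conn_bound(2)[OF finA(3) *(5)]
    have pl': "2 * length ds + 4 = card S + card (orbits (prodl (cyc3 a b c # ds)) S)"
      using pl unfolding planar_iff by simp
    have "2 * length d1 + 2 = card A + card (orbits (prodl d1) A)"
      "2 * length d2 + 2 = card B + card (orbits (prodl d2) B)"
      "2 * length d3 + 2 = card (S - A - B) + card (orbits (prodl d3) (S - A - B))"
      using n b pl' by linarith+
    then have "d1 \<in> planar A" "d2 \<in> planar B" "d3 \<in> planar (S - A - B)" using * unfolding planar_iff by blast+
    then show ?thesis using * unfolding split3_def by blast
  qed
  show "cyc3 a b c # ds \<in> planar S" if sp: "split3 is_planar S a b c ds"
  proof -
    obtain A B d1 d2 d3 where *: "A \<subseteq> S" "B \<subseteq> S - A" "d1 \<in> planar A" "d2 \<in> planar B" "d3 \<in> planar (S - A - B)"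
      "ds \<in> shuffles3 d1 d2 d3" "a \<in> A" "b \<in> B" "c \<in> S - A - B" using sp unfolding split3_def by blast
    note pl = *(3-5)[unfolded planar_iff]
    note n = split3_numbers(1-4)[OF fin abc(1) *(1,2) conjunct1[OF pl(1)] conjunct1[OF pl(2)] conjunct1[OF pl(3)] *(6-9)]
    have "conn S (cyc3 a b c # ds)" by (rule conn_Cons_if(3)[OF fin abc split_planar_imp_conn(2)[OF sp]])
    moreover have "2 * length (cyc3 a b c # ds) + 2 = card S + card (orbits (prodl (cyc3 a b c # ds)) S)"
    proof -
      have "2 * length ds + 4 = card S + card (orbits (prodl (cyc3 a b c # ds)) S)"
        using n conjunct2[OF pl(1)] conjunct2[OF pl(2)] conjunct2[OF pl(3)] by linarith
      then show ?thesis by simp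
    qed
    ultimately show ?thesis unfolding planar_iff by blast
  qed
qed

text \<open>If \<open>ds\<close> is already connected, the bound for \<open>ds\<close> forces the
  extra factor to raise the number of cycles by 2, and only a cut does so.\<close>

lemma planar_cut:
  assumes fin: "finite S" and abc: "distinct [a, b, c]" "{a, b, c} \<subseteq> S"
  shows "cyc3 a b c # ds \<in> planar S \<Longrightarrow> conn S ds \<Longrightarrow> ds \<in> planar S \<and> cut (prodl ds) a b c"
    and "ds \<in> planar S \<Longrightarrow> cut (prodl ds) a b c \<Longrightarrow> cyc3 a b c # ds \<in> planar S"
proof -
  show "ds \<in> planar S \<and> cut (prodl ds) a b c" if pl: "cyc3 a b c # ds \<in> planar S" and conn: "conn S ds"
  proof -
    have len: "2 * length ds + 4 = card S + card (orbits (prodl (cyc3 a b c # ds)) S)"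
      using pl unfolding planar_iff by simp
    from conn_cyc3_numbers[OF fin abc conn] show ?thesis
      using conn_bound(2)[OF fin conn] len conn unfolding planar_iff
      by (elim disjE conjE; intro conjI) (assumption | linarith)+
  qed
  show "cyc3 a b c # ds \<in> planar S" if pl: "ds \<in> planar S" and "cut (prodl ds) a b c"
    using conn_cyc3_numbers[OF fin abc, of ds] conn_Cons_if(1)[OF fin abc, of ds] that
    unfolding planar_iff list.size by auto
qed

text \<open>The two-class case appears three times, once for each point that may be the isolated
  one.\<close>

lemma planar_Cons_iff:
  assumes fin: "finite S" and abc: "distinct [a, b, c]" "{a, b, c} \<subseteq> S"
  shows "cyc3 a b c # ds \<in> planar S \<longleftrightarrow>
    (ds \<in> planar S \<and> cut (prodl ds) a b c)
    \<or> (split2 is_planar S a b c ds \<and> b \<in> orbit (prodl ds) a)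
    \<or> (split2 is_planar S b c a ds \<and> c \<in> orbit (prodl ds) b)
    \<or> (split2 is_planar S c a b ds \<and> a \<in> orbit (prodl ds) c)
    \<or> split3 is_planar S a b c ds" (is "?L \<longleftrightarrow> ?R")
proof -
  have abc1: "distinct [b, c, a]" "{b, c, a} \<subseteq> S" and abc2: "distinct [c, a, b]" "{c, a, b} \<subseteq> S"
    using abc by auto
  have rot: "cyc3 b c a = cyc3 a b c" "cyc3 c a b = cyc3 a b c"
    using cyc3_rotate[of a b c] cyc3_rotate[of b c a] abc(1) by auto
  show ?thesis
  proof
    assume pl: ?L
    then have "conn S (cyc3 a b c # ds)" unfolding planar_iff by blast
    from conn_Cons_cases[OF fin abc this] show ?R
      using planar_cut(1)[OF fin abc pl] planar_split2(1)[OF fin abc pl]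
        planar_split2(1)[OF fin abc1, unfolded rot, OF pl] planar_split2(1)[OF fin abc2, unfolded rot, OF pl]
        planar_split3(1)[OF fin abc pl] by blast
  next
    assume ?R
    then show ?L
      using planar_cut(2)[OF fin abc] planar_split2(2)[OF fin abc]
        planar_split2(2)[OF fin abc1, unfolded rot] planar_split2(2)[OF fin abc2, unfolded rot]
        planar_split3(2)[OF fin abc] by blast
  qed
qed


section \<open>Weights\<close>

lemma scalar_mult: "scalar x * scalar y = scalar (x * y)"
  by (simp add: scalar_def mult_single)

lemma scalar_of_nat: "scalar (of_nat n) = of_nat n"
  by (simp add: scalar_def)

lemma of_nat_mult_scalar: "of_nat n * scalar x = scalar (of_nat n * x)"
  unfolding scalar_of_nat[symmetric] scalar_mult ..

definition mon :: "'a set set \<Rightarrow> ppoly" where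
  "mon C = (\<Prod>X\<in>C. p_var (card X))"

definition wt :: "'a list \<Rightarrow> ppoly" where
  "wt ds = scalar (1 / fact (length ds))"

definition pointed :: "'a set \<Rightarrow> (('a \<Rightarrow> 'a) list \<times> 'a) set" where
  "pointed S = planar S \<times> S"

definition cycle_len :: "('a \<Rightarrow> 'a) list \<times> 'a \<Rightarrow> nat" where
  "cycle_len x = card (orbit (prodl (fst x)) (snd x))"

definition rest :: "'a set \<Rightarrow> ('a \<Rightarrow> 'a) list \<times> 'a \<Rightarrow> ppoly" where
  "rest S x = mon (orbits (prodl (fst x)) (S - orbit (prodl (fst x)) (snd x)))"

definition val :: "'a set \<Rightarrow> ('a \<Rightarrow> 'a) list \<times> 'a \<Rightarrow> ppoly" where
  "val S x = wt (fst x) * rest S x"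

text \<open>
  Marking a point on a cycle of length \<open>i\<close> and deleting the variable of that cycle is
  \<open>i \<partial>/\<partial>p\<^sub>i\<close>: the exponential generating function of \<open>ptd {1..n} i\<close> is \<open>i \<partial>F\<^sub>3/\<partial>p\<^sub>i\<close>.
\<close>

definition ptd :: "'a set \<Rightarrow> nat \<Rightarrow> ppoly" where
  "ptd S i = (\<Sum>x | x \<in> pointed S \<and> cycle_len x = i. val S x)"

lemma mon_Un: "finite C \<Longrightarrow> finite D \<Longrightarrow> C \<inter> D = {} \<Longrightarrow> mon (C \<union> D) = mon C * mon D"
  unfolding mon_def by (rule prod.union_disjoint)

lemma finite_orbits: "finite S \<Longrightarrow> finite (orbits \<sigma> S)"
  by (simp add: orbits_def)

lemma planarD:
  assumes "ds \<in> planar S"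
  shows "conn S ds" "set ds \<subseteq> tri S" "prodl ds permutes S"
  using assms conn_tri conn_prodl_permutes unfolding planar_iff by blast+

lemma finite_planar:
  assumes "finite S"
  shows "finite (planar S)"
proof (rule finite_subset)
  show "planar S \<subseteq> {ds. set ds \<subseteq> tri S \<and> length ds \<le> card S}"
  proof
    fix ds assume ds: "ds \<in> planar S"
    have "card (orbits (prodl ds) S) \<le> card S" using assms by (simp add: orbits_def card_image_le)
    then have "length ds \<le> card S" using ds unfolding planar_iff by linarith
    then show "ds \<in> {ds. set ds \<subseteq> tri S \<and> length ds \<le> card S}" using planarD[OF ds] by simp
  qed
  show "finite {ds. set ds \<subseteq> tri S \<and> length ds \<le> card S}"
    by (intro finite_lists_length_le finite_tri assms)
qed

lemma finite_pointed: "finite S \<Longrightarrow> finite (pointed S)"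
  by (simp add: pointed_def finite_planar)

lemma cycle_len_bounds:
  assumes "finite S" "x \<in> pointed S"
  shows "0 < cycle_len x" "cycle_len x \<le> card S"
proof -
  have *: "prodl (fst x) permutes S" "snd x \<in> S" using assms planarD(3)[of "fst x" S] by (auto simp: pointed_def)
  show "0 < cycle_len x" unfolding cycle_len_def using assms(1) *(1) by (rule card_orbit_pos)
  show "cycle_len x \<le> card S" unfolding cycle_len_def
    using orbit_subset_of_permutes[OF *] assms(1) by (intro card_mono)
qed

text \<open>Exchange of summation: the marked cycle is chosen first, and then the index tuples
  \<open>t\<close> whose value \<open>s t\<close> (later \<open>i + j + k\<close> or
  \<open>i + j\<close>) is its length.\<close>

lemma sum_mult_ptd:
  assumes "finite S" "finite I"
  shows "(\<Sum>t\<in>I. g t * ptd S (s t)) = (\<Sum>x\<in>pointed S. val S x * (\<Sum>t | t \<in> I \<and> s t = cycle_len x. g t))"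
proof -
  have "(\<Sum>t\<in>I. g t * ptd S (s t)) = (\<Sum>t\<in>I. \<Sum>x | x \<in> pointed S \<and> cycle_len x = s t. val S x * g t)"
    unfolding ptd_def by (simp add: sum_distrib_left mult.commute)
  also have "\<dots> = (\<Sum>x\<in>pointed S. \<Sum>t | t \<in> I \<and> cycle_len x = s t. val S x * g t)"
    by (rule sum.swap_restrict[OF assms(2) finite_pointed[OF assms(1)]])
  finally show ?thesis by (simp add: sum_distrib_left eq_commute)
qed

text \<open>Stopping at \<open>n\<close> loses nothing, as a marked cycle is contained in
  \<open>S\<close>.\<close>

lemma sum_mult_ptd':
  assumes "finite S" "card S \<le> n"
  shows "(\<Sum>i\<in>{1..n}. g i * ptd S i) = (\<Sum>x\<in>pointed S. val S x * g (cycle_len x))"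
proof -
  have "(\<Sum>t | t \<in> {1..n} \<and> t = cycle_len x. g t) = g (cycle_len x)" if "x \<in> pointed S" for x
  proof -
    have "{t. t \<in> {1..n} \<and> t = cycle_len x} = {cycle_len x}"
      using cycle_len_bounds[OF assms(1) that] assms(2) by auto
    then show ?thesis by simp
  qed
  then show ?thesis unfolding sum_mult_ptd[OF assms(1) finite_atLeastAtMost] by (intro sum.cong) auto
qed

text \<open>Disjoint lists have a binomial coefficient as their number of shuffles, and it turns
  \<open>1 / (k + l)!\<close> into the product of \<open>1 / k!\<close> and
  \<open>1 / l!\<close>.\<close>

lemma sum_wt_shuffles:
  assumes "set d1 \<inter> set d2 = {}"
  shows "(\<Sum>ds\<in>shuffles d1 d2. wt ds) = wt d1 * wt d2"
proof -
  have "(\<Sum>ds\<in>shuffles d1 d2. wt ds)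
      = (\<Sum>ds\<in>shuffles d1 d2. scalar (1 / fact (length d1 + length d2)))"
    by (intro sum.cong) (auto simp: wt_def length_shuffles)
  also have "\<dots> = of_nat ((length d1 + length d2) choose length d1) * scalar (1 / fact (length d1 + length d2))"
    using assms by (simp add: card_disjoint_shuffles)
  also have "\<dots> = scalar (1 / fact (length d1) * (1 / fact (length d2)))"
    unfolding of_nat_mult_scalar by (simp add: binomial_fact)
  finally show ?thesis by (simp add: wt_def scalar_mult)
qed

lemma prodl_Cons_comp: "prodl (d # ds) = d \<circ> prodl ds"
  by simp

lemma orbit_pow_inj:
  assumes "finite S" "\<sigma> permutes S"
  shows "inj_on (\<lambda>d. (\<sigma> ^^ d) a) {1..<card (orbit \<sigma> a)}"
    and "(\<lambda>d. (\<sigma> ^^ d) a) ` {1..<card (orbit \<sigma> a)} = orbit \<sigma> a - {a}"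
proof -
  let ?m = "card (orbit \<sigma> a)" and ?f = "\<lambda>d. (\<sigma> ^^ d) a"
  have inj: "inj_on ?f {..<?m}" and im: "?f ` {..<?m} = orbit \<sigma> a"
    using orbit_enum[OF assms, of a] by blast+
  show "inj_on ?f {1..<?m}" by (rule inj_on_subset[OF inj]) auto
  have eq: "{1..<?m} = {..<?m} - {0}" by auto
  have "?f ` ({..<?m} - {0}) = ?f ` {..<?m} - ?f ` {0}"
    by (rule inj_on_image_set_diff[OF inj]) (use card_orbit_pos[OF assms, of a] in auto)
  then show "?f ` {1..<?m} = orbit \<sigma> a - {a}" unfolding im eq by simp
qed

subsection \<open>Weights of the three kinds of products\<close>

lemma mon_cut:
  assumes "finite S" "\<sigma> permutes S" "a \<in> S"
    and "0 < i" "0 < j" "0 < k" "i + j + k = card (orbit \<sigma> a)"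
  shows "mon (orbits (cyc3 a ((\<sigma> ^^ (i + j)) a) ((\<sigma> ^^ i) a) \<circ> \<sigma>) S)
    = p_var i * p_var j * p_var k * mon (orbits \<sigma> (S - orbit \<sigma> a))"
proof -
  obtain X Y Z where new: "orbits (cyc3 a ((\<sigma> ^^ (i + j)) a) ((\<sigma> ^^ i) a) \<circ> \<sigma>) S = orbits \<sigma> (S - orbit \<sigma> a) \<union> {X, Y, Z}"
    and XYZ: "card X = i" "card Y = j" "card Z = k" "X \<union> Y \<union> Z = orbit \<sigma> a" "X \<inter> Y = {}" "X \<inter> Z = {}" "Y \<inter> Z = {}"
    by (rule orbits_cut_three[OF assms refl refl]) blast
  have ne: "X \<noteq> {}" "Y \<noteq> {}" "Z \<noteq> {}" using XYZ assms(4-6) by auto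
  have "{X, Y, Z} \<subseteq> Pow (orbit \<sigma> a) - {{}}" using XYZ(4) ne by auto
  then have "orbits \<sigma> (S - orbit \<sigma> a) \<inter> {X, Y, Z} = {}"
    using orbit_closed[OF assms(1,2)] by (intro orbits_Diff_disjoint[OF assms(1,2)])
  then have "mon (orbits \<sigma> (S - orbit \<sigma> a) \<union> {X, Y, Z}) = mon (orbits \<sigma> (S - orbit \<sigma> a)) * mon {X, Y, Z}"
    using assms(1) by (intro mon_Un finite_orbits) auto
  moreover have "X \<noteq> Y" "X \<noteq> Z" "Y \<noteq> Z" using XYZ(5-7) ne by auto
  ultimately show ?thesis unfolding new using XYZ(1-3) by (simp add: mon_def mult_ac)
qed

lemma mon_cut_join:
  assumes "finite S" "\<sigma> permutes S" "a \<in> S" "0 < d" "d < card (orbit \<sigma> a)" "c \<in> S" "orbit \<sigma> c \<noteq> orbit \<sigma> a"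
  shows "mon (orbits (cyc3 a ((\<sigma> ^^ d) a) c \<circ> \<sigma>) S)
    = p_var (card (orbit \<sigma> a) - d) * p_var (d + card (orbit \<sigma> c)) * mon (orbits \<sigma> (S - (orbit \<sigma> a \<union> orbit \<sigma> c)))"
proof -
  let ?Z = "orbit \<sigma> a \<union> orbit \<sigma> c"
  obtain X Y where new: "orbits (cyc3 a ((\<sigma> ^^ d) a) c \<circ> \<sigma>) S = orbits \<sigma> (S - ?Z) \<union> {X, Y}"
    and XY: "card X = card (orbit \<sigma> a) - d" "card Y = d + card (orbit \<sigma> c)" "X \<union> Y = ?Z" "X \<inter> Y = {}"
    by (rule orbits_cut_join[OF assms(1-5) refl assms(6,7)]) blast
  have ne: "X \<noteq> {}" "Y \<noteq> {}" using XY assms(4,5) by auto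
  have "{X, Y} \<subseteq> Pow ?Z - {{}}" using XY(3) ne by auto
  then have "orbits \<sigma> (S - ?Z) \<inter> {X, Y} = {}"
    using orbit_closed[OF assms(1,2)] by (intro orbits_Diff_disjoint[OF assms(1,2)]) blast
  then have "mon (orbits \<sigma> (S - ?Z) \<union> {X, Y}) = mon (orbits \<sigma> (S - ?Z)) * mon {X, Y}"
    using assms(1) by (intro mon_Un finite_orbits) auto
  moreover have "X \<noteq> Y" using XY(4) ne by auto
  ultimately show ?thesis unfolding new using XY(1,2) by (simp add: mon_def mult_ac)
qed

lemma mon_join:
  assumes "finite S" "\<sigma> permutes S" "a \<in> S" "b \<in> S" "c \<in> S"
    and ne: "orbit \<sigma> a \<noteq> orbit \<sigma> b" "orbit \<sigma> a \<noteq> orbit \<sigma> c" "orbit \<sigma> b \<noteq> orbit \<sigma> c"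
  shows "mon (orbits (cyc3 a b c \<circ> \<sigma>) S)
    = p_var (card (orbit \<sigma> a) + card (orbit \<sigma> b) + card (orbit \<sigma> c))
      * mon (orbits \<sigma> (S - (orbit \<sigma> a \<union> orbit \<sigma> b \<union> orbit \<sigma> c)))"
proof -
  let ?Z = "orbit \<sigma> a \<union> orbit \<sigma> b \<union> orbit \<sigma> c"
  note new = orbits_join_three[OF assms]
  have "{?Z} \<subseteq> Pow ?Z - {{}}" using orbit_nonempty[of \<sigma> a] by auto
  then have "orbits \<sigma> (S - ?Z) \<inter> {?Z} = {}"
    using orbit_closed[OF assms(1,2)] by (intro orbits_Diff_disjoint[OF assms(1,2)]) blast
  then have "mon (orbits \<sigma> (S - ?Z) \<union> {?Z}) = mon (orbits \<sigma> (S - ?Z)) * mon {?Z}"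
    using assms(1) by (intro mon_Un finite_orbits) auto
  moreover have "card ?Z = card (orbit \<sigma> a) + card (orbit \<sigma> b) + card (orbit \<sigma> c)"
  proof -
    have disj: "orbit \<sigma> a \<inter> orbit \<sigma> b = {}" "(orbit \<sigma> a \<union> orbit \<sigma> b) \<inter> orbit \<sigma> c = {}"
      using orbits_disjoint[OF assms(1,2)] ne by blast+
    show ?thesis
      using finite_orbit_permutes[OF assms(1,2)] disj by (simp add: card_Un_disjoint)
  qed
  ultimately show ?thesis unfolding new by (simp add: mon_def mult_ac)
qed

lemma mon_orbits_disjoint_Un:
  assumes "finite A" "finite B" "A \<inter> B = {}" "\<sigma> permutes A" "\<tau> permutes B" "A' \<subseteq> A" "B' \<subseteq> B"
  shows "mon (orbits \<sigma> A' \<union> orbits \<tau> B') = mon (orbits \<sigma> A') * mon (orbits \<tau> B')"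
proof (rule mon_Un)
  have "finite A'" "finite B'" using assms finite_subset by blast+
  then show "finite (orbits \<sigma> A')" "finite (orbits \<tau> B')" by (simp_all add: finite_orbits)
  show "orbits \<sigma> A' \<inter> orbits \<tau> B' = {}"
  proof (rule ccontr)
    assume "orbits \<sigma> A' \<inter> orbits \<tau> B' \<noteq> {}"
    then obtain x y where xy: "x \<in> A'" "y \<in> B'" "orbit \<sigma> x = orbit \<tau> y" unfolding orbits_def by blast
    have "orbit \<sigma> x \<subseteq> A" "orbit \<tau> y \<subseteq> B"
      using orbit_subset_of_permutes[OF assms(4), of x] orbit_subset_of_permutes[OF assms(5), of y] xy assms(6,7)
      by blast+
    then show False using xy(3) assms(3) orbit_nonempty[of \<sigma> x] by blast
  qed
qed

lemma mon_split2:
  assumes fin: "finite S" and A: "A \<subseteq> S" and x: "(d1, a) \<in> pointed A" and z: "(d2, c) \<in> pointed (S - A)"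
    and ds: "ds \<in> shuffles d1 d2" and d: "0 < d" "d < cycle_len (d1, a)" and b: "b = (prodl d1 ^^ d) a"
  shows "mon (orbits (prodl (cyc3 a b c # ds)) S)
    = p_var (cycle_len (d1, a) - d) * p_var (d + cycle_len (d2, c)) * (rest A (d1, a) * rest (S - A) (d2, c))"
proof -
  have finA: "finite A" "finite (S - A)" using fin A finite_subset by auto
  have un: "A \<union> (S - A) = S" and disj: "A \<inter> (S - A) = {}" using A by auto
  have p1: "d1 \<in> planar A" "a \<in> A" and p2: "d2 \<in> planar (S - A)" "c \<in> S - A" using x z by (auto simp: pointed_def)
  note tri = planarD(2)[OF p1(1)] planarD(2)[OF p2(1)]
  note perm = planarD(3)[OF p1(1)] planarD(3)[OF p2(1)]
  note sh = finA disj tri ds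
  have dsS: "set ds \<subseteq> tri S" using shuffle_tri[OF sh] unfolding un .
  have permS: "prodl ds permutes S" by (rule prodl_permutes[OF dsS])
  have oa: "orbit (prodl ds) a = orbit (prodl d1) a" by (rule orbit_shuffle(1)[OF sh p1(2)])
  have oc: "orbit (prodl ds) c = orbit (prodl d2) c" by (rule orbit_shuffle(2)[OF sh p2(2)])
  have suba: "orbit (prodl d1) a \<subseteq> A" and subc: "orbit (prodl d2) c \<subseteq> S - A"
    using orbit_subset_of_permutes[OF perm(1) p1(2)] orbit_subset_of_permutes[OF perm(2) p2(2)] .
  have on_A: "prodl ds u = prodl d1 u" if "u \<in> A" for u
    using prodl_restr[OF dsS shuffle_invariant(1)[OF sh] that] unfolding shuffle_restr(1)[OF sh] .
  \<comment> \<open>\<open>b\<close> is given as a power of \<open>prodl d1\<close> applied to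
    \<open>a\<close>, while the cutting lemma expects a power of the whole product. The two agree
    because the iterates never leave \<open>A\<close>.\<close>
  have pow: "(prodl ds ^^ t) a = (prodl d1 ^^ t) a \<and> (prodl d1 ^^ t) a \<in> A" for t
  proof (induction t)
    case (Suc t)
    then have "prodl ds ((prodl d1 ^^ t) a) = prodl d1 ((prodl d1 ^^ t) a)" by (intro on_A) blast
    moreover have "prodl d1 ((prodl d1 ^^ t) a) \<in> A" using Suc permutes_in_image[OF perm(1)] by blast
    ultimately show ?case using Suc unfolding funpow.simps(2) o_apply by metis
  qed (use p1 in simp)
  have ne: "orbit (prodl ds) c \<noteq> orbit (prodl ds) a"
    using suba subc orbit_nonempty[of "prodl d1" a] unfolding oa oc by blast
  have S: "a \<in> S" "c \<in> S" using p1 p2 A by auto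
  have "S - (orbit (prodl d1) a \<union> orbit (prodl d2) c) = (A - orbit (prodl d1) a) \<union> (S - A - orbit (prodl d2) c)"
    using A suba subc by blast
  then have "orbits (prodl ds) (S - (orbit (prodl d1) a \<union> orbit (prodl d2) c))
      = orbits (prodl d1) (A - orbit (prodl d1) a) \<union> orbits (prodl d2) (S - A - orbit (prodl d2) c)"
    using orbits_shuffle_sub(1)[OF sh, of "A - orbit (prodl d1) a"]
      orbits_shuffle_sub(2)[OF sh, of "S - A - orbit (prodl d2) c"] by (simp add: orbits_def image_Un)
  moreover have "mon (orbits (prodl d1) (A - orbit (prodl d1) a) \<union> orbits (prodl d2) (S - A - orbit (prodl d2) c))
      = rest A (d1, a) * rest (S - A) (d2, c)"
    unfolding rest_def fst_conv snd_conv by (rule mon_orbits_disjoint_Un[OF finA disj perm]) auto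
  moreover have "b = (prodl ds ^^ d) a" using pow b by simp
  ultimately show ?thesis
    using mon_cut_join[OF fin permS S(1) d(1) _ S(2) ne] d(2)
    unfolding prodl_Cons_comp oa oc cycle_len_def fst_conv snd_conv by simp
qed

lemma mon_split3:
  assumes fin: "finite S" and A: "A \<subseteq> S" "B \<subseteq> S - A" and x: "(d1, a) \<in> pointed A" and y: "(d2, b) \<in> pointed B"
    and z: "(d3, c) \<in> pointed (S - A - B)" and ds: "ds \<in> shuffles3 d1 d2 d3"
  shows "mon (orbits (prodl (cyc3 a b c # ds)) S)
    = p_var (cycle_len (d1, a) + cycle_len (d2, b) + cycle_len (d3, c))
      * (rest A (d1, a) * rest B (d2, b) * rest (S - A - B) (d3, c))"
proof -
  let ?C = "S - A - B"
  have p1: "d1 \<in> planar A" "a \<in> A" and p2: "d2 \<in> planar B" "b \<in> B" and p3: "d3 \<in> planar ?C" "c \<in> ?C"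
    using x y z by (auto simp: pointed_def)
  have dist: "distinct [a, b, c]" using p1(2) p2(2) p3(2) A by auto
  note n = split3_numbers(5-12)[OF fin dist A planarD(1)[OF p1(1)] planarD(1)[OF p2(1)] planarD(1)[OF p3(1)]
      ds p1(2) p2(2) p3(2)]
  have S: "a \<in> S" "b \<in> S" "c \<in> S" using p1 p2 p3 A by auto
  note perm = planarD(3)[OF p1(1)] planarD(3)[OF p2(1)] planarD(3)[OF p3(1)]
  have self: "u \<in> orbit (prodl ds) u" for u by (rule orbit_self[OF fin n(5)])
  have ne: "orbit (prodl ds) a \<noteq> orbit (prodl ds) b" "orbit (prodl ds) a \<noteq> orbit (prodl ds) c"
    "orbit (prodl ds) b \<noteq> orbit (prodl ds) c"
    using n(6-8) self[of b] self[of c] by blast+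
  have fins: "finite A" "finite B" "finite ?C"
    using fin finite_subset[OF A(1)] finite_subset[OF A(2)] by auto
  let ?x = "orbits (prodl d1) (A - orbit (prodl d1) a)" and ?y = "orbits (prodl d2) (B - orbit (prodl d2) b)"
    and ?z = "orbits (prodl d3) (?C - orbit (prodl d3) c)"
  have 1: "mon (?x \<union> ?y) = mon ?x * mon ?y"
    by (rule mon_orbits_disjoint_Un[OF fins(1,2) _ perm(1,2)]) (use A in auto)
  have "?x \<inter> ?z = {}" "?y \<inter> ?z = {}"
  proof -
    have x: "?x \<subseteq> Pow A - {{}}" and y: "?y \<subseteq> Pow B - {{}}" and z: "?z \<subseteq> Pow ?C - {{}}"
      unfolding orbits_def
      using orbit_subset_of_permutes[OF perm(1)] orbit_subset_of_permutes[OF perm(2)]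
        orbit_subset_of_permutes[OF perm(3)] orbit_nonempty by fast+
    show "?x \<inter> ?z = {}" "?y \<inter> ?z = {}" using x y z by blast+
  qed
  then have "mon (?x \<union> ?y \<union> ?z) = mon (?x \<union> ?y) * mon ?z"
    using fins by (intro mon_Un) (auto simp: finite_orbits)
  then have "mon (?x \<union> ?y \<union> ?z) = rest A (d1, a) * rest B (d2, b) * rest ?C (d3, c)"
    unfolding 1 by (simp add: rest_def)
  then show ?thesis
    using mon_join[OF fin n(5) S ne] unfolding n(4) prodl_Cons_comp by (simp add: cycle_len_def n(1-3))
qed


section \<open>Removing the first factor\<close>

definition triples :: "'a set \<Rightarrow> ('a \<times> 'a \<times> 'a) set" where
  "triples S = {(a, b, c). distinct [a, b, c] \<and> {a, b, c} \<subseteq> S}"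

definition cyc :: "'a \<times> 'a \<times> 'a \<Rightarrow> 'a \<Rightarrow> 'a" where
  "cyc t = (case t of (a, b, c) \<Rightarrow> cyc3 a b c)"

text \<open>Mixed on purpose: the factorial belongs to the shorter list, the monomial to the longer
  product. As \<open>1 / (k - 1)! = k / k!\<close>, this brings the number of factors into the
  count.\<close>

definition Cons_weight :: "'a set \<Rightarrow> ('a \<times> 'a \<times> 'a) \<times> ('a \<Rightarrow> 'a) list \<Rightarrow> ppoly" where
  "Cons_weight S x = wt (snd x) * mon (orbits (prodl (cyc (fst x) # snd x)) S)"

definition Cons_planar :: "'a set \<Rightarrow> (('a \<times> 'a \<times> 'a) \<times> ('a \<Rightarrow> 'a) list) set" where
  "Cons_planar S = {(t, ds). t \<in> triples S \<and> cyc t # ds \<in> planar S}"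

lemma finite_triples: "finite S \<Longrightarrow> finite (triples S)"
  by (rule finite_subset[of _ "S \<times> S \<times> S"]) (auto simp: triples_def)

lemma finite_Cons_planar:
  assumes "finite S"
  shows "finite (Cons_planar S)"
proof (rule finite_subset)
  show "Cons_planar S \<subseteq> triples S \<times> tl ` planar S"
    by (force simp: Cons_planar_def image_iff)
qed (use assms in \<open>simp add: finite_triples finite_planar\<close>)

text \<open>The first entry is a point of the support, and the 3-cycle then dictates the other
  two.\<close>

lemma card_triples_of_cycle:
  assumes "d \<in> tri S"
  shows "card {t \<in> triples S. cyc t = d} = 3"
proof -
  obtain a b c where d: "d = cyc3 a b c" "distinct [a, b, c]" "a \<in> S" "b \<in> S" "c \<in> S"
    using assms by (rule triE)
  have "{t \<in> triples S. cyc t = d} = {(a, b, c), (b, c, a), (c, a, b)}"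
  proof (intro equalityI subsetI)
    fix t assume t: "t \<in> {t \<in> triples S. cyc t = d}"
    obtain x y z where xyz: "t = (x, y, z)" by (cases t)
    have xyz': "distinct [x, y, z]" "cyc3 x y z = d" using t xyz by (auto simp: triples_def cyc_def)
    have "x \<in> {a, b, c}"
      using supp_cyc3[OF xyz'(1)] supp_cyc3[OF d(2)] xyz'(2) d(1) by auto
    moreover have "y = d x" "z = d y" using cyc3_simps[OF xyz'(1)] xyz'(2) by auto
    ultimately show "t \<in> {(a, b, c), (b, c, a), (c, a, b)}"
      unfolding xyz d(1) using cyc3_simps[OF d(2)] by auto
  next
    fix t assume "t \<in> {(a, b, c), (b, c, a), (c, a, b)}"
    then show "t \<in> {t \<in> triples S. cyc t = d}"
      using d cyc3_rotate[of a b c] cyc3_rotate[of b c a] by (auto simp: triples_def cyc_def)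
  qed
  then show ?thesis using d(2) by simp
qed

text \<open>The factor 3 counts the rotations of \<open>(a, b, c)\<close>, which all describe the same 3-cycle.\<close>

lemma sum_Cons_planar:
  assumes fin: "finite S"
  shows "(\<Sum>ds\<in>planar S. of_nat (3 * length ds) * wt ds * mon (orbits (prodl ds) S))
    = (\<Sum>x\<in>Cons_planar S. Cons_weight S x)"
proof -
  let ?g = "\<lambda>x. cyc (fst x) # snd x"
  have "(\<Sum>x | x \<in> Cons_planar S \<and> ?g x = ds. Cons_weight S x)
      = of_nat (3 * length ds) * wt ds * mon (orbits (prodl ds) S)" if ds: "ds \<in> planar S" for ds
  proof (cases ds)
    case Nil
    then show ?thesis by simp
  next
    case (Cons d es)
    let ?T = "{t \<in> triples S. cyc t = d}"
    have "d \<in> tri S" using planarD(2)[OF ds] Cons by simp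
    have "{x. x \<in> Cons_planar S \<and> ?g x = ds} = ?T \<times> {es}"
      using ds Cons by (auto simp: Cons_planar_def)
    then have "(\<Sum>x | x \<in> Cons_planar S \<and> ?g x = ds. Cons_weight S x) = (\<Sum>x\<in>?T \<times> {es}. Cons_weight S x)"
      by simp
    also have "\<dots> = (\<Sum>x\<in>?T \<times> {es}. wt es * mon (orbits (prodl ds) S))"
      by (intro sum.cong) (auto simp: Cons_weight_def Cons)
    also have "\<dots> = of_nat 3 * (wt es * mon (orbits (prodl ds) S))"
      using card_triples_of_cycle[OF \<open>d \<in> tri S\<close>] by (simp add: card_cartesian_product)
    also have "of_nat 3 * wt es = of_nat (3 * length ds) * wt ds"
      unfolding wt_def of_nat_mult_scalar
      by (rule arg_cong[of _ _ scalar]) (simp add: Cons divide_simps del: of_nat_Suc, simp add: algebra_simps)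
    then have "of_nat 3 * (wt es * mon (orbits (prodl ds) S)) = of_nat (3 * length ds) * wt ds * mon (orbits (prodl ds) S)"
      by (simp only: mult.assoc[symmetric])
    finally show ?thesis .
  qed
  then have "(\<Sum>ds\<in>planar S. of_nat (3 * length ds) * wt ds * mon (orbits (prodl ds) S))
      = (\<Sum>ds\<in>planar S. \<Sum>x | x \<in> Cons_planar S \<and> ?g x = ds. Cons_weight S x)"
    by (intro sum.cong) auto
  also have "\<dots> = (\<Sum>x\<in>Cons_planar S. Cons_weight S x)"
    by (rule sum.group[OF finite_Cons_planar[OF fin] finite_planar[OF fin]]) (auto simp: Cons_planar_def)
  finally show ?thesis .
qed

text \<open>A change of variables for the three cases. An index \<open>j\<close> records classes,
  marked points and distances; it yields the triple \<open>t j\<close> and the admissible lists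
  \<open>D j\<close>. Uniqueness says that triple and list together give back
  \<open>j\<close>.\<close>

lemma sum_over_fibres:
  assumes "finite J" "\<And>j. j \<in> J \<Longrightarrow> finite (D j)"
    and P: "\<And>x. x \<in> P \<longleftrightarrow> (\<exists>j\<in>J. fst x = t j \<and> snd x \<in> D j)"
    and uniq: "\<And>j j' ds. j \<in> J \<Longrightarrow> j' \<in> J \<Longrightarrow> t j = t j' \<Longrightarrow> ds \<in> D j \<Longrightarrow> ds \<in> D j' \<Longrightarrow> j = j'"
  shows "(\<Sum>x\<in>P. F x) = (\<Sum>j\<in>J. \<Sum>ds\<in>D j. F (t j, ds))"
proof -
  let ?f = "\<lambda>(j, ds). (t j, ds)"
  have "P = ?f ` (SIGMA j:J. D j)"
    using P by (force simp: image_iff)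
  moreover have "inj_on ?f (SIGMA j:J. D j)" using uniq by (auto intro!: inj_onI)
  ultimately have "(\<Sum>x\<in>P. F x) = (\<Sum>y\<in>(SIGMA j:J. D j). F (?f y))"
    by (simp add: sum.reindex)
  also have "\<dots> = (\<Sum>j\<in>J. \<Sum>ds\<in>D j. F (t j, ds))"
    using assms(1,2) by (subst sum.Sigma) (auto intro!: sum.cong)
  finally show ?thesis .
qed

subsection \<open>Splitting by components\<close>

definition cons1 :: "'a set \<Rightarrow> (('a \<times> 'a \<times> 'a) \<times> ('a \<Rightarrow> 'a) list) set" where
  "cons1 S = {((a, b, c), ds). (a, b, c) \<in> triples S \<and> ds \<in> planar S \<and> cut (prodl ds) a b c}"

definition cons2 :: "'a set \<Rightarrow> (('a \<times> 'a \<times> 'a) \<times> ('a \<Rightarrow> 'a) list) set" where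
  "cons2 S = {((a, b, c), ds). (a, b, c) \<in> triples S \<and> split2 is_planar S a b c ds \<and> b \<in> orbit (prodl ds) a}"

definition cons3 :: "'a set \<Rightarrow> (('a \<times> 'a \<times> 'a) \<times> ('a \<Rightarrow> 'a) list) set" where
  "cons3 S = {((a, b, c), ds). (a, b, c) \<in> triples S \<and> split3 is_planar S a b c ds}"

text \<open>Changes the triple but not the 3-cycle that it describes. The two other variants of the
  two-class case are preimages of \<open>cons2\<close> under this map and its square.\<close>

definition rot :: "('a \<times> 'a \<times> 'a) \<times> 'b \<Rightarrow> ('a \<times> 'a \<times> 'a) \<times> 'b" where
  "rot x = (case x of ((a, b, c), ds) \<Rightarrow> ((b, c, a), ds))"

lemma rot_simp [simp]: "rot ((a, b, c), ds) = ((b, c, a), ds)"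
  by (simp add: rot_def)

lemma bij_rot: "bij rot"
proof (rule bij_betw_byWitness[where f' = "rot \<circ> rot"])
qed (auto simp: rot_def)

lemma component_conn:
  assumes "conn S ds" "x \<in> S"
  shows "component S ds x = S"
proof (rule connD[OF assms(1)])
  note ds = conn_tri[OF assms(1)]
  show "component S ds x \<subseteq> S" by (rule component_subset_whole[OF ds assms(2)])
  show "component S ds x \<noteq> {}" using component_self[of x S ds] by auto
  show "invariant ds (component S ds x)" by (rule component_invariant[OF ds])
qed

text \<open>The splitting can be recovered from the list: the sets are classes, and the sublists are
  restrictions to them. Both the disjointness of the cases and the injectivity of the
  parametrizations rest on this.\<close>

lemma split2_component:
  assumes fin: "finite S" and A: "A \<subseteq> S" "conn A d1" "conn (S - A) d2" "ds \<in> shuffles d1 d2"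
  shows "set ds \<subseteq> tri S" "\<And>x. x \<in> A \<Longrightarrow> component S ds x = A" "\<And>x. x \<in> S - A \<Longrightarrow> component S ds x = S - A"
    "restr A ds = d1" "restr (S - A) ds = d2"
proof -
  have finA: "finite A" "finite (S - A)" using fin A(1) finite_subset by auto
  have un: "A \<union> (S - A) = S" and disj: "A \<inter> (S - A) = {}" using A(1) by auto
  note sh = finA disj conn_tri[OF A(2)] conn_tri[OF A(3)] A(4)
  show ds: "set ds \<subseteq> tri S" using shuffle_tri[OF sh] unfolding un .
  show r: "restr A ds = d1" "restr (S - A) ds = d2" by (rule shuffle_restr[OF sh])+
  show "component S ds x = A" if "x \<in> A" for x
    using component_unique[OF ds A(1) that shuffle_invariant(1)[OF sh]] A(2) r by simp
  show "component S ds x = S - A" if "x \<in> S - A" for x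
    using component_unique[OF ds Diff_subset that shuffle_invariant(2)[OF sh]] A(3) r by simp
qed

lemma split3_component:
  assumes fin: "finite S" and A: "A \<subseteq> S" "B \<subseteq> S - A" "conn A d1" "conn B d2" "conn (S - A - B) d3"
    "ds \<in> shuffles3 d1 d2 d3"
  shows "\<And>x. x \<in> A \<Longrightarrow> component S ds x = A" "\<And>x. x \<in> B \<Longrightarrow> component S ds x = B"
    "\<And>x. x \<in> S - A - B \<Longrightarrow> component S ds x = S - A - B"
    "restr A ds = d1" "restr B ds = d2" "restr (S - A - B) ds = d3"
proof -
  let ?C = "S - A - B"
  obtain d' where d': "d' \<in> shuffles d2 d3" "ds \<in> shuffles d1 d'" by (rule shuffles3E[OF A(6)])
  have finA: "finite A" "finite (S - A)" "finite B" "finite ?C"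
    using fin finite_subset[OF A(1)] finite_subset[OF A(2)] by auto
  have un: "A \<union> (S - A) = S" and disj: "A \<inter> (S - A) = {}" using A(1) by auto
  have un': "B \<union> ?C = S - A" and disj': "B \<inter> ?C = {}" using A(2) by auto
  note tri = conn_tri[OF A(3)] conn_tri[OF A(4)] conn_tri[OF A(5)]
  note sh' = finA(3,4) disj' tri(2,3) d'(1)
  have tri': "set d' \<subseteq> tri (S - A)" using shuffle_tri[OF sh'] unfolding un' .
  note sh = finA(1,2) disj tri(1) tri' d'(2)
  have ds: "set ds \<subseteq> tri S" using shuffle_tri[OF sh] unfolding un .
  show rA: "restr A ds = d1" by (rule shuffle_restr[OF sh])
  \<comment> \<open>Inside \<open>S - A\<close> only the inner shuffle \<open>d'\<close> matters,
    which reduces the three-class case to two shuffles of two lists.\<close>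
  have rest: "restr X ds = restr X d' \<and> (invariant d' X \<longrightarrow> invariant ds X)" if "X \<subseteq> S - A" for X
  proof -
    have *: "restr (S - A) ds = d'" by (rule shuffle_restr(2)[OF sh])
    have "restr X ds = restr X (restr (S - A) ds)"
      using that by (auto simp: restr_def intro!: filter_cong)
    moreover have "invariant d' X \<longrightarrow> invariant ds X"
      using invariant_restr[OF shuffle_invariant(2)[OF sh] that] unfolding * by simp
    ultimately show ?thesis unfolding * by simp
  qed
  have B: "restr B ds = d2 \<and> invariant ds B" and C: "restr ?C ds = d3 \<and> invariant ds ?C"
    using rest[OF A(2)] rest[of ?C] shuffle_restr[OF sh'] shuffle_invariant[OF sh'] by auto
  then show "restr B ds = d2" "restr ?C ds = d3" by auto
  show "component S ds x = A" if "x \<in> A" for x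
    using component_unique[OF ds A(1) that shuffle_invariant(1)[OF sh]] A(3) rA by simp
  show "component S ds x = B" if "x \<in> B" for x
    using component_unique[OF ds _ that, of] B A(2,4) by auto
  show "component S ds x = ?C" if "x \<in> ?C" for x
    using component_unique[OF ds _ that] C A(5) by auto
qed

lemma split2_component_eq:
  assumes "finite S" "split2 is_planar S a b c ds"
  shows "component S ds a = component S ds b" "component S ds a \<noteq> component S ds c"
proof -
  obtain A d1 d2 where A: "A \<subseteq> S" "d1 \<in> planar A" "d2 \<in> planar (S - A)" "ds \<in> shuffles d1 d2"
    "a \<in> A" "b \<in> A" "c \<in> S - A" using assms(2) unfolding split2_def by blast
  note s = split2_component[OF assms(1) A(1) planarD(1)[OF A(2)] planarD(1)[OF A(3)] A(4)]
  show "component S ds a = component S ds b" "component S ds a \<noteq> component S ds c"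
    using s(2)[OF A(5)] s(2)[OF A(6)] s(3)[OF A(7)] A(5) by auto
qed

lemma split3_component_neq:
  assumes "finite S" "split3 is_planar S a b c ds"
  shows "component S ds a \<noteq> component S ds b" "component S ds a \<noteq> component S ds c"
    "component S ds b \<noteq> component S ds c"
proof -
  obtain A B d1 d2 d3 where A: "A \<subseteq> S" "B \<subseteq> S - A" "d1 \<in> planar A" "d2 \<in> planar B" "d3 \<in> planar (S - A - B)"
    "ds \<in> shuffles3 d1 d2 d3" "a \<in> A" "b \<in> B" "c \<in> S - A - B" using assms(2) unfolding split3_def by blast
  note s = split3_component[OF assms(1) A(1,2) planarD(1)[OF A(3)] planarD(1)[OF A(4)] planarD(1)[OF A(5)] A(6)]
  show "component S ds a \<noteq> component S ds b" "component S ds a \<noteq> component S ds c"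
    "component S ds b \<noteq> component S ds c"
    using s(1)[OF A(7)] s(2)[OF A(8)] s(3)[OF A(9)] A(2,7,8) by auto
qed

lemma Cons_weight_rot: "t \<in> triples S \<Longrightarrow> Cons_weight S' (rot (t, ds)) = Cons_weight S' (t, ds)"
  by (cases t) (simp add: Cons_weight_def cyc_def triples_def cyc3_rotate del: foldr.simps)

text \<open>The five cases exclude each other, as they differ in which of \<open>a\<close>,
  \<open>b\<close>, \<open>c\<close> share a class. Rotation keeps the weight, so the three variants
  of the two-class case have equal sums.\<close>

lemma sum_Cons_planar_split:
  assumes fin: "finite S"
  shows "(\<Sum>x\<in>Cons_planar S. Cons_weight S x)
    = (\<Sum>x\<in>cons1 S. Cons_weight S x) + 3 * (\<Sum>x\<in>cons2 S. Cons_weight S x) + (\<Sum>x\<in>cons3 S. Cons_weight S x)"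
proof -
  let ?r1 = "{x. rot x \<in> cons2 S}" and ?r2 = "{x. rot (rot x) \<in> cons2 S}"
  have mem: "((a, b, c), ds) \<in> Cons_planar S \<longleftrightarrow> ((a, b, c), ds) \<in> cons1 S \<union> cons2 S \<union> ?r1 \<union> ?r2 \<union> cons3 S"
    for a b c ds
  proof (cases "(a, b, c) \<in> triples S")
    case True
    then have abc: "distinct [a, b, c]" "{a, b, c} \<subseteq> S" by (auto simp: triples_def)
    then have t: "(b, c, a) \<in> triples S" "(c, a, b) \<in> triples S" by (auto simp: triples_def)
    show ?thesis
      using True t planar_Cons_iff[OF fin abc, of ds]
      unfolding Cons_planar_def cons1_def cons2_def cons3_def cyc_def by (simp del: foldr.simps)
  next
    case False
    then have "(b, c, a) \<notin> triples S" "(c, a, b) \<notin> triples S" by (auto simp: triples_def)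
    then show ?thesis using False by (simp add: Cons_planar_def cons1_def cons2_def cons3_def)
  qed
  have eq: "Cons_planar S = cons1 S \<union> cons2 S \<union> ?r1 \<union> ?r2 \<union> cons3 S"
  proof (rule Set.set_eqI)
    fix x :: "('a \<times> 'a \<times> 'a) \<times> ('a \<Rightarrow> 'a) list"
    obtain a b c ds where "x = ((a, b, c), ds)" by (metis prod.exhaust)
    then show "x \<in> Cons_planar S \<longleftrightarrow> x \<in> cons1 S \<union> cons2 S \<union> ?r1 \<union> ?r2 \<union> cons3 S"
      using mem by simp
  qed
  let ?C = "\<lambda>ds. component S ds"
  have c1: "?C ds a = ?C ds b \<and> ?C ds b = ?C ds c" if "((a, b, c), ds) \<in> cons1 S" for a b c ds
  proof -
    have "conn S ds" "a \<in> S" "b \<in> S" "c \<in> S"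
      using that planarD(1)[of ds S] by (auto simp: cons1_def triples_def)
    then show ?thesis using component_conn[of S ds] by simp
  qed
  have c2: "?C ds a = ?C ds b \<and> ?C ds a \<noteq> ?C ds c" if "((a, b, c), ds) \<in> cons2 S" for a b c ds
    using split2_component_eq[OF fin, of a b c ds] that by (simp add: cons2_def)
  have c3: "?C ds a \<noteq> ?C ds b \<and> ?C ds a \<noteq> ?C ds c \<and> ?C ds b \<noteq> ?C ds c" if "((a, b, c), ds) \<in> cons3 S" for a b c ds
    using split3_component_neq[OF fin, of a b c ds] that by (simp add: cons3_def)
  have c4: "?C ds b = ?C ds c \<and> ?C ds b \<noteq> ?C ds a" if "((a, b, c), ds) \<in> ?r1" for a b c ds
    using c2[of b c a ds] that by auto
  have c5: "?C ds c = ?C ds a \<and> ?C ds c \<noteq> ?C ds b" if "((a, b, c), ds) \<in> ?r2" for a b c ds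
    using c2[of c a b ds] that by auto
  have disj: "cons1 S \<inter> cons2 S = {}" "(cons1 S \<union> cons2 S) \<inter> ?r1 = {}" "(cons1 S \<union> cons2 S \<union> ?r1) \<inter> ?r2 = {}"
    "(cons1 S \<union> cons2 S \<union> ?r1 \<union> ?r2) \<inter> cons3 S = {}"
  proof -
    have "x \<notin> cons1 S \<inter> cons2 S" "x \<notin> (cons1 S \<union> cons2 S) \<inter> ?r1" "x \<notin> (cons1 S \<union> cons2 S \<union> ?r1) \<inter> ?r2"
      "x \<notin> (cons1 S \<union> cons2 S \<union> ?r1 \<union> ?r2) \<inter> cons3 S" for x
    proof -
      obtain a b c ds where x: "x = ((a, b, c), ds)" by (metis prod.exhaust)
      note c = c1[of a b c ds] c2[of a b c ds] c3[of a b c ds] c4[of a b c ds] c5[of a b c ds]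
      show "x \<notin> cons1 S \<inter> cons2 S" "x \<notin> (cons1 S \<union> cons2 S) \<inter> ?r1" "x \<notin> (cons1 S \<union> cons2 S \<union> ?r1) \<inter> ?r2"
        "x \<notin> (cons1 S \<union> cons2 S \<union> ?r1 \<union> ?r2) \<inter> cons3 S"
        unfolding x Int_iff Un_iff using c by argo+
    qed
    then show "cons1 S \<inter> cons2 S = {}" "(cons1 S \<union> cons2 S) \<inter> ?r1 = {}" "(cons1 S \<union> cons2 S \<union> ?r1) \<inter> ?r2 = {}"
      "(cons1 S \<union> cons2 S \<union> ?r1 \<union> ?r2) \<inter> cons3 S = {}" by blast+
  qed
  have fins: "finite (cons1 S)" "finite (cons2 S)" "finite ?r1" "finite ?r2" "finite (cons3 S)"
    using finite_Cons_planar[OF fin] unfolding eq by simp_all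
  have "(\<Sum>x\<in>Cons_planar S. Cons_weight S x) = (\<Sum>x\<in>cons1 S. Cons_weight S x) + (\<Sum>x\<in>cons2 S. Cons_weight S x)
      + (\<Sum>x\<in>?r1. Cons_weight S x) + (\<Sum>x\<in>?r2. Cons_weight S x) + (\<Sum>x\<in>cons3 S. Cons_weight S x)"
    unfolding eq using fins disj by (simp only: sum.union_disjoint finite_Un simp_thms)
  moreover have r: "(\<Sum>x\<in>{x. rot x \<in> X}. Cons_weight S x) = (\<Sum>x\<in>X. Cons_weight S x)"
    if "X \<subseteq> {x. fst x \<in> triples S}" for X
  proof -
    have im: "rot ` {x. rot x \<in> X} = X" using bij_is_surj[OF bij_rot] by (auto simp: image_iff)
    have "(\<Sum>x\<in>X. Cons_weight S x) = (\<Sum>x\<in>{x. rot x \<in> X}. Cons_weight S (rot x))"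
      by (subst im[symmetric], subst sum.reindex) (auto intro: inj_on_subset[OF bij_is_inj[OF bij_rot]])
    also have "\<dots> = (\<Sum>x\<in>{x. rot x \<in> X}. Cons_weight S x)"
    proof (rule sum.cong)
      fix x assume "x \<in> {x. rot x \<in> X}"
      then have "fst (rot x) \<in> triples S" using that by blast
      then have "fst x \<in> triples S" by (cases x) (auto simp: triples_def)
      then show "Cons_weight S (rot x) = Cons_weight S x" using Cons_weight_rot[of "fst x" S S "snd x"] by simp
    qed simp
    finally show ?thesis by simp
  qed
  have sub: "cons2 S \<subseteq> {x. fst x \<in> triples S}" by (auto simp: cons2_def)
  have sub': "?r1 \<subseteq> {x. fst x \<in> triples S}" by (auto simp: cons2_def triples_def)
  have "(\<Sum>x\<in>?r1. Cons_weight S x) = (\<Sum>x\<in>cons2 S. Cons_weight S x)" by (rule r[OF sub])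
  moreover have "(\<Sum>x\<in>?r2. Cons_weight S x) = (\<Sum>x\<in>?r1. Cons_weight S x)" using r[OF sub'] by simp
  ultimately show ?thesis by simp
qed


subsection \<open>Evaluating the three sums\<close>

lemma sum_Sigma:
  assumes "finite A" "\<And>x. x \<in> A \<Longrightarrow> finite (B x)"
  shows "sum G (Sigma A B) = (\<Sum>x\<in>A. \<Sum>y\<in>B x. G (x, y))"
  using sum.Sigma[of A B "\<lambda>x y. G (x, y)"] assms by simp

text \<open>A cut is the same as a marked point \<open>a\<close> together with an ordered
  decomposition \<open>i + j + k\<close> of the length of its cycle; \<open>b\<close> and
  \<open>c\<close> are then determined.\<close>

lemma sum_cons1:
  assumes fin: "finite S" and n: "card S \<le> n"
  shows "(\<Sum>x\<in>cons1 S. Cons_weight S x)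
    = (\<Sum>(i, j, k)\<in>{1..n} \<times> {1..n} \<times> {1..n}. p_var i * p_var j * p_var k * ptd S (i + j + k))"
proof -
  let ?N = "{1..n} \<times> {1..n} \<times> {1..n}"
  let ?s = "\<lambda>(i, j, k). i + j + k :: nat" and ?g = "\<lambda>(i, j, k). p_var i * p_var j * p_var k"
  let ?I = "\<lambda>x. {u \<in> ?N. ?s u = cycle_len x}"
  let ?J = "SIGMA x:pointed S. ?I x"
  let ?t = "\<lambda>(x, (i, j, k)). (snd x, (prodl (fst x) ^^ (i + j)) (snd x), (prodl (fst x) ^^ i) (snd x))"
  let ?D = "\<lambda>(x, u). {fst x}"
  have finJ: "finite ?J" by (intro finite_SigmaI finite_pointed[OF fin]) simp
  have perm: "prodl ds permutes S" if "ds \<in> planar S" for ds by (rule planarD(3)[OF that])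
  have J: "(x, (i, j, k)) \<in> ?J \<longleftrightarrow> fst x \<in> planar S \<and> snd x \<in> S \<and> 0 < i \<and> 0 < j \<and> 0 < k
      \<and> i + j + k = card (orbit (prodl (fst x)) (snd x))" for x i j k
  proof -
    have "card (orbit (prodl (fst x)) (snd x)) \<le> n" if "x \<in> pointed S"
      using cycle_len_bounds(2)[OF fin that] n by (simp add: cycle_len_def)
    then show ?thesis by (cases x) (auto simp: pointed_def cycle_len_def)
  qed
  have "(\<Sum>x\<in>cons1 S. Cons_weight S x) = (\<Sum>y\<in>?J. \<Sum>ds\<in>?D y. Cons_weight S (?t y, ds))"
  proof (rule sum_over_fibres[OF finJ])
    fix y :: "(('a \<times> 'a \<times> 'a) \<times> ('a \<Rightarrow> 'a) list)"
    obtain a b c ds where y: "y = ((a, b, c), ds)" by (metis prod.exhaust)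
    show "y \<in> cons1 S \<longleftrightarrow> (\<exists>v\<in>?J. fst y = ?t v \<and> snd y \<in> ?D v)"
    proof
      assume "y \<in> cons1 S"
      then have ds: "ds \<in> planar S" and a: "a \<in> S" and "cut (prodl ds) a b c"
        by (auto simp: y cons1_def triples_def)
      then obtain i j k where ijk: "0 < i" "0 < j" "0 < k" "i + j + k = card (orbit (prodl ds) a)"
        "c = (prodl ds ^^ i) a" "b = (prodl ds ^^ (i + j)) a" unfolding cut_def by blast
      have "((ds, a), (i, j, k)) \<in> ?J" unfolding J using ds a ijk by simp
      then show "\<exists>v\<in>?J. fst y = ?t v \<and> snd y \<in> ?D v"
        by (rule rev_bexI) (simp add: y ijk del: foldr.simps)
    next
      assume "\<exists>v\<in>?J. fst y = ?t v \<and> snd y \<in> ?D v"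
      then obtain x i j k where v: "(x, (i, j, k)) \<in> ?J" "fst y = ?t (x, (i, j, k))" "snd y = fst x"
        by fast
      note v1 = v(1)[unfolded J]
      have eqs: "a = snd x" "ds = fst x" "b = (prodl ds ^^ (i + j)) a" "c = (prodl ds ^^ i) a"
        using v(2,3) by (simp_all add: y)
      have ds: "ds \<in> planar S" and a: "a \<in> S" and ijk: "0 < i" "0 < j" "0 < k" "i + j + k = card (orbit (prodl ds) a)"
        using v1 eqs by auto
      obtain "distinct [a, b, c]" "b \<in> orbit (prodl ds) a" "c \<in> orbit (prodl ds) a"
        by (rule orbits_cut_three[OF fin perm[OF ds] a ijk eqs(4,3)]) blast
      moreover have "orbit (prodl ds) a \<subseteq> S" by (rule orbit_subset_of_permutes[OF perm[OF ds] a])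
      moreover have "cut (prodl ds) a b c" unfolding cut_def using ijk eqs(3,4) by blast
      ultimately show "y \<in> cons1 S" using ds a by (auto simp: y cons1_def triples_def)
    qed
  next
    fix v v' ds assume vv: "v \<in> ?J" "v' \<in> ?J" "?t v = ?t v'" "ds \<in> ?D v" "ds \<in> ?D v'"
    obtain x i j k where v: "v = (x, (i, j, k))" by (metis prod.exhaust)
    obtain x' i' j' k' where v': "v' = (x', (i', j', k'))" by (metis prod.exhaust)
    have x: "x' = x" using vv(3-5) by (auto simp: v v' prod_eq_iff)
    note J1 = vv(1)[unfolded v J] and J2 = vv(2)[unfolded v' x J]
    have "(prodl (fst x) ^^ i) (snd x) = (prodl (fst x) ^^ i') (snd x)"
      "(prodl (fst x) ^^ (i + j)) (snd x) = (prodl (fst x) ^^ (i' + j')) (snd x)"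
      using vv(3) by (simp_all add: v v' x)
    \<comment> \<open>All exponents are below the length of the cycle, because \<open>j\<close> and
      \<open>k\<close> are positive; so equal points have equal exponents.\<close>
    then have "i = i'" "i + j = i' + j'"
      using funpow_eq_iff[OF fin perm, of "fst x" _ "snd x"] J1 J2 by auto
    then show "v = v'" using J1 J2 by (simp add: v v' x)
  qed auto
  also have "\<dots> = (\<Sum>y\<in>?J. val S (fst y) * ?g (snd y))"
  proof (rule sum.cong)
    fix y assume y: "y \<in> ?J"
    obtain x i j k where v: "y = (x, (i, j, k))" by (metis prod.exhaust)
    note J1 = y[unfolded v J]
    have "mon (orbits (cyc3 (snd x) ((prodl (fst x) ^^ (i + j)) (snd x)) ((prodl (fst x) ^^ i) (snd x)) \<circ> prodl (fst x)) S)
        = p_var i * p_var j * p_var k * rest S x"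
      unfolding rest_def using J1 by (intro mon_cut fin perm) auto
    then show "(\<Sum>ds\<in>?D y. Cons_weight S (?t y, ds)) = val S (fst y) * ?g (snd y)"
      unfolding v Cons_weight_def val_def cyc_def by (simp add: mult_ac)
  qed simp
  also have "\<dots> = (\<Sum>x\<in>pointed S. \<Sum>u\<in>?I x. val S x * ?g u)"
    by (subst sum.Sigma) (auto simp: finite_pointed[OF fin] case_prod_beta)
  also have "\<dots> = (\<Sum>u\<in>?N. ?g u * ptd S (?s u))"
    by (subst sum_mult_ptd[OF fin]) (auto simp: sum_distrib_left)
  finally show ?thesis by (simp add: case_prod_beta)
qed

lemma planar_sets_disjoint:
  assumes "d1 \<in> planar A" "d2 \<in> planar B" "A \<inter> B = {}"
  shows "set d1 \<inter> set d2 = {}"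
  using planarD(2)[OF assms(1)] planarD(2)[OF assms(2)] tri_disjoint[OF assms(3)] by blast

lemma sum_compositions:
  fixes m n :: nat
  assumes "m \<le> n"
  shows "(\<Sum>u | u \<in> {1..n} \<times> {1..n} \<and> fst u + snd u = m. h u) = (\<Sum>d\<in>{1..<m}. h (m - d, d))"
  by (rule sum.reindex_bij_witness[where i = "\<lambda>d. (m - d, d)" and j = snd]) (use assms in auto)

text \<open>The data are the class \<open>A\<close> of \<open>a\<close> and \<open>b\<close>, marked
  points \<open>a\<close> and \<open>c\<close> in the two classes, and the distance \<open>d\<close>
  from \<open>a\<close> to \<open>b\<close>. For cycle lengths \<open>m\<close> and \<open>k\<close>
  the new cycles have lengths \<open>m - d\<close> and \<open>d + k\<close>.\<close>

lemma sum_cons2: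
  assumes fin: "finite S" and n: "card S \<le> n"
  shows "(\<Sum>x\<in>cons2 S. Cons_weight S x)
    = (\<Sum>(i, j, k)\<in>{1..n} \<times> {1..n} \<times> {1..n}. p_var i * p_var (j + k) * (\<Sum>A\<in>Pow S. ptd A (i + j) * ptd (S - A) k))"
proof -
  let ?N = "{1..n} \<times> {1..n} \<times> {1..n}"
  define J where "J = (SIGMA A:Pow S. SIGMA x:pointed A. SIGMA z:pointed (S - A). {1..<cycle_len x})"
  define t where "t v = (case v of (A, x, z, d) \<Rightarrow> (snd x, (prodl (fst x) ^^ d) (snd x), snd z))"
    for v :: "'a set \<times> (('a \<Rightarrow> 'a) list \<times> 'a) \<times> (('a \<Rightarrow> 'a) list \<times> 'a) \<times> nat"
  define D where "D v = (case v of (A, x, z, d) \<Rightarrow> shuffles (fst x) (fst z))"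
    for v :: "'a set \<times> (('a \<Rightarrow> 'a) list \<times> 'a) \<times> (('a \<Rightarrow> 'a) list \<times> 'a) \<times> nat"
  define G where "G v = (case v of (A, x, z, d) \<Rightarrow>
      val A x * (val (S - A) z * (p_var (cycle_len x - d) * p_var (d + cycle_len z))))"
    for v :: "'a set \<times> (('a \<Rightarrow> 'a) list \<times> 'a) \<times> (('a \<Rightarrow> 'a) list \<times> 'a) \<times> nat"
  have finA: "finite A" "finite (S - A)" if "A \<subseteq> S" for A using that fin finite_subset by auto
  have finJ: "finite J" unfolding J_def
    using fin by (intro finite_SigmaI) (auto intro!: finite_pointed finA)
  have J: "(A, (d1, a), (d2, c), d) \<in> J \<longleftrightarrow> A \<subseteq> S \<and> d1 \<in> planar A \<and> a \<in> A \<and> d2 \<in> planar (S - A) \<and> c \<in> S - A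
      \<and> 0 < d \<and> d < card (orbit (prodl d1) a)" for A d1 a d2 c d
    by (auto simp: J_def pointed_def cycle_len_def)
  have orb: "orbit (prodl ds) a = orbit (prodl d1) a"
    if "A \<subseteq> S" "d1 \<in> planar A" "a \<in> A" "d2 \<in> planar (S - A)" "ds \<in> shuffles d1 d2" for A d1 a d2 ds
    by (rule orbit_shuffle(1)[OF finA[OF that(1)] _ planarD(2)[OF that(2)] planarD(2)[OF that(4)] that(5,3)]) blast
  have "(\<Sum>x\<in>cons2 S. Cons_weight S x) = (\<Sum>v\<in>J. \<Sum>ds\<in>D v. Cons_weight S (t v, ds))"
  proof (rule sum_over_fibres[OF finJ])
    fix y :: "(('a \<times> 'a \<times> 'a) \<times> ('a \<Rightarrow> 'a) list)"
    obtain a b c ds where y: "y = ((a, b, c), ds)" by (metis prod.exhaust)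
    show "y \<in> cons2 S \<longleftrightarrow> (\<exists>v\<in>J. fst y = t v \<and> snd y \<in> D v)"
    proof
      assume "y \<in> cons2 S"
      then have sp: "split2 is_planar S a b c ds" and b: "b \<in> orbit (prodl ds) a" and "a \<noteq> b"
        by (auto simp: y cons2_def triples_def)
      obtain A d1 d2 where A: "A \<subseteq> S" "d1 \<in> planar A" "d2 \<in> planar (S - A)" "ds \<in> shuffles d1 d2"
        "a \<in> A" "b \<in> A" "c \<in> S - A" using sp unfolding split2_def by blast
      have "b \<in> orbit (prodl d1) a - {a}" using b \<open>a \<noteq> b\<close> orb[OF A(1,2,5,3,4)] by auto
      then obtain d where d: "d \<in> {1..<card (orbit (prodl d1) a)}" "b = (prodl d1 ^^ d) a"
        unfolding orbit_pow_inj(2)[OF finA(1)[OF A(1)] planarD(3)[OF A(2)], symmetric] by blast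
      have "(A, (d1, a), (d2, c), d) \<in> J" unfolding J using A d(1) by auto
      then show "\<exists>v\<in>J. fst y = t v \<and> snd y \<in> D v"
        by (rule rev_bexI) (simp add: y t_def D_def d(2) A(4))
    next
      assume "\<exists>v\<in>J. fst y = t v \<and> snd y \<in> D v"
      then obtain v where v: "v \<in> J" "fst y = t v" "snd y \<in> D v" by blast
      obtain A d1 a' d2 c' d where v': "v = (A, (d1, a'), (d2, c'), d)" by (metis prod.exhaust)
      have eqs: "a' = a" "c' = c" "b = (prodl d1 ^^ d) a" "ds \<in> shuffles d1 d2"
        using v(2,3) by (auto simp: y v' t_def D_def)
      have A: "A \<subseteq> S" "d1 \<in> planar A" "a \<in> A" "d2 \<in> planar (S - A)" "c \<in> S - A" "0 < d" "d < card (orbit (prodl d1) a)"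
        using v(1)[unfolded v' J] eqs by auto
      have "b \<in> (\<lambda>d. (prodl d1 ^^ d) a) ` {1..<card (orbit (prodl d1) a)}" using A(6,7) eqs(3) by auto
      then have b: "b \<in> orbit (prodl d1) a - {a}"
        unfolding orbit_pow_inj(2)[OF finA(1)[OF A(1)] planarD(3)[OF A(2)]] .
      have bA: "b \<in> A" using b orbit_subset_of_permutes[OF planarD(3)[OF A(2)] A(3)] by blast
      have "split2 is_planar S a b c ds" unfolding split2_def using A bA eqs(4) by blast
      moreover have "b \<in> orbit (prodl ds) a" using b orb[OF A(1-4) eqs(4)] by simp
      moreover have "(a, b, c) \<in> triples S" using A b bA by (auto simp: triples_def)
      ultimately show "y \<in> cons2 S" by (simp add: y cons2_def)
    qed
  next
    fix v v' ds assume vv: "v \<in> J" "v' \<in> J" "t v = t v'" "ds \<in> D v" "ds \<in> D v'"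
    obtain A d1 a d2 c d where v: "v = (A, (d1, a), (d2, c), d)" by (metis prod.exhaust)
    obtain A' d1' a' d2' c' d' where v': "v' = (A', (d1', a'), (d2', c'), d')" by (metis prod.exhaust)
    have ac: "a' = a" "c' = c" using vv(3) by (auto simp: v v' t_def)
    have sh: "ds \<in> shuffles d1 d2" "ds \<in> shuffles d1' d2'" using vv(4,5) by (auto simp: v v' D_def)
    note J1 = vv(1)[unfolded v J] and J2 = vv(2)[unfolded v' ac J]
    have A: "A \<subseteq> S" "conn A d1" "conn (S - A) d2" and A': "A' \<subseteq> S" "conn A' d1'" "conn (S - A') d2'"
      using J1 J2 planarD(1) by blast+
    note s = split2_component[OF fin A sh(1)] and s' = split2_component[OF fin A' sh(2)]
    have AA: "A' = A" using s(2)[of a] s'(2)[of a] J1 J2 by simp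
    have dd: "d1' = d1" "d2' = d2" using s(4,5) s'(4,5) unfolding AA by simp_all
    have "(prodl d1 ^^ d) a = (prodl d1 ^^ d') a" using vv(3) by (simp add: v v' t_def dd ac)
    then have "d = d'"
      using funpow_eq_iff[OF finA(1)[OF A(1)], of "prodl d1" d a d'] planarD(3) J1 J2 dd by auto
    then show "v = v'" using AA dd ac by (simp add: v v')
  qed (auto simp: D_def)
  also have "\<dots> = (\<Sum>v\<in>J. G v)"
  proof (rule sum.cong)
    fix v assume v: "v \<in> J"
    obtain A d1 a d2 c d where v': "v = (A, (d1, a), (d2, c), d)" by (metis prod.exhaust)
    note J1 = v[unfolded v' J]
    let ?q = "p_var (cycle_len (d1, a) - d) * p_var (d + cycle_len (d2, c))"
    have pt: "(d1, a) \<in> pointed A" "(d2, c) \<in> pointed (S - A)" using J1 by (auto simp: pointed_def)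
    have "Cons_weight S (t v, ds) = wt ds * (?q * (rest A (d1, a) * rest (S - A) (d2, c)))"
      if "ds \<in> shuffles d1 d2" for ds
      unfolding Cons_weight_def fst_conv snd_conv
      using mon_split2[OF fin _ pt that, of d "(prodl d1 ^^ d) a"] J1
      by (simp add: t_def v' cyc_def cycle_len_def del: foldr.simps)
    then have "(\<Sum>ds\<in>D v. Cons_weight S (t v, ds))
        = (\<Sum>ds\<in>shuffles d1 d2. wt ds) * (?q * (rest A (d1, a) * rest (S - A) (d2, c)))"
      by (simp add: D_def v' sum_distrib_right)
    also have "(\<Sum>ds\<in>shuffles d1 d2. wt ds) = wt d1 * wt d2"
      using J1 planar_sets_disjoint[of d1 A d2 "S - A"] by (intro sum_wt_shuffles) auto
    finally show "(\<Sum>ds\<in>D v. Cons_weight S (t v, ds)) = G v"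
      by (simp add: val_def G_def v' mult_ac)
  qed simp
  also have "\<dots> = (\<Sum>A\<in>Pow S. \<Sum>x\<in>pointed A. \<Sum>z\<in>pointed (S - A). \<Sum>d\<in>{1..<cycle_len x}. G (A, x, z, d))"
  proof -
    have f1: "finite (pointed A)" "finite (pointed (S - A))" if "A \<in> Pow S" for A
      using finA[of A] that by (simp_all add: finite_pointed)
    show ?thesis unfolding J_def
      using fin f1 by (simp add: sum.Sigma case_prod_beta)
  qed
  also have "\<dots> = (\<Sum>A\<in>Pow S. \<Sum>(i, j, k)\<in>?N. p_var i * p_var (j + k) * (ptd A (i + j) * ptd (S - A) k))"
  proof (rule sum.cong)
    fix A assume "A \<in> Pow S"
    then have A: "A \<subseteq> S" by simp
    have cA: "card A \<le> n" "card (S - A) \<le> n" using card_mono[OF fin A] card_mono[OF fin, of "S - A"] n by auto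
    let ?h = "\<lambda>u. \<Sum>z\<in>pointed (S - A). val (S - A) z * (p_var (fst u) * p_var (snd u + cycle_len z))"
    have "(\<Sum>(i, j, k)\<in>?N. p_var i * p_var (j + k) * (ptd A (i + j) * ptd (S - A) k))
        = (\<Sum>(i, j)\<in>{1..n} \<times> {1..n}. \<Sum>k\<in>{1..n}. p_var i * p_var (j + k) * (ptd A (i + j) * ptd (S - A) k))"
      by (simp add: sum.cartesian_product[symmetric])
    also have "\<dots> = (\<Sum>u\<in>{1..n} \<times> {1..n}. ?h u * ptd A (fst u + snd u))"
    proof (rule sum.cong)
      fix u assume "u \<in> {1..n} \<times> {1..n}"
      obtain i j where u: "u = (i, j)" by (cases u)
      have "(\<Sum>k\<in>{1..n}. p_var i * p_var (j + k) * (ptd A (i + j) * ptd (S - A) k))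
          = (\<Sum>k\<in>{1..n}. (p_var i * p_var (j + k)) * ptd (S - A) k) * ptd A (i + j)"
        by (simp add: sum_distrib_left sum_distrib_right mult_ac)
      also have "\<dots> = ?h (i, j) * ptd A (i + j)"
        by (subst sum_mult_ptd'[OF finA(2)[OF A] cA(2)]) simp
      finally show "(case u of (i, j) \<Rightarrow> \<Sum>k\<in>{1..n}. p_var i * p_var (j + k) * (ptd A (i + j) * ptd (S - A) k))
          = ?h u * ptd A (fst u + snd u)" by (simp add: u)
    qed simp
    also have "\<dots> = (\<Sum>x\<in>pointed A. val A x * (\<Sum>u | u \<in> {1..n} \<times> {1..n} \<and> fst u + snd u = cycle_len x. ?h u))"
      by (rule sum_mult_ptd[OF finA(1)[OF A]]) simp
    \<comment> \<open>The index \<open>j\<close> is the distance from \<open>a\<close> to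
      \<open>b\<close>, and \<open>i\<close> is the remainder of the cycle.\<close>
    also have "\<dots> = (\<Sum>x\<in>pointed A. val A x * (\<Sum>d\<in>{1..<cycle_len x}. ?h (cycle_len x - d, d)))"
    proof (rule sum.cong)
      fix x assume x: "x \<in> pointed A"
      let ?m = "cycle_len x"
      have m: "?m \<le> n" using cycle_len_bounds(2)[OF finA(1)[OF A] x] cA by simp
      have "(\<Sum>u | u \<in> {1..n} \<times> {1..n} \<and> fst u + snd u = ?m. ?h u) = (\<Sum>d\<in>{1..<?m}. ?h (?m - d, d))"
        by (rule sum_compositions[OF m])
      then show "val A x * (\<Sum>u | u \<in> {1..n} \<times> {1..n} \<and> fst u + snd u = ?m. ?h u)
          = val A x * (\<Sum>d\<in>{1..<?m}. ?h (?m - d, d))" by simp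
    qed simp
    also have "\<dots> = (\<Sum>x\<in>pointed A. \<Sum>z\<in>pointed (S - A). \<Sum>d\<in>{1..<cycle_len x}. G (A, x, z, d))"
    proof (rule sum.cong)
      fix x assume "x \<in> pointed A"
      have "(\<Sum>d\<in>{1..<cycle_len x}. ?h (cycle_len x - d, d))
          = (\<Sum>z\<in>pointed (S - A). \<Sum>d\<in>{1..<cycle_len x}.
              val (S - A) z * (p_var (cycle_len x - d) * p_var (d + cycle_len z)))"
        unfolding fst_conv snd_conv by (rule sum.swap)
      then show "val A x * (\<Sum>d\<in>{1..<cycle_len x}. ?h (cycle_len x - d, d))
          = (\<Sum>z\<in>pointed (S - A). \<Sum>d\<in>{1..<cycle_len x}. G (A, x, z, d))"
        by (simp add: sum_distrib_left G_def)
    qed simp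
    finally show "(\<Sum>x\<in>pointed A. \<Sum>z\<in>pointed (S - A). \<Sum>d\<in>{1..<cycle_len x}. G (A, x, z, d))
        = (\<Sum>(i, j, k)\<in>?N. p_var i * p_var (j + k) * (ptd A (i + j) * ptd (S - A) k))" by simp
  qed simp
  also have "\<dots> = (\<Sum>u\<in>?N. \<Sum>A\<in>Pow S. case u of (i, j, k) \<Rightarrow> p_var i * p_var (j + k) * (ptd A (i + j) * ptd (S - A) k))"
    by (rule sum.swap)
  finally show ?thesis by (simp add: sum_distrib_left case_prod_beta)
qed

text \<open>Deleting the factors of \<open>d1\<close> gives back the inner shuffle, so the union
  defining \<open>shuffles3\<close> is disjoint.\<close>

lemma sum_wt_shuffles3:
  assumes "set d1 \<inter> set d2 = {}" "set d1 \<inter> set d3 = {}" "set d2 \<inter> set d3 = {}"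
  shows "(\<Sum>ds\<in>shuffles3 d1 d2 d3. wt ds) = wt d1 * wt d2 * wt d3"
proof -
  have disj: "set d1 \<inter> set d' = {}" if "d' \<in> shuffles d2 d3" for d'
    using set_shuffles[OF that] assms(1,2) by auto
  have "shuffles d1 d' \<inter> shuffles d1 d'' = {}" if "d' \<in> shuffles d2 d3" "d'' \<in> shuffles d2 d3" "d' \<noteq> d''" for d' d''
    using filter_shuffles_disjoint1(2)[OF disj[OF that(1)]] filter_shuffles_disjoint1(2)[OF disj[OF that(2)]] that(3)
    by blast
  then have "(\<Sum>ds\<in>shuffles3 d1 d2 d3. wt ds) = (\<Sum>d'\<in>shuffles d2 d3. \<Sum>ds\<in>shuffles d1 d'. wt ds)"
    unfolding shuffles3_def by (intro sum.UNION_disjoint) auto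
  also have "\<dots> = (\<Sum>d'\<in>shuffles d2 d3. wt d1 * wt d')"
    by (intro sum.cong refl sum_wt_shuffles disj)
  also have "\<dots> = wt d1 * wt d2 * wt d3"
    by (simp add: sum_distrib_left[symmetric] sum_wt_shuffles[OF assms(3)] mult.assoc)
  finally show ?thesis .
qed

text \<open>The points \<open>a\<close>, \<open>b\<close>, \<open>c\<close> put the three classes in
  order and mark one cycle in each. Hence the sum is over ordered pairs \<open>A\<close>,
  \<open>B\<close>, with no division by a symmetry.\<close>

lemma sum_cons3:
  assumes fin: "finite S" and n: "card S \<le> n"
  shows "(\<Sum>x\<in>cons3 S. Cons_weight S x)
    = (\<Sum>(i, j, k)\<in>{1..n} \<times> {1..n} \<times> {1..n}. p_var (i + j + k) *
        (\<Sum>A\<in>Pow S. \<Sum>B\<in>Pow (S - A). ptd A i * ptd B j * ptd (S - A - B) k))"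
proof -
  let ?N = "{1..n} \<times> {1..n} \<times> {1..n}"
  define J where "J = (SIGMA A:Pow S. SIGMA B:Pow (S - A). SIGMA x:pointed A. SIGMA y:pointed B. pointed (S - A - B))"
  define t where "t v = (case v of (A, B, x, y, z) \<Rightarrow> (snd x, snd y, snd z))"
    for v :: "'a set \<times> 'a set \<times> (('a \<Rightarrow> 'a) list \<times> 'a) \<times> (('a \<Rightarrow> 'a) list \<times> 'a) \<times> (('a \<Rightarrow> 'a) list \<times> 'a)"
  define D where "D v = (case v of (A, B, x, y, z) \<Rightarrow> shuffles3 (fst x) (fst y) (fst z))"
    for v :: "'a set \<times> 'a set \<times> (('a \<Rightarrow> 'a) list \<times> 'a) \<times> (('a \<Rightarrow> 'a) list \<times> 'a) \<times> (('a \<Rightarrow> 'a) list \<times> 'a)"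
  define G where "G v = (case v of (A, B, x, y, z) \<Rightarrow>
      val A x * (val B y * (val (S - A - B) z * p_var (cycle_len x + cycle_len y + cycle_len z))))"
    for v :: "'a set \<times> 'a set \<times> (('a \<Rightarrow> 'a) list \<times> 'a) \<times> (('a \<Rightarrow> 'a) list \<times> 'a) \<times> (('a \<Rightarrow> 'a) list \<times> 'a)"
  have finA: "finite A" "finite B" "finite (S - A - B)" if "A \<subseteq> S" "B \<subseteq> S - A" for A B
    using fin finite_subset[OF that(1)] finite_subset[OF that(2)] by auto
  have f1: "finite (pointed A)" "finite (pointed B)" "finite (pointed (S - A - B))" if "A \<in> Pow S" "B \<in> Pow (S - A)" for A B
    using finA[of A B] that by (simp_all add: finite_pointed)
  have f2: "finite (Pow (S - A))" for A using fin by simp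
  have finJ: "finite J" unfolding J_def
    by (intro finite_SigmaI) (use fin in \<open>auto intro: f1\<close>)
  have J: "(A, B, (d1, a), (d2, b), (d3, c)) \<in> J \<longleftrightarrow> A \<subseteq> S \<and> B \<subseteq> S - A \<and> d1 \<in> planar A \<and> a \<in> A
      \<and> d2 \<in> planar B \<and> b \<in> B \<and> d3 \<in> planar (S - A - B) \<and> c \<in> S - A - B" for A B d1 a d2 b d3 c
    by (auto simp: J_def pointed_def)
  have "(\<Sum>x\<in>cons3 S. Cons_weight S x) = (\<Sum>v\<in>J. \<Sum>ds\<in>D v. Cons_weight S (t v, ds))"
  proof (rule sum_over_fibres[OF finJ])
    fix y :: "(('a \<times> 'a \<times> 'a) \<times> ('a \<Rightarrow> 'a) list)"
    obtain a b c ds where y: "y = ((a, b, c), ds)" by (metis prod.exhaust)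
    show "y \<in> cons3 S \<longleftrightarrow> (\<exists>v\<in>J. fst y = t v \<and> snd y \<in> D v)"
    proof
      assume "y \<in> cons3 S"
      then have "split3 is_planar S a b c ds" by (simp add: y cons3_def)
      then obtain A B d1 d2 d3 where A: "A \<subseteq> S" "B \<subseteq> S - A" "d1 \<in> planar A" "d2 \<in> planar B" "d3 \<in> planar (S - A - B)"
        "ds \<in> shuffles3 d1 d2 d3" "a \<in> A" "b \<in> B" "c \<in> S - A - B" unfolding split3_def by blast
      have "(A, B, (d1, a), (d2, b), (d3, c)) \<in> J" unfolding J using A by blast
      then show "\<exists>v\<in>J. fst y = t v \<and> snd y \<in> D v"
        by (rule rev_bexI) (simp add: y t_def D_def A(6))
    next
      assume "\<exists>v\<in>J. fst y = t v \<and> snd y \<in> D v"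
      then obtain v where v: "v \<in> J" "fst y = t v" "snd y \<in> D v" by blast
      obtain A B d1 a' d2 b' d3 c' where v': "v = (A, B, (d1, a'), (d2, b'), (d3, c'))" by (metis prod.exhaust)
      have eqs: "a' = a" "b' = b" "c' = c" "ds \<in> shuffles3 d1 d2 d3"
        using v(2,3) by (auto simp: y v' t_def D_def)
      have A: "A \<subseteq> S" "B \<subseteq> S - A" "d1 \<in> planar A" "a \<in> A" "d2 \<in> planar B" "b \<in> B" "d3 \<in> planar (S - A - B)" "c \<in> S - A - B"
        using v(1)[unfolded v' J] eqs by auto
      have "split3 is_planar S a b c ds" unfolding split3_def using A eqs(4) by blast
      moreover have "(a, b, c) \<in> triples S" using A by (auto simp: triples_def)
      ultimately show "y \<in> cons3 S" by (simp add: y cons3_def)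
    qed
  next
    fix v v' ds assume vv: "v \<in> J" "v' \<in> J" "t v = t v'" "ds \<in> D v" "ds \<in> D v'"
    obtain A B d1 a d2 b d3 c where v: "v = (A, B, (d1, a), (d2, b), (d3, c))" by (metis prod.exhaust)
    obtain A' B' d1' a' d2' b' d3' c' where v': "v' = (A', B', (d1', a'), (d2', b'), (d3', c'))" by (metis prod.exhaust)
    have ac: "a' = a" "b' = b" "c' = c" using vv(3) by (auto simp: v v' t_def)
    have sh: "ds \<in> shuffles3 d1 d2 d3" "ds \<in> shuffles3 d1' d2' d3'" using vv(4,5) by (auto simp: v v' D_def)
    note J1 = vv(1)[unfolded v J] and J2 = vv(2)[unfolded v' ac J]
    have A: "A \<subseteq> S" "B \<subseteq> S - A" "conn A d1" "conn B d2" "conn (S - A - B) d3"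
      and A': "A' \<subseteq> S" "B' \<subseteq> S - A'" "conn A' d1'" "conn B' d2'" "conn (S - A' - B') d3'"
      using J1 J2 planarD(1) by blast+
    note s = split3_component[OF fin A sh(1)] and s' = split3_component[OF fin A' sh(2)]
    have AA: "A' = A" "B' = B" using s(1)[of a] s'(1)[of a] s(2)[of b] s'(2)[of b] J1 J2 by simp_all
    have dd: "d1' = d1" "d2' = d2" "d3' = d3" using s(4-6) s'(4-6) unfolding AA by simp_all
    then show "v = v'" using AA ac by (simp add: v v')
  qed (auto simp: D_def shuffles3_def)
  also have "\<dots> = (\<Sum>v\<in>J. G v)"
  proof (rule sum.cong)
    fix v assume v: "v \<in> J"
    obtain A B d1 a d2 b d3 c where v': "v = (A, B, (d1, a), (d2, b), (d3, c))" by (metis prod.exhaust)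
    note J1 = v[unfolded v' J]
    let ?q = "p_var (cycle_len (d1, a) + cycle_len (d2, b) + cycle_len (d3, c))"
    let ?r = "rest A (d1, a) * rest B (d2, b) * rest (S - A - B) (d3, c)"
    have pt: "(d1, a) \<in> pointed A" "(d2, b) \<in> pointed B" "(d3, c) \<in> pointed (S - A - B)"
      using J1 by (auto simp: pointed_def)
    have "Cons_weight S (t v, ds) = wt ds * (?q * ?r)" if "ds \<in> shuffles3 d1 d2 d3" for ds
      unfolding Cons_weight_def fst_conv snd_conv
      using mon_split3[OF fin _ _ pt that] J1 by (simp add: t_def v' cyc_def del: foldr.simps)
    then have "(\<Sum>ds\<in>D v. Cons_weight S (t v, ds)) = (\<Sum>ds\<in>shuffles3 d1 d2 d3. wt ds) * (?q * ?r)"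
      by (simp add: D_def v' sum_distrib_right)
    also have "(\<Sum>ds\<in>shuffles3 d1 d2 d3. wt ds) = wt d1 * wt d2 * wt d3"
      using J1 planar_sets_disjoint[of d1 A d2 B] planar_sets_disjoint[of d1 A d3 "S - A - B"]
        planar_sets_disjoint[of d2 B d3 "S - A - B"] by (intro sum_wt_shuffles3) auto
    finally show "(\<Sum>ds\<in>D v. Cons_weight S (t v, ds)) = G v"
      by (simp add: val_def G_def v' mult_ac)
  qed simp
  also have "\<dots> = (\<Sum>A\<in>Pow S. \<Sum>B\<in>Pow (S - A). \<Sum>x\<in>pointed A. \<Sum>y\<in>pointed B. \<Sum>z\<in>pointed (S - A - B). G (A, B, x, y, z))"
  proof -
    have f3: "finite (SIGMA B:Pow (S - A). SIGMA x:pointed A. SIGMA y:pointed B. pointed (S - A - B))"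
      if "A \<in> Pow S" for A
      using f1[OF that] f2 by (intro finite_SigmaI) auto
    have "(\<Sum>v\<in>J. G v) = (\<Sum>A\<in>Pow S. \<Sum>v\<in>(SIGMA B:Pow (S - A). SIGMA x:pointed A. SIGMA y:pointed B. pointed (S - A - B)). G (A, v))"
      unfolding J_def by (rule sum_Sigma) (use fin f3 in auto)
    also have "\<dots> = (\<Sum>A\<in>Pow S. \<Sum>B\<in>Pow (S - A). \<Sum>v\<in>(SIGMA x:pointed A. SIGMA y:pointed B. pointed (S - A - B)). G (A, B, v))"
      using f1 f2 by (intro sum.cong refl sum_Sigma finite_SigmaI) auto
    also have "\<dots> = (\<Sum>A\<in>Pow S. \<Sum>B\<in>Pow (S - A). \<Sum>x\<in>pointed A. \<Sum>y\<in>pointed B. \<Sum>z\<in>pointed (S - A - B). G (A, B, x, y, z))"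
      by (simp add: sum.cartesian_product case_prod_beta)
    finally show ?thesis .
  qed
  also have "\<dots> = (\<Sum>A\<in>Pow S. \<Sum>B\<in>Pow (S - A). \<Sum>(i, j, k)\<in>?N. p_var (i + j + k) * (ptd A i * ptd B j * ptd (S - A - B) k))"
  proof (intro sum.cong refl)
    fix A B assume "A \<in> Pow S" "B \<in> Pow (S - A)"
    then have A: "A \<subseteq> S" "B \<subseteq> S - A" by auto
    let ?C = "S - A - B"
    note fA = finA[OF A]
    have cA: "card A \<le> n" "card B \<le> n" "card ?C \<le> n"
      using card_mono[OF fin A(1)] card_mono[OF fin, of B] card_mono[OF fin, of ?C] A n by fastforce+
    have "(\<Sum>(i, j, k)\<in>?N. p_var (i + j + k) * (ptd A i * ptd B j * ptd ?C k))
        = (\<Sum>i\<in>{1..n}. (\<Sum>j\<in>{1..n}. (\<Sum>k\<in>{1..n}. p_var (i + j + k) * ptd ?C k) * ptd B j) * ptd A i)"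
      by (simp add: sum.cartesian_product[symmetric] sum_distrib_left sum_distrib_right mult_ac)
    also have "\<dots> = (\<Sum>x\<in>pointed A. val A x * (\<Sum>y\<in>pointed B. val B y *
        (\<Sum>z\<in>pointed ?C. val ?C z * p_var (cycle_len x + cycle_len y + cycle_len z))))"
      unfolding sum_mult_ptd'[OF fA(3) cA(3)] sum_mult_ptd'[OF fA(2) cA(2)] sum_mult_ptd'[OF fA(1) cA(1)] ..
    also have "\<dots> = (\<Sum>x\<in>pointed A. \<Sum>y\<in>pointed B. \<Sum>z\<in>pointed ?C. G (A, B, x, y, z))"
      by (simp add: G_def sum_distrib_left)
    finally show "(\<Sum>x\<in>pointed A. \<Sum>y\<in>pointed B. \<Sum>z\<in>pointed ?C. G (A, B, x, y, z))
        = (\<Sum>(i, j, k)\<in>?N. p_var (i + j + k) * (ptd A i * ptd B j * ptd ?C k))" by simp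
  qed
  also have "\<dots> = (\<Sum>A\<in>Pow S. \<Sum>u\<in>?N. \<Sum>B\<in>Pow (S - A). case u of (i, j, k) \<Rightarrow> p_var (i + j + k) * (ptd A i * ptd B j * ptd (S - A - B) k))"
    by (intro sum.cong refl sum.swap)
  also have "\<dots> = (\<Sum>u\<in>?N. \<Sum>A\<in>Pow S. \<Sum>B\<in>Pow (S - A). case u of (i, j, k) \<Rightarrow> p_var (i + j + k) * (ptd A i * ptd B j * ptd (S - A - B) k))"
    by (rule sum.swap)
  finally show ?thesis by (simp add: sum_distrib_left case_prod_beta)
qed

text \<open>The right side is the cubic sum with marked cycles in place of derivatives and with
  choices of subsets in place of products of series.\<close>

theorem planar_recursion:
  assumes fin: "finite S" and n: "card S \<le> n"
  shows "(\<Sum>ds\<in>planar S. of_nat (3 * length ds) * wt ds * mon (orbits (prodl ds) S))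
    = (\<Sum>(i, j, k)\<in>{1..n} \<times> {1..n} \<times> {1..n}.
        p_var i * p_var j * p_var k * ptd S (i + j + k)
      + p_var (i + j + k) * (\<Sum>A\<in>Pow S. \<Sum>B\<in>Pow (S - A). ptd A i * ptd B j * ptd (S - A - B) k)
      + 3 * (p_var i * p_var (j + k) * (\<Sum>A\<in>Pow S. ptd A (i + j) * ptd (S - A) k)))"
  unfolding sum_Cons_planar[OF fin] sum_Cons_planar_split[OF fin] sum_cons1[OF fin n] sum_cons2[OF fin n]
    sum_cons3[OF fin n]
  by (simp add: case_prod_beta sum.distrib sum_distrib_left)


section \<open>Relabelling\<close>

text \<open>Conjugation by \<open>g\<close>. It shows that \<open>ptd\<close> depends only on the
  number of points, which is all that an exponential generating function can record.\<close>

definition relabel :: "('a \<Rightarrow> 'b) \<Rightarrow> ('a \<Rightarrow> 'a) \<Rightarrow> 'b \<Rightarrow> 'b" where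
  "relabel g d = g \<circ> d \<circ> inv' g"

context
  fixes g :: "'a \<Rightarrow> 'b"
  assumes g: "bij g"
begin

lemma relabel_apply: "relabel g d (g x) = g (d x)"
  using bij_is_inj[OF g] by (simp add: relabel_def)

lemma relabel_eqI: "(\<And>x. d' (g x) = g (d x)) \<Longrightarrow> relabel g d = d'"
  using bij_is_surj[OF g] relabel_apply by (metis ext surjD)

lemma relabel_comp: "relabel g (d \<circ> e) = relabel g d \<circ> relabel g e"
  by (rule relabel_eqI) (simp add: relabel_apply)

lemma relabel_id: "relabel g id = id"
  by (rule relabel_eqI) simp

lemma relabel_cyc3: "relabel g (cyc3 a b c) = cyc3 (g a) (g b) (g c)"
  using bij_is_inj[OF g] by (intro relabel_eqI) (auto simp: cyc3_def transpose_def inj_eq)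

lemma prodl_relabel: "prodl (map (relabel g) ds) = relabel g (prodl ds)"
proof (induction ds)
  case Nil
  show ?case by (simp only: list.map foldr.simps id_apply[of id] relabel_id)
next
  case (Cons d ds)
  then show ?case by (simp only: list.map prodl_Cons_comp relabel_comp)
qed

lemma funpow_relabel: "(relabel g d ^^ n) (g x) = g ((d ^^ n) x)"
  by (induction n) (simp_all add: relabel_apply)

lemma orbit_relabel: "orbit (relabel g d) (g x) = g ` orbit d x"
  unfolding orbit_altdef funpow_relabel by blast

lemma orbits_relabel: "orbits (relabel g d) (g ` S) = (`) g ` orbits d S"
  unfolding orbits_def by (simp add: image_image orbit_relabel)

lemma card_relabel: "card (g ` X) = card X"
  by (rule card_image[OF inj_on_subset[OF bij_is_inj[OF g]]]) simp

lemma inj_on_image_g: "inj_on ((`) g) C"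
  using bij_is_inj[OF g] by (simp add: inj_on_def inj_image_eq_iff)

lemma supp_relabel: "supp (relabel g d) = g ` supp d"
proof -
  have "y \<in> supp (relabel g d) \<longleftrightarrow> y \<in> g ` supp d" for y
  proof -
    obtain x where y: "y = g x" using bij_is_surj[OF g] by blast
    show ?thesis unfolding y using bij_is_inj[OF g] by (simp add: supp_def relabel_apply inj_eq inj_image_mem_iff)
  qed
  then show ?thesis by blast
qed

lemma tri_relabel: "d \<in> tri S \<Longrightarrow> relabel g d \<in> tri (g ` S)"
  using bij_is_inj[OF g] by (elim triE) (auto simp: relabel_cyc3 inj_eq intro!: triI)

lemma conn_relabel:
  assumes "conn S ds"
  shows "conn (g ` S) (map (relabel g) ds)"
  unfolding conn_def
proof (intro conjI allI impI)
  show "g ` S \<noteq> {}" using conn_nonempty[OF assms] by simp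
  show "set (map (relabel g) ds) \<subseteq> tri (g ` S)" using conn_tri[OF assms] tri_relabel by auto
  fix A assume A: "A \<subseteq> g ` S" "A \<noteq> {}" "invariant (map (relabel g) ds) A"
  obtain B where B: "A = g ` B" "B \<subseteq> S" using A(1) by (meson subset_imageE)
  have "invariant ds B"
    using A(3) bij_is_inj[OF g] unfolding invariant_def B(1)
    by (simp add: supp_relabel inj_image_subset_iff image_Int[symmetric])
  then have "B = S" using connD[OF assms B(2)] A(2) B(1) by simp
  then show "A = g ` S" using B(1) by simp
qed

lemma card_orbits_relabel: "card (orbits (relabel g d) (g ` S)) = card (orbits d S)"
  unfolding orbits_relabel by (rule card_image[OF inj_on_image_g])

lemma planar_relabel: "ds \<in> planar S \<Longrightarrow> map (relabel g) ds \<in> planar (g ` S)"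
  unfolding planar_iff using conn_relabel[of S ds]
  by (simp add: prodl_relabel card_orbits_relabel card_relabel del: foldr.simps)

end

lemma relabel_inv:
  assumes "bij g"
  shows "relabel (inv' g) (relabel g d) = d" "relabel g (relabel (inv' g) e) = e"
  using bij_is_inj[OF assms] bij_is_surj[OF assms]
  by (auto simp: relabel_def fun_eq_iff inv_inv_eq[OF assms] surj_f_inv_f)

lemma planar_relabel_image:
  assumes "bij g"
  shows "planar (g ` S) = map (relabel g) ` planar S"
proof (intro equalityI subsetI)
  fix es assume "es \<in> planar (g ` S)"
  then have "map (relabel (inv' g)) es \<in> planar (inv' g ` g ` S)"
    by (rule planar_relabel[OF bij_imp_bij_inv[OF assms]])
  moreover have "inv' g ` g ` S = S" using bij_is_inj[OF assms] by (simp add: image_image)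
  moreover have "es = map (relabel g) (map (relabel (inv' g)) es)"
    by (simp add: relabel_inv(2)[OF assms] comp_def)
  ultimately show "es \<in> map (relabel g) ` planar S" by (metis imageI)
qed (auto intro: planar_relabel[OF assms])

lemma ptd_relabel:
  assumes "bij g"
  shows "ptd (g ` S) i = ptd S i"
proof -
  let ?f = "\<lambda>x. (map (relabel g) (fst x), g (snd x))"
  note inj = bij_is_inj[OF assms]
  have cl: "cycle_len (?f x) = cycle_len x" for x
    by (simp add: cycle_len_def prodl_relabel[OF assms] orbit_relabel[OF assms] card_relabel[OF assms] del: foldr.simps)
  have val: "val (g ` S) (?f x) = val S x" for x
  proof -
    have "g ` S - orbit (prodl (map (relabel g) (fst x))) (g (snd x)) = g ` (S - orbit (prodl (fst x)) (snd x))"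
      unfolding prodl_relabel[OF assms] orbit_relabel[OF assms] using inj by (simp add: image_set_diff)
    then have "rest (g ` S) (?f x) = mon ((`) g ` orbits (prodl (fst x)) (S - orbit (prodl (fst x)) (snd x)))"
      unfolding rest_def fst_conv snd_conv by (simp only: prodl_relabel[OF assms] orbits_relabel[OF assms])
    also have "\<dots> = rest S x"
      unfolding mon_def rest_def
      by (simp add: prod.reindex[OF inj_on_image_g[OF assms]] card_relabel[OF assms] comp_def)
    finally show ?thesis by (simp add: val_def wt_def)
  qed
  have "inj (relabel g)" by (rule inj_on_inverseI[where g = "relabel (inv' g)"]) (simp add: relabel_inv(1)[OF assms])
  then have inj_f: "inj_on ?f X" for X
    using inj by (auto intro!: inj_onI simp: inj_eq prod_eq_iff)
  have "pointed (g ` S) = ?f ` pointed S"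
    unfolding pointed_def planar_relabel_image[OF assms] by force
  then have "{x. x \<in> pointed (g ` S) \<and> cycle_len x = i} = ?f ` {x. x \<in> pointed S \<and> cycle_len x = i}"
    using cl by auto
  then show ?thesis unfolding ptd_def by (simp add: sum.reindex[OF inj_f] val)
qed

text \<open>Conjugation uses the inverse of a bijection of the whole type, so a bijection from
  \<open>S\<close> onto \<open>T\<close> has to be extended. As \<open>T - S\<close> and
  \<open>S - T\<close> have equal size, the first is mapped back onto the second, and all other
  points stay fixed.\<close>

lemma finite_card_eq_bij:
  fixes S T :: "'a set"
  assumes "finite S" "finite T" "card S = card T"
  obtains g :: "'a \<Rightarrow> 'a" where "bij g" "g ` S = T"
proof -
  obtain f where f: "bij_betw f S T" using finite_same_card_bij[OF assms] by blast
  have "card (T - S) = card (S - T)"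
    using assms card_Diff_subset_Int[of T S] card_Diff_subset_Int[of S T] by (simp add: Int_commute)
  then obtain h where h: "bij_betw h (T - S) (S - T)"
    using finite_same_card_bij[of "T - S" "S - T"] assms by blast
  define g where "g x = (if x \<in> S then f x else if x \<in> T then h x else x)" for x
  have "bij_betw g S T" using f by (rule bij_betw_cong[THEN iffD1, rotated]) (simp add: g_def)
  moreover have "bij_betw g (T - S) (S - T)"
    using h by (rule bij_betw_cong[THEN iffD1, rotated]) (simp add: g_def)
  moreover have "bij_betw g (- (S \<union> T)) (- (S \<union> T))"
    using bij_betw_id by (rule bij_betw_cong[THEN iffD1, rotated]) (simp add: g_def)
  ultimately have "bij_betw g (S \<union> (T - S) \<union> - (S \<union> T)) (T \<union> (S - T) \<union> - (S \<union> T))"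
    by (intro bij_betw_combine) auto
  moreover have "S \<union> (T - S) \<union> - (S \<union> T) = UNIV" "T \<union> (S - T) \<union> - (S \<union> T) = UNIV" by auto
  ultimately have "bij g" by simp
  moreover have "g ` S = T" using \<open>bij_betw g S T\<close> by (simp add: bij_betw_def)
  ultimately show ?thesis by (rule that)
qed

lemma ptd_card_eq:
  fixes S T :: "'a set"
  assumes "finite S" "finite T" "card S = card T"
  shows "ptd S i = ptd T i"
proof -
  obtain g :: "'a \<Rightarrow> 'a" where "bij g" "g ` S = T" by (rule finite_card_eq_bij[OF assms])
  then show ?thesis using ptd_relabel[of g S i] by simp
qed


section \<open>Existence of planar factorizations\<close>

definition orbit_type :: "'a set \<Rightarrow> ('a \<Rightarrow> 'a) \<Rightarrow> nat multiset" where
  "orbit_type S \<sigma> = image_mset card (mset_set (orbits \<sigma> S))"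

definition realizable :: "nat multiset \<Rightarrow> bool" where
  "realizable \<alpha> \<longleftrightarrow> (\<exists>(S :: nat set) ds. finite S \<and> ds \<in> planar S \<and> orbit_type S (prodl ds) = \<alpha>)"

lemma orbits_partition: "\<sigma> permutes S \<Longrightarrow> finite S \<Longrightarrow> \<Union>(orbits \<sigma> S) = S"
  unfolding orbits_def using orbit_subset_of_permutes orbit_self by fast

lemma sum_orbit_type:
  assumes "finite S" "\<sigma> permutes S"
  shows "sum_mset (orbit_type S \<sigma>) = card S" "size (orbit_type S \<sigma>) = card (orbits \<sigma> S)" "0 \<notin># orbit_type S \<sigma>"
proof -
  have "card (\<Union>(orbits \<sigma> S)) = (\<Sum>X\<in>orbits \<sigma> S. card X)"
  proof (rule card_Union_disjoint)
    show "pairwise disjnt (orbits \<sigma> S)"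
      unfolding orbits_def pairwise_def disjnt_def using orbits_disjoint[OF assms] by auto
    show "\<And>X. X \<in> orbits \<sigma> S \<Longrightarrow> finite X" using finite_orbit_permutes[OF assms] by (auto simp: orbits_def)
  qed
  then show "sum_mset (orbit_type S \<sigma>) = card S"
    by (simp add: orbit_type_def orbits_partition assms sum_unfold_sum_mset)
  show "size (orbit_type S \<sigma>) = card (orbits \<sigma> S)" by (simp add: orbit_type_def)
  show "0 \<notin># orbit_type S \<sigma>"
  proof
    assume "0 \<in># orbit_type S \<sigma>"
    then obtain x where "card (orbit \<sigma> x) = 0"
      using finite_orbits[OF assms(1), of \<sigma>] by (auto simp: orbit_type_def orbits_def simp del: card_eq_0_iff)
    then show False using card_orbit_pos[OF assms, of x] by simp
  qed
qed

section \<open>Operations on realizable types\<close>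

lemma planar_singleton: "[] \<in> planar {x}"
  by (auto simp: planar_iff conn_def orbits_def)

lemma realizable_add_msetE:
  assumes "realizable (add_mset m \<alpha>)"
  obtains S :: "nat set" and ds a where "finite S" "ds \<in> planar S" "a \<in> S" "card (orbit (prodl ds) a) = m"
    "\<alpha> = image_mset card (mset_set (orbits (prodl ds) (S - orbit (prodl ds) a)))"
proof -
  obtain S :: "nat set" and ds where S: "finite S" "ds \<in> planar S" "orbit_type S (prodl ds) = add_mset m \<alpha>"
    using assms unfolding realizable_def by blast
  note perm = planarD(3)[OF S(2)]
  have "m \<in># orbit_type S (prodl ds)" using S(3) by simp
  then obtain a where a: "a \<in> S" "card (orbit (prodl ds) a) = m"
    using S(1) by (auto simp: orbit_type_def orbits_def)
  let ?O = "orbit (prodl ds) a"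
  have "orbits (prodl ds) S = orbits (prodl ds) (S - ?O) \<union> {?O}"
    using orbits_Diff_Un[OF S(1) perm orbit_subset_of_permutes[OF perm a(1)]] unfolding orbits_orbit[OF S(1) perm] .
  moreover have "orbits (prodl ds) (S - ?O) \<inter> {?O} = {}"
    using orbit_closed[OF S(1) perm] orbit_nonempty[of "prodl ds" a]
    by (intro orbits_Diff_disjoint[OF S(1) perm, of ?O]) auto
  ultimately have "orbit_type S (prodl ds) = add_mset m (image_mset card (mset_set (orbits (prodl ds) (S - ?O))))"
    using S(1) a(2) by (simp add: orbit_type_def finite_orbits)
  then have "\<alpha> = image_mset card (mset_set (orbits (prodl ds) (S - ?O)))" using S(3) by simp
  then show ?thesis using that S a by blast
qed

lemma image_mset_orbits_Un:
  assumes "finite S" "\<sigma> permutes S" "\<And>x. x \<in> Z \<Longrightarrow> orbit \<sigma> x \<subseteq> Z" "P \<subseteq> Pow Z - {{}}" "finite P"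
  shows "image_mset card (mset_set (orbits \<sigma> (S - Z) \<union> P))
    = image_mset card (mset_set (orbits \<sigma> (S - Z))) + image_mset card (mset_set P)"
  using orbits_Diff_disjoint[OF assms(1-4)] assms(1,5)
  by (simp add: mset_set_Union finite_orbits)

lemma realizable_cut:
  assumes "realizable (add_mset (i + j + k) \<alpha>)" "0 < i" "0 < j" "0 < k"
  shows "realizable (add_mset i (add_mset j (add_mset k \<alpha>)))"
proof -
  obtain S :: "nat set" and ds a where S: "finite S" "ds \<in> planar S" "a \<in> S" "card (orbit (prodl ds) a) = i + j + k"
    "\<alpha> = image_mset card (mset_set (orbits (prodl ds) (S - orbit (prodl ds) a)))"
    by (rule realizable_add_msetE[OF assms(1)])
  note perm = planarD(3)[OF S(2)]
  let ?O = "orbit (prodl ds) a"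
  let ?b = "(prodl ds ^^ (i + j)) a" and ?c = "(prodl ds ^^ i) a"
  obtain X Y Z where new: "orbits (cyc3 a ?b ?c \<circ> prodl ds) S = orbits (prodl ds) (S - ?O) \<union> {X, Y, Z}"
    and XYZ: "card X = i" "card Y = j" "card Z = k" "X \<union> Y \<union> Z = ?O" "X \<inter> Y = {}" "X \<inter> Z = {}" "Y \<inter> Z = {}"
    and dist: "distinct [a, ?b, ?c]" "?b \<in> ?O" "?c \<in> ?O"
    by (rule orbits_cut_three[OF S(1) perm S(3) assms(2-4) S(4)[symmetric] refl refl]) blast
  have sub: "{a, ?b, ?c} \<subseteq> S" using S(3) dist orbit_subset_of_permutes[OF perm S(3)] by auto
  have "cut (prodl ds) a ?b ?c" unfolding cut_def using assms S(4) by metis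
  then have pl: "cyc3 a ?b ?c # ds \<in> planar S" using planar_cut(2)[OF S(1) dist(1) sub S(2)] by blast
  have ne: "X \<noteq> {}" "Y \<noteq> {}" "Z \<noteq> {}" using XYZ assms by auto
  then have neq: "X \<noteq> Y" "X \<noteq> Z" "Y \<noteq> Z" using XYZ(5-7) by auto
  have "{X, Y, Z} \<subseteq> Pow ?O - {{}}" using ne XYZ(4) by auto
  then have "orbit_type S (prodl (cyc3 a ?b ?c # ds)) = \<alpha> + image_mset card (mset_set {X, Y, Z})"
    unfolding orbit_type_def prodl_Cons_comp new S(5)
    using orbit_closed[OF S(1) perm] by (intro image_mset_orbits_Un[OF S(1) perm]) auto
  then have "orbit_type S (prodl (cyc3 a ?b ?c # ds)) = add_mset i (add_mset j (add_mset k \<alpha>))"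
    using neq XYZ(1-3) by simp
  then show ?thesis unfolding realizable_def using S(1) pl by blast
qed

lemma orbit_insert_fixed:
  assumes "finite S" "\<sigma> permutes S" "y \<notin> S"
  shows "orbit \<sigma> y = {y}"
  using permutes_not_in[OF assms(2,3)] by (simp add: orbit_eq_singleton_iff)

text \<open>The second class is a new fixed point. The cycle of length \<open>i + j\<close> is cut
  into \<open>i\<close> and \<open>j\<close>, and the piece of length \<open>j\<close> takes up the
  new point.\<close>

lemma realizable_cut_join:
  assumes "realizable (add_mset (i + j) \<alpha>)" "0 < i" "0 < j"
  shows "realizable (add_mset i (add_mset (j + 1) \<alpha>))"
proof -
  obtain S :: "nat set" and ds a where S: "finite S" "ds \<in> planar S" "a \<in> S" "card (orbit (prodl ds) a) = i + j"
    "\<alpha> = image_mset card (mset_set (orbits (prodl ds) (S - orbit (prodl ds) a)))"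
    by (rule realizable_add_msetE[OF assms(1)])
  obtain y where y: "y \<notin> S" using S(1) ex_new_if_finite infinite_UNIV_nat by blast
  define T where "T = insert y S"
  have T: "finite T" "a \<in> T" "y \<in> T" "S \<subseteq> T" "T - S = {y}" using S y by (auto simp: T_def)
  let ?\<sigma> = "prodl ds"
  note permS = planarD(3)[OF S(2)]
  have perm: "?\<sigma> permutes T" by (rule permutes_subset[OF permS T(4)])
  let ?O = "orbit ?\<sigma> a" and ?b = "(?\<sigma> ^^ j) a"
  have j: "j < card ?O" using S(4) assms(2) by simp
  have oy: "orbit ?\<sigma> y = {y}" by (rule orbit_insert_fixed[OF S(1) permS y])
  have OS: "?O \<subseteq> S" by (rule orbit_subset_of_permutes[OF permS S(3)])
  then have ne: "orbit ?\<sigma> y \<noteq> ?O" using oy y by auto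
  obtain X Y where new: "orbits (cyc3 a ?b y \<circ> ?\<sigma>) T = orbits ?\<sigma> (T - (?O \<union> orbit ?\<sigma> y)) \<union> {X, Y}"
    and XY: "card X = card ?O - j" "card Y = j + card (orbit ?\<sigma> y)" "X \<union> Y = ?O \<union> orbit ?\<sigma> y" "X \<inter> Y = {}"
    by (rule orbits_cut_join[OF T(1) perm T(2) assms(3) j refl T(3) ne]) blast
  have b: "?b \<in> ?O" by (rule funpow_in[OF S(1) permS])
  have "?b \<noteq> a" using funpow_eq_iff[OF S(1) permS, of j a 0] j assms(3) by simp
  then have dist: "distinct [a, ?b, y]" using S(3) b OS y by auto
  have sub: "{a, ?b, y} \<subseteq> T" using S(3) b OS T by auto
  have "split2 is_planar T a ?b y ds" unfolding split2_def
  proof (intro exI conjI)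
    show "S \<subseteq> T" "ds \<in> planar S" "a \<in> S" by (fact T S)+
    show "?b \<in> S" using b OS by blast
    show "y \<in> T - S" unfolding T(5) by simp
    show "[] \<in> planar (T - S)" unfolding T(5) by (rule planar_singleton)
    show "ds \<in> shuffles ds []" by simp
  qed
  then have pl: "cyc3 a ?b y # ds \<in> planar T" using b by (rule planar_split2(2)[OF T(1) dist sub])
  have neXY: "X \<noteq> {}" "Y \<noteq> {}" using XY j assms by auto
  have TS: "T - (?O \<union> orbit ?\<sigma> y) = S - ?O" using oy y by (auto simp: T_def)
  have "{X, Y} \<subseteq> Pow (?O \<union> orbit ?\<sigma> y) - {{}}" using neXY XY(3) by auto
  then have "orbit_type T (prodl (cyc3 a ?b y # ds))
      = image_mset card (mset_set (orbits ?\<sigma> (T - (?O \<union> orbit ?\<sigma> y)))) + image_mset card (mset_set {X, Y})"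
    unfolding orbit_type_def prodl_Cons_comp new
    using orbit_closed[OF T(1) perm] by (intro image_mset_orbits_Un[OF T(1) perm]) blast+
  moreover have "X \<noteq> Y" using XY(4) neXY by auto
  ultimately have "orbit_type T (prodl (cyc3 a ?b y # ds)) = add_mset i (add_mset (j + 1) \<alpha>)"
    using XY(1,2) S(4,5) oy unfolding TS by simp
  then show ?thesis unfolding realizable_def using T(1) pl by blast
qed

text \<open>Two new fixed points, each a class of its own, are joined to the given cycle.\<close>

lemma realizable_join:
  assumes "realizable (add_mset m \<alpha>)"
  shows "realizable (add_mset (m + 2) \<alpha>)"
proof -
  obtain S :: "nat set" and ds a where S: "finite S" "ds \<in> planar S" "a \<in> S" "card (orbit (prodl ds) a) = m"
    "\<alpha> = image_mset card (mset_set (orbits (prodl ds) (S - orbit (prodl ds) a)))"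
    by (rule realizable_add_msetE[OF assms(1)])
  obtain x where x: "x \<notin> S" using S(1) ex_new_if_finite infinite_UNIV_nat by blast
  obtain y where y: "y \<notin> insert x S" using S(1) ex_new_if_finite[of "insert x S"] infinite_UNIV_nat by blast
  define T where "T = insert y (insert x S)"
  have T: "finite T" "a \<in> T" "x \<in> T" "y \<in> T" "S \<subseteq> T" "T - S = {x, y}" "T - S - {x} = {y}"
    using S x y by (auto simp: T_def)
  let ?\<sigma> = "prodl ds"
  note permS = planarD(3)[OF S(2)]
  have perm: "?\<sigma> permutes T" by (rule permutes_subset[OF permS T(5)])
  let ?O = "orbit ?\<sigma> a"
  have ox: "orbit ?\<sigma> x = {x}" and oy: "orbit ?\<sigma> y = {y}"
    using orbit_insert_fixed[OF S(1) permS] x y by auto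
  have OS: "?O \<subseteq> S" by (rule orbit_subset_of_permutes[OF permS S(3)])
  have finO: "finite ?O" using OS S(1) finite_subset by blast
  have ne: "?O \<noteq> orbit ?\<sigma> x" "?O \<noteq> orbit ?\<sigma> y" "orbit ?\<sigma> x \<noteq> orbit ?\<sigma> y"
    using OS ox oy x y by auto
  let ?Z = "?O \<union> orbit ?\<sigma> x \<union> orbit ?\<sigma> y"
  have new: "orbits (cyc3 a x y \<circ> ?\<sigma>) T = orbits ?\<sigma> (T - ?Z) \<union> {?Z}"
    by (rule orbits_join_three[OF T(1) perm T(2-4) ne])
  have dist: "distinct [a, x, y]" and sub: "{a, x, y} \<subseteq> T" using S(3) x y T by auto
  have "split3 is_planar T a x y ds" unfolding split3_def
  proof (intro exI conjI)
    show "S \<subseteq> T" "ds \<in> planar S" "a \<in> S" by (fact T S)+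
    show "{x} \<subseteq> T - S" "x \<in> {x}" "y \<in> T - S - {x}" using x y unfolding T_def by auto
    show "[] \<in> planar {x}" "[] \<in> planar (T - S - {x})" unfolding T(7) by (rule planar_singleton)+
    show "ds \<in> shuffles3 ds [] []" by (simp add: shuffles3_def)
  qed
  then have pl: "cyc3 a x y # ds \<in> planar T" by (rule planar_split3(2)[OF T(1) dist sub])
  have TS: "T - ?Z = S - ?O" using ox oy x y by (auto simp: T_def)
  have "orbit_type T (prodl (cyc3 a x y # ds))
      = image_mset card (mset_set (orbits ?\<sigma> (T - ?Z))) + image_mset card (mset_set {?Z})"
    unfolding orbit_type_def prodl_Cons_comp new
    using orbit_closed[OF T(1) perm] orbit_nonempty[of ?\<sigma> a] by (intro image_mset_orbits_Un[OF T(1) perm]) auto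
  moreover have "card ?Z = m + 2" unfolding ox oy using OS x y S(4) finO by (auto simp: card_insert_if)
  ultimately have "orbit_type T (prodl (cyc3 a x y # ds)) = add_mset (m + 2) \<alpha>"
    using S(5) unfolding TS by simp
  then show ?thesis unfolding realizable_def using T(1) pl by blast
qed

lemma realizable_one: "realizable {#1#}"
  unfolding realizable_def
proof (intro exI conjI)
  have "orbit id (0 :: nat) = {0}" by (simp add: orbit_eq_singleton_iff)
  then show "orbit_type {0 :: nat} (prodl []) = {#1#}" by (simp add: orbit_type_def orbits_def)
qed (simp_all add: planar_singleton)

lemma realizable_odd: "odd m \<Longrightarrow> realizable {#m#}"
proof (induction m rule: less_induct)
  case (less m)
  show ?case
  proof (cases "m = 1")
    case False
    then have m: "m = m - 2 + 2" "odd (m - 2)" "m - 2 < m" using less.prems by presburger+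
    then show ?thesis using realizable_join[of "m - 2" "{#}"] less.IH by simp
  qed (use realizable_one in simp)
qed

text \<open>
  The exclusion of \<open>n = 2\<close> is necessary: the type \<open>{#1, 1#}\<close> is even, but there
  are no 3-cycles on two points.
\<close>

lemma realizable_even:
  assumes "0 \<notin># \<alpha>" "\<alpha> \<noteq> {#}" "even (sum_mset \<alpha> + size \<alpha>)" "sum_mset \<alpha> \<noteq> 2"
  shows "realizable \<alpha>"
  using assms
proof (induction "sum_mset \<alpha>" arbitrary: \<alpha> rule: less_induct)
  case less
  \<comment> \<open>Undoes \<open>realizable_cut_join\<close>: the parts \<open>a\<close>,
    \<open>b\<close> come from the single part \<open>b + (a - 1)\<close>, cut into \<open>b\<close>
    and \<open>a - 1\<close>, the latter extended by a new point. The total drops by 1 and the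
    parity is kept.\<close>
  have big: "realizable (add_mset a (add_mset b \<beta>))"
    if "2 \<le> a" and eq: "sum_mset (add_mset a (add_mset b \<beta>)) = sum_mset \<alpha>"
      "0 \<notin># add_mset a (add_mset b \<beta>)" "even (sum_mset (add_mset a (add_mset b \<beta>)) + size (add_mset a (add_mset b \<beta>)))"
    for a b \<beta>
  proof -
    have b: "0 < b" using eq(2) by auto
    let ?\<gamma> = "add_mset (b + (a - 1)) \<beta>"
    have sum: "sum_mset ?\<gamma> + 1 = sum_mset \<alpha>" using eq(1) that(1) by simp
    \<comment> \<open>The excluded total 2 could only arise from the parts 2 and 1 alone, and that
      type is odd.\<close>
    have "sum_mset ?\<gamma> \<noteq> 2"
    proof
      assume "sum_mset ?\<gamma> = 2"
      then have 1: "b + (a - 1) + sum_mset \<beta> = 2" by simp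
      then have "a = 2" "b = 1" "sum_mset \<beta> = 0" using b that(1) by linarith+
      moreover have "\<beta> = {#}" using \<open>sum_mset \<beta> = 0\<close> eq(2) by (cases \<beta>) auto
      ultimately show False using eq(3) by simp
    qed
    moreover have "even (sum_mset ?\<gamma> + size ?\<gamma>)"
    proof -
      have "sum_mset (add_mset a (add_mset b \<beta>)) + size (add_mset a (add_mset b \<beta>))
          = (sum_mset ?\<gamma> + size ?\<gamma>) + 2" using that(1) by simp
      then show ?thesis using eq(3) by (metis even_add even_numeral)
    qed
    moreover have "sum_mset ?\<gamma> < sum_mset \<alpha>" using sum by linarith
    moreover have "0 \<notin># ?\<gamma>" using eq(2) b by auto
    ultimately have "realizable ?\<gamma>" by (intro less.hyps) auto
    from realizable_cut_join[OF this b] show ?thesis using that(1) by (simp add: add_mset_commute)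
  qed
  show ?case
  proof (cases "\<exists>a. a \<in># \<alpha> \<and> 2 \<le> a")
    case True
    then obtain a \<alpha>' where a: "\<alpha> = add_mset a \<alpha>'" "2 \<le> a" by (meson mset_add)
    show ?thesis
    proof (cases \<alpha>')
      case empty
      then show ?thesis using a less.prems(3) realizable_odd[of a] by simp
    next
      case (add b \<beta>)
      then show ?thesis using big[OF a(2), of b \<beta>] a(1) less.prems by simp
    qed
  next
    case False
    have "x = 1" if "x \<in># \<alpha>" for x
    proof -
      have "x \<noteq> 0" using that less.prems(1) by metis
      moreover have "\<not> 2 \<le> x" using that False by blast
      ultimately show ?thesis by simp
    qed
    then have rep: "\<alpha> = replicate_mset (size \<alpha>) 1"
      by (metis in_replicate_mset set_mset_subset_singletonD set_mset_replicate_mset_subset subsetI singleton_iff)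
    define n where "n = size \<alpha>"
    have \<alpha>: "\<alpha> = replicate_mset n 1" using rep by (simp add: n_def)
    have "n \<noteq> 0" "n \<noteq> 2" using less.prems(2,4) by (auto simp: \<alpha>)
    show ?thesis
    proof (cases "n = 1")
      case True
      then show ?thesis using realizable_one by (simp add: \<alpha>)
    next
      case False
      then obtain r where r: "n = Suc (Suc (Suc r))"
        using \<open>n \<noteq> 0\<close> \<open>n \<noteq> 2\<close> by (metis One_nat_def Suc_1 not0_implies_Suc)
      \<comment> \<open>A type of ones results from cutting a part 3 into three ones. The type with
        the 3 has the same total, so induction does not reach it directly, but \<open>big\<close>
        does; without further parts it is a single odd cycle.\<close>
      have "realizable (add_mset 3 (replicate_mset r 1))"
      proof (cases r)
        case 0
        then show ?thesis using realizable_odd[of 3] by simp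
      next
        case (Suc s)
        then show ?thesis using big[of 3 1 "replicate_mset s 1"] by (simp add: \<alpha> r)
      qed
      then have "realizable (add_mset (1 + 1 + 1) (replicate_mset r 1))" by (simp add: numeral_3_eq_3)
      from realizable_cut[OF this] show ?thesis by (simp add: \<alpha> r)
    qed
  qed
qed

lemma orbit_type_relabel:
  assumes "bij g"
  shows "orbit_type (g ` S) (relabel g \<sigma>) = orbit_type S \<sigma>"
proof -
  have "mset_set ((`) g ` orbits \<sigma> S) = image_mset ((`) g) (mset_set (orbits \<sigma> S))"
    by (rule image_mset_mset_set[OF inj_on_image_g[OF assms], symmetric])
  then show ?thesis unfolding orbit_type_def orbits_relabel[OF assms]
    by (simp add: image_mset.compositionality comp_def card_relabel[OF assms])
qed

lemma realizableD:
  assumes "realizable \<alpha>"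
  obtains ds where "ds \<in> planar {1..sum_mset \<alpha>}" "orbit_type {1..sum_mset \<alpha>} (prodl ds) = \<alpha>"
proof -
  obtain S :: "nat set" and ds where S: "finite S" "ds \<in> planar S" "orbit_type S (prodl ds) = \<alpha>"
    using assms unfolding realizable_def by blast
  have "card S = card {1..sum_mset \<alpha>}" using sum_orbit_type(1)[OF S(1) planarD(3)[OF S(2)]] S(3) by simp
  then obtain g :: "nat \<Rightarrow> nat" where g: "bij g" "g ` S = {1..sum_mset \<alpha>}"
    using finite_card_eq_bij[OF S(1), of "{1..sum_mset \<alpha>}"] by blast
  show ?thesis
    using that[of "map (relabel g) ds"] planar_relabel[OF g(1) S(2)] orbit_type_relabel[OF g(1), of S "prodl ds"]
    unfolding prodl_relabel[OF g(1)] g(2) S(3) by blast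
qed


section \<open>Transitive factorizations\<close>

lemma three_cycles_eq_tri: "three_cycles n = tri {1..n}"
proof (intro equalityI subsetI)
  fix d assume "d \<in> three_cycles n"
  then obtain cs where cs: "d = cycle_of_list cs" "distinct cs" "length cs = 3" "set cs \<subseteq> {1..n}" by auto
  obtain a b c where "cs = [a, b, c]"
    using cs(3) by (auto simp: numeral_3_eq_3 length_Suc_conv)
  then show "d \<in> tri {1..n}" using cs unfolding tri_def by (auto simp: cyc3_def)
next
  fix d assume "d \<in> tri {1..n}"
  then obtain a b c where d: "d = cyc3 a b c" "distinct [a, b, c]" "a \<in> {1..n}" "b \<in> {1..n}" "c \<in> {1..n}"
    by (rule triE)
  have "d = cycle_of_list [a, b, c] \<and> distinct [a, b, c] \<and> length [a, b, c] = 3 \<and> set [a, b, c] \<subseteq> {1..n}"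
    using d by (auto simp: cyc3_def)
  then show "d \<in> three_cycles n" by blast
qed

text \<open>In one direction, an invariant set is preserved by the factors and their inverses, hence
  by the group; in the other, the orbit of a point under the group is an invariant set.\<close>

lemma transitive_iff_conn:
  assumes ds: "set ds \<subseteq> tri {1..n}" and n: "1 \<le> n"
  shows "(\<forall>x\<in>{1..n}. \<forall>y\<in>{1..n}. \<exists>g\<in>generate (sym_group n) (set ds). g x = y) \<longleftrightarrow> conn {1..n} ds"
proof
  assume trans: "\<forall>x\<in>{1..n}. \<forall>y\<in>{1..n}. \<exists>g\<in>generate (sym_group n) (set ds). g x = y"
  show "conn {1..n} ds" unfolding conn_def
  proof (intro conjI allI impI ds)
    show "{1..n} \<noteq> {}" using n by simp
    fix A assume A: "A \<subseteq> {1..n}" "A \<noteq> {}" "invariant ds A"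
    have bij: "bij h" if "h \<in> set ds" for h using that ds tri_permutes permutes_bij by blast
    have closed: "g x \<in> A" if "g \<in> generate (sym_group n) (set ds)" "x \<in> A" for g x
      using that
    proof (induction g arbitrary: x rule: generate.induct)
      case one
      then show ?case by (simp add: sym_group_one)
    next
      case (incl h)
      show ?case
      proof (cases "h x = x")
        case False
        \<comment> \<open>If \<open>h\<close> moves \<open>x\<close>, then \<open>h x\<close> lies
          in its support as well, and the support is contained in \<open>A\<close> because
          \<open>x\<close> is in both.\<close>
        then have "h (h x) \<noteq> h x" using bij_is_inj[OF bij[OF incl(1)]] by (simp add: inj_eq)
        then show ?thesis using False A(3) incl unfolding invariant_def supp_def by blast
      qed (use incl in simp)
    next
      case (inv h)
      \<comment> \<open>The inverse in \<open>generate\<close> is that of the group; membership in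
        the carrier identifies it with the inverse function.\<close>
      have h: "h \<in> carrier (sym_group n)"
        using inv(1) ds tri_permutes unfolding sym_group_carrier by blast
      have hx: "h (inv' h x) = x" using bij_is_surj[OF bij[OF inv(1)]] by (rule surj_f_inv_f)
      have "inv' h x \<in> A"
      proof (cases "inv' h x = x")
        case False
        then have "h x \<noteq> x" using hx bij_is_inj[OF bij[OF inv(1)]] by (metis inj_eq)
        then have "x \<in> supp h" "inv' h x \<in> supp h" using False hx by (auto simp: supp_def)
        moreover have "supp h \<subseteq> A \<or> supp h \<inter> A = {}" using A(3) inv(1) by (simp add: invariant_def)
        ultimately show ?thesis using inv(2) by blast
      qed (use inv in simp)
      then show ?case using h by simp
    next
      case (eng h1 h2)
      then show ?case by (simp add: sym_group_mult)
    qed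
    obtain x where x: "x \<in> A" using A(2) by blast
    have "y \<in> A" if y: "y \<in> {1..n}" for y
    proof -
      have "x \<in> {1..n}" using x A(1) by blast
      then obtain g where "g \<in> generate (sym_group n) (set ds)" "g x = y" using trans y by blast
      then show ?thesis using closed[of g x] x by simp
    qed
    then show "A = {1..n}" using A(1) by blast
  qed
next
  assume conn: "conn {1..n} ds"
  show "\<forall>x\<in>{1..n}. \<forall>y\<in>{1..n}. \<exists>g\<in>generate (sym_group n) (set ds). g x = y"
  proof (intro ballI)
    fix x y assume x: "x \<in> {1..n}" and y: "y \<in> {1..n}"
    let ?G = "generate (sym_group n) (set ds)"
    have sub: "set ds \<subseteq> carrier (sym_group n)"
    proof
      fix d assume "d \<in> set ds"
      then have "d permutes {1..n}" using ds tri_permutes by blast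
      then show "d \<in> carrier (sym_group n)" by (simp add: sym_group_carrier)
    qed
    have perm: "g permutes {1..n}" if "g \<in> ?G" for g
      using group.generate_in_carrier[OF sym_group_is_group sub that] by (simp add: sym_group_carrier)
    define A where "A = {g x | g. g \<in> ?G}"
    have step: "d z \<in> A" if "d \<in> set ds" "z \<in> A" for d z
    proof -
      obtain g where g: "g \<in> ?G" "z = g x" using \<open>z \<in> A\<close> unfolding A_def by blast
      have "d \<circ> g \<in> ?G" using generate.eng[OF generate.incl[OF \<open>d \<in> set ds\<close>] g(1)] by (simp add: sym_group_mult)
      then have "\<exists>h. d (g x) = h x \<and> h \<in> ?G" by (intro exI[of _ "d \<circ> g"]) simp
      then show ?thesis unfolding A_def g(2) by simp
    qed
    have "A = {1..n}"
    proof (rule connD[OF conn])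
      have "g x \<in> {1..n}" if "g \<in> ?G" for g using permutes_in_image[OF perm[OF that]] x by blast
      then show "A \<subseteq> {1..n}" unfolding A_def by blast
      have "id \<in> ?G" using generate.one[of "sym_group n" "set ds"] by (simp add: sym_group_one)
      then have "\<exists>h. x = h x \<and> h \<in> ?G" by (intro exI[of _ id]) simp
      then have "x \<in> A" unfolding A_def by simp
      then show "A \<noteq> {}" by blast
      show "invariant ds A" unfolding invariant_def
      proof
        fix d assume d: "d \<in> set ds"
        then obtain a b c where abc: "d = cyc3 a b c" "distinct [a, b, c]" using ds by (meson subsetD triE)
        note im = cyc3_simps[OF abc(2), folded abc(1)]
        \<comment> \<open>Closure under \<open>d\<close> suffices, since a 3-cycle leads from each
          point of its support to the other two.\<close>
        have "a \<in> A \<Longrightarrow> b \<in> A" "b \<in> A \<Longrightarrow> c \<in> A" "c \<in> A \<Longrightarrow> a \<in> A"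
          using step[OF d, of a] step[OF d, of b] step[OF d, of c] unfolding im by blast+
        then show "supp d \<subseteq> A \<or> supp d \<inter> A = {}" unfolding abc(1) supp_cyc3[OF abc(2)] by blast
      qed
    qed
    then have "y \<in> A" using y by simp
    then show "\<exists>g\<in>?G. g x = y" unfolding A_def by blast
  qed
qed

text \<open>There is no 3-cycle on two points, and the empty list is connected only on one point. So
  the total excluded in \<open>realizable_even\<close> never occurs.\<close>

lemma conn_card_neq_2:
  assumes "conn S ds" "finite S"
  shows "card S \<noteq> 2"
proof
  assume card: "card S = 2"
  have "ds = []"
  proof (rule ccontr)
    assume "ds \<noteq> []"
    then obtain d where "d \<in> tri S" using conn_tri[OF assms(1)] by (cases ds) auto
    then obtain a b c where abc: "distinct [a, b, c]" "a \<in> S" "b \<in> S" "c \<in> S" by (rule triE)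
    then have "card {a, b, c} \<le> card S" using assms(2) by (intro card_mono) auto
    then show False using card abc(1) by simp
  qed
  obtain x where "x \<in> S" using conn_nonempty[OF assms(1)] by blast
  then have "{x} = S" using \<open>ds = []\<close> by (intro connD[OF assms(1)]) (auto simp: invariant_def)
  then show False using card by auto
qed

text \<open>
  A shortest factorization might have positive genus; it does not, because a type that occurs at
  all is even and therefore also has a planar factorization.
\<close>

lemma h3_eq_card_planar:
  assumes \<alpha>: "\<alpha> \<in> partitions_of n" and n: "1 \<le> n"
  shows "h3 \<alpha> = card {ds \<in> planar {1..n}. orbit_type {1..n} (prodl ds) = \<alpha>}"
proof -
  let ?S = "{1..n}"
  let ?Q = "{ds \<in> planar ?S. orbit_type ?S (prodl ds) = \<alpha>}"
  have sum: "sum_mset \<alpha> = n" and zero: "0 \<notin># \<alpha>" using \<alpha> by (auto simp: partitions_of_def)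
  have TF: "(ds, \<sigma>) \<in> transitive_factorizations \<alpha> \<longleftrightarrow> conn ?S ds \<and> \<sigma> = prodl ds \<and> orbit_type ?S (prodl ds) = \<alpha>"
    for ds \<sigma>
  proof -
    have ct: "cycle_type n \<tau> = orbit_type ?S \<tau>" for \<tau> by (simp add: cycle_type_def orbit_type_def orbits_def)
    have "(ds, \<sigma>) \<in> transitive_factorizations \<alpha> \<longleftrightarrow> set ds \<subseteq> tri ?S \<and> \<sigma> permutes ?S \<and> orbit_type ?S \<sigma> = \<alpha>
      \<and> prodl ds = \<sigma> \<and> (\<forall>x\<in>?S. \<forall>y\<in>?S. \<exists>g\<in>generate (sym_group n) (set ds). g x = y)"
      unfolding transitive_factorizations_def Let_def sum three_cycles_eq_tri ct by simp
    then show ?thesis using transitive_iff_conn[OF _ n, of ds] conn_tri[of ?S ds] conn_prodl_permutes[of ?S ds] by blast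
  qed
  have size: "card (orbits (prodl ds) ?S) = size \<alpha>" if "conn ?S ds" "orbit_type ?S (prodl ds) = \<alpha>" for ds
    using sum_orbit_type(2)[OF _ conn_prodl_permutes[OF that(1)]] that(2) by simp
  have bound: "n + size \<alpha> \<le> 2 * length ds + 2" "even (n + size \<alpha>)" if "conn ?S ds" "orbit_type ?S (prodl ds) = \<alpha>" for ds
    using conn_bound[OF _ that(1)] size[OF that] by simp_all
  have pl: "ds \<in> ?Q \<longleftrightarrow> conn ?S ds \<and> orbit_type ?S (prodl ds) = \<alpha> \<and> 2 * length ds + 2 = n + size \<alpha>" for ds
    using size[of ds] by (auto simp: planar_iff)
  have "{(ds, \<sigma>) \<in> transitive_factorizations \<alpha>. \<forall>(ds', \<sigma>') \<in> transitive_factorizations \<alpha>. length ds \<le> length ds'}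
      = (\<lambda>ds. (ds, prodl ds)) ` ?Q" (is "?M = _")
  proof (intro equalityI subsetI)
    fix y assume "y \<in> ?M"
    moreover obtain ds \<sigma> where y': "y = (ds, \<sigma>)" by (cases y)
    ultimately have *: "(ds, \<sigma>) \<in> transitive_factorizations \<alpha>"
      "\<forall>(ds', \<sigma>') \<in> transitive_factorizations \<alpha>. length ds \<le> length ds'" by simp_all
    have min: "length ds \<le> length ds'" if "(ds', \<sigma>') \<in> transitive_factorizations \<alpha>" for ds' \<sigma>'
      using bspec[OF *(2) that] by simp
    have y: "y = (ds, prodl ds)" "conn ?S ds" "orbit_type ?S (prodl ds) = \<alpha>"
      using *(1) unfolding TF y' by simp_all
    have "n \<noteq> 2" using conn_card_neq_2[OF y(2)] by simp
    moreover have "\<alpha> \<noteq> {#}" using sum n by auto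
    ultimately have "realizable \<alpha>" using bound(2)[OF y(2,3)] sum zero by (intro realizable_even) auto
    then obtain es where es: "es \<in> ?Q" using realizableD[of \<alpha>] unfolding sum by blast
    then have "(es, prodl es) \<in> transitive_factorizations \<alpha>" using TF pl by simp
    then have "length ds \<le> length es" by (rule min)
    \<comment> \<open>The planar list \<open>es\<close> attains the lower bound for this type;
      \<open>ds\<close>, being no longer, attains it as well.\<close>
    then have "ds \<in> ?Q" using es bound(1)[OF y(2,3)] y(2,3) unfolding pl by linarith
    then show "y \<in> (\<lambda>ds. (ds, prodl ds)) ` ?Q" using y(1) by blast
  next
    fix y assume "y \<in> (\<lambda>ds. (ds, prodl ds)) ` ?Q"
    then obtain ds where y: "y = (ds, prodl ds)" and ds: "ds \<in> ?Q" by blast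
    have "length ds \<le> length ds'" if "(ds', \<sigma>') \<in> transitive_factorizations \<alpha>" for ds' \<sigma>'
      using bound(1)[of ds'] that ds unfolding TF pl by linarith
    then show "y \<in> ?M" using ds TF unfolding y pl by blast
  qed
  then have "h3 \<alpha> = card ((\<lambda>ds. (ds, prodl ds)) ` ?Q)" by (simp add: h3_def)
  also have "\<dots> = card ?Q" by (rule card_image) (auto intro: inj_onI)
  finally show ?thesis .
qed

section \<open>The coefficients of \<open>F3\<close> as sums over planar lists\<close>

lemma prod_mset_orbit_type: "(\<Prod>i\<in>#orbit_type S \<sigma>. p_var i) = mon (orbits \<sigma> S)"
  unfolding orbit_type_def mon_def by (simp add: image_mset.compositionality comp_def prod_unfold_prod_mset)

lemma planar_empty: "planar {} = {}"
  by (auto simp: planar_iff conn_def)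

text \<open>All planar lists of one type have the same length and the same monomial. Grouping them
  by type leads from lists to partitions, and types without planar lists contribute 0 on both
  sides.\<close>

lemma F3_nth:
  "fps_nth F3 n = scalar (1 / fact n) * (\<Sum>ds\<in>planar {1..n}. wt ds * mon (orbits (prodl ds) {1..n}))"
proof (cases "n = 0")
  case True
  then show ?thesis by (simp add: F3_def planar_empty)
next
  case False
  let ?S = "{1..n}" and ?g = "\<lambda>ds. orbit_type {1..n} (prodl ds)"
  have "fps_nth F3 n = (\<Sum>\<alpha>\<in>partitions_of n. scalar (of_nat (h3 \<alpha>) * (1 / fact n) * (1 / fact (mu3 \<alpha>))) * (\<Prod>i\<in>#\<alpha>. p_var i))"
    using False by (simp add: F3_def)
  also have "\<dots> = (\<Sum>\<alpha>\<in>partitions_of n. \<Sum>ds | ds \<in> planar ?S \<and> ?g ds = \<alpha>. scalar (1 / fact n) * (wt ds * mon (orbits (prodl ds) ?S)))"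
  proof (rule sum.cong)
    fix \<alpha> assume \<alpha>: "\<alpha> \<in> partitions_of n"
    have "scalar (1 / fact n) * (wt ds * mon (orbits (prodl ds) ?S))
        = scalar ((1 / fact n) * (1 / fact (mu3 \<alpha>))) * (\<Prod>i\<in>#\<alpha>. p_var i)"
      if ds: "ds \<in> planar ?S" "?g ds = \<alpha>" for ds
    proof -
      have "card (orbits (prodl ds) ?S) = size \<alpha>" "sum_mset \<alpha> = n"
        using sum_orbit_type[OF _ planarD(3)[OF ds(1)]] ds(2) by auto
      moreover have "2 * length ds + 2 = n + card (orbits (prodl ds) ?S)" using ds(1) unfolding planar_iff by simp
      ultimately have "sum_mset \<alpha> + size \<alpha> - 2 = 2 * length ds" by linarith
      \<comment> \<open>Planarity makes the numerator of \<open>mu3\<close> an even number, so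
        \<open>div\<close> does not round.\<close>
      then have "length ds = mu3 \<alpha>" unfolding mu3_def by simp
      moreover have "(\<Prod>i\<in>#\<alpha>. p_var i) = mon (orbits (prodl ds) ?S)"
        using prod_mset_orbit_type[of ?S "prodl ds"] unfolding ds(2) .
      ultimately show ?thesis by (simp only: wt_def scalar_mult[symmetric] mult.assoc)
    qed
    then have "(\<Sum>ds | ds \<in> planar ?S \<and> ?g ds = \<alpha>. scalar (1 / fact n) * (wt ds * mon (orbits (prodl ds) ?S)))
        = of_nat (h3 \<alpha>) * (scalar ((1 / fact n) * (1 / fact (mu3 \<alpha>))) * (\<Prod>i\<in>#\<alpha>. p_var i))"
      using h3_eq_card_planar[OF \<alpha>] False by simp
    then show "scalar (of_nat (h3 \<alpha>) * (1 / fact n) * (1 / fact (mu3 \<alpha>))) * (\<Prod>i\<in>#\<alpha>. p_var i)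
        = (\<Sum>ds | ds \<in> planar ?S \<and> ?g ds = \<alpha>. scalar (1 / fact n) * (wt ds * mon (orbits (prodl ds) ?S)))"
      by (simp add: of_nat_mult_scalar mult.assoc[symmetric])
  qed simp
  also have "\<dots> = (\<Sum>ds\<in>planar ?S. scalar (1 / fact n) * (wt ds * mon (orbits (prodl ds) ?S)))"
  proof (rule sum.group)
    show "?g ` planar ?S \<subseteq> partitions_of n"
      using sum_orbit_type[of ?S] planarD(3) by (fastforce simp: partitions_of_def simp del: foldr.simps)
  qed (simp_all add: finite_planar finite_partitions_of)
  finally show ?thesis by (simp add: sum_distrib_left)
qed


section \<open>Partial derivatives\<close>

lemma partial_ppoly_superset:
  assumes "finite A" "Poly_Mapping.keys f \<subseteq> A"
  shows "partial_ppoly i f = (\<Sum>m\<in>A. Poly_Mapping.single (m - Poly_Mapping.single i 1)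
     (of_nat (Poly_Mapping.lookup m i) * Poly_Mapping.lookup f m))"
  unfolding partial_ppoly_def
  by (rule sum.mono_neutral_left[OF assms]) (auto simp: in_keys_iff)

lemma partial_ppoly_add: "partial_ppoly i (f + g) = partial_ppoly i f + partial_ppoly i g"
proof -
  let ?A = "Poly_Mapping.keys f \<union> Poly_Mapping.keys g"
  have A: "finite ?A" "Poly_Mapping.keys f \<subseteq> ?A" "Poly_Mapping.keys g \<subseteq> ?A" "Poly_Mapping.keys (f + g) \<subseteq> ?A"
    using Poly_Mapping.keys_add[of f g] by auto
  show ?thesis
    unfolding partial_ppoly_superset[OF A(1,2)] partial_ppoly_superset[OF A(1,3)] partial_ppoly_superset[OF A(1,4)]
    by (simp add: lookup_add sum.distrib[symmetric] single_add[symmetric] distrib_left)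
qed

lemma partial_ppoly_0: "partial_ppoly i 0 = 0"
  by (simp add: partial_ppoly_def)

lemma partial_ppoly_sum: "partial_ppoly i (sum f A) = (\<Sum>x\<in>A. partial_ppoly i (f x))"
  by (induction A rule: infinite_finite_induct) (simp_all add: partial_ppoly_0 partial_ppoly_add)

lemma partial_ppoly_single:
  "partial_ppoly i (Poly_Mapping.single m c) = Poly_Mapping.single (m - Poly_Mapping.single i 1) (of_nat (Poly_Mapping.lookup m i) * c)"
  by (subst partial_ppoly_superset[of "{m}"]) auto

definition orbit_monomial :: "'a set set \<Rightarrow> nat \<Rightarrow>\<^sub>0 nat" where
  "orbit_monomial C = (\<Sum>X\<in>C. Poly_Mapping.single (card X) 1)"

lemma mon_eq_single: "mon C = Poly_Mapping.single (orbit_monomial C) 1"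
proof -
  have "(\<Prod>X\<in>C. p_var (card X)) = Poly_Mapping.single (\<Sum>X\<in>C. Poly_Mapping.single (card X) 1) 1"
    by (induction C rule: infinite_finite_induct) (simp_all add: p_var_def mult_single)
  then show ?thesis by (simp add: mon_def orbit_monomial_def)
qed

lemma lookup_orbit_monomial:
  "finite C \<Longrightarrow> Poly_Mapping.lookup (orbit_monomial C) i = card {X \<in> C. card X = i}"
  by (simp add: orbit_monomial_def lookup_sum lookup_single when_def sum.If_cases Int_def conj_commute)

lemma scalar_mult_single: "scalar c * Poly_Mapping.single m d = Poly_Mapping.single m (c * d)"
  by (simp add: scalar_def mult_single)

text \<open>A cycle of length \<open>i\<close> has \<open>i\<close> points, and marking any of them
  deletes the same variable. So the sum consists of equal terms, as many as \<open>i\<close> times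
  the exponent of \<open>p_var i\<close>.\<close>

lemma partial_scalar_mon:
  assumes "finite S" "\<sigma> permutes S"
  shows "of_nat i * partial_ppoly i (scalar c * mon (orbits \<sigma> S))
    = scalar c * (\<Sum>a | a \<in> S \<and> card (orbit \<sigma> a) = i. mon (orbits \<sigma> (S - orbit \<sigma> a)))"
proof -
  let ?C = "orbits \<sigma> S" and ?A = "{a. a \<in> S \<and> card (orbit \<sigma> a) = i}"
  let ?m = "orbit_monomial ?C - Poly_Mapping.single i 1"
  have "mon (orbits \<sigma> (S - orbit \<sigma> a)) = Poly_Mapping.single ?m 1" if a: "a \<in> ?A" for a
  proof -
    let ?O = "orbit \<sigma> a"
    have eq: "?C = orbits \<sigma> (S - ?O) \<union> {?O}"
      using orbits_Diff_Un[OF assms orbit_subset_of_permutes[OF assms(2)]] a unfolding orbits_orbit[OF assms] by simp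
    have "orbits \<sigma> (S - ?O) \<inter> {?O} = {}"
      using orbit_closed[OF assms] orbit_nonempty[of \<sigma> a] by (intro orbits_Diff_disjoint[OF assms, of ?O]) auto
    then have "orbit_monomial ?C = orbit_monomial (orbits \<sigma> (S - ?O)) + Poly_Mapping.single i 1"
      unfolding eq orbit_monomial_def using a assms(1) by (subst sum.union_disjoint) (auto simp: finite_orbits)
    then show ?thesis unfolding mon_eq_single by simp
  qed
  then have sum: "(\<Sum>a\<in>?A. mon (orbits \<sigma> (S - orbit \<sigma> a))) = of_nat (card ?A) * Poly_Mapping.single ?m 1"
    by simp
  have card: "card ?A = i * card {X \<in> ?C. card X = i}"
  proof -
    have "?A = \<Union>{X \<in> ?C. card X = i}"
    proof (intro equalityI subsetI)
      fix a assume "a \<in> ?A"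
      then show "a \<in> \<Union>{X \<in> ?C. card X = i}" using orbit_self[OF assms, of a] by (auto simp: orbits_def)
    next
      fix a assume "a \<in> \<Union>{X \<in> ?C. card X = i}"
      then obtain b where b: "b \<in> S" "a \<in> orbit \<sigma> b" "card (orbit \<sigma> b) = i" by (auto simp: orbits_def)
      then show "a \<in> ?A" using orbit_eq[OF assms b(2)] orbit_subset_of_permutes[OF assms(2) b(1)] by auto
    qed
    moreover have "card (\<Union>{X \<in> ?C. card X = i}) = (\<Sum>X\<in>{X \<in> ?C. card X = i}. card X)"
    proof (rule card_Union_disjoint)
      show "pairwise disjnt {X \<in> ?C. card X = i}"
        unfolding orbits_def pairwise_def disjnt_def using orbits_disjoint[OF assms] by auto
      show "\<And>X. X \<in> {X \<in> ?C. card X = i} \<Longrightarrow> finite X"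
        using finite_orbit_permutes[OF assms] by (auto simp: orbits_def)
    qed
    ultimately show ?thesis by simp
  qed
  have of_nat_single: "of_nat j * Poly_Mapping.single ?m d = Poly_Mapping.single ?m (of_nat j * d)" for j and d :: rat
    by (simp only: scalar_of_nat[symmetric] scalar_mult_single)
  have "of_nat i * partial_ppoly i (scalar c * mon ?C)
      = of_nat i * Poly_Mapping.single ?m (of_nat (card {X \<in> ?C. card X = i}) * c)"
    using assms(1) by (simp add: mon_eq_single scalar_mult_single partial_ppoly_single lookup_orbit_monomial finite_orbits)
  also have "\<dots> = Poly_Mapping.single ?m (c * (of_nat (card ?A) * 1))"
    unfolding of_nat_single card by (simp add: mult_ac)
  also have "\<dots> = scalar c * (of_nat (card ?A) * Poly_Mapping.single ?m 1)"
    unfolding of_nat_single scalar_mult_single ..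
  finally show ?thesis unfolding sum .
qed

lemma p_var_partial_scalar_mon:
  assumes "finite S"
  shows "p_var i * partial_ppoly i (scalar c * mon (orbits \<sigma> S))
    = of_nat (card {X \<in> orbits \<sigma> S. card X = i}) * (scalar c * mon (orbits \<sigma> S))"
proof -
  let ?m = "orbit_monomial (orbits \<sigma> S)"
  let ?k = "card {X \<in> orbits \<sigma> S. card X = i}"
  have k: "Poly_Mapping.lookup ?m i = ?k" using assms by (simp add: lookup_orbit_monomial finite_orbits)
  have eq: "p_var i * partial_ppoly i (scalar c * mon (orbits \<sigma> S))
      = Poly_Mapping.single (Poly_Mapping.single i 1 + (?m - Poly_Mapping.single i 1)) (of_nat ?k * c)"
    by (simp add: mon_eq_single scalar_mult_single partial_ppoly_single k p_var_def mult_single)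
  show ?thesis
  proof (cases "?k = 0")
    case True
    then show ?thesis unfolding eq by simp
  next
    case False
    \<comment> \<open>The exponent of \<open>p_var i\<close> is positive here, so the truncated
      subtraction is a genuine one.\<close>
    have "Poly_Mapping.single i 1 + (?m - Poly_Mapping.single i 1) = ?m"
    proof (rule poly_mapping_eqI)
      fix j
      show "Poly_Mapping.lookup (Poly_Mapping.single i 1 + (?m - Poly_Mapping.single i 1)) j = Poly_Mapping.lookup ?m j"
        using False k by (cases "i = j") (auto simp: lookup_add lookup_minus lookup_single)
    qed
    then show ?thesis unfolding eq by (simp add: mon_eq_single scalar_of_nat[symmetric] scalar_mult_single mult.assoc)
  qed
qed


section \<open>Exponential generating functions\<close>

text \<open>For every \<open>n\<close> only the indices in the finite set \<open>X n\<close>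
  contribute to the coefficient; it is constant as soon as a partial sum includes them all.\<close>

lemma has_sum_fpsI:
  fixes f :: "'i \<Rightarrow> 'a::comm_ring_1 fps"
  assumes fin: "\<And>n. finite (X n)" and sub: "\<And>n. X n \<subseteq> A"
    and zero: "\<And>n t. t \<in> A - X n \<Longrightarrow> fps_nth (f t) n = 0"
    and sum: "\<And>n. fps_nth g n = (\<Sum>t\<in>X n. fps_nth (f t) n)"
  shows "(f has_sum g) A"
  unfolding has_sum_def
proof (rule tendsto_fpsI)
  fix n
  show "\<forall>\<^sub>F Y in finite_subsets_at_top A. fps_nth (sum f Y) n = fps_nth g n"
    unfolding eventually_finite_subsets_at_top
  proof (intro exI conjI allI impI)
    show "finite (X n)" "X n \<subseteq> A" by (fact fin sub)+
    fix Y assume Y: "finite Y \<and> X n \<subseteq> Y \<and> Y \<subseteq> A"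
    then have "(\<Sum>t\<in>Y. fps_nth (f t) n) = (\<Sum>t\<in>X n. fps_nth (f t) n)"
      using zero by (intro sum.mono_neutral_right) auto
    then show "fps_nth (sum f Y) n = fps_nth g n" by (simp add: sum fps_sum_nth)
  qed
qed

definition egf :: "(nat \<Rightarrow> ppoly) \<Rightarrow> ppoly fps" where
  "egf f = Abs_fps (\<lambda>n. scalar (1 / fact n) * f n)"

lemma egf_nth: "fps_nth (egf f) n = scalar (1 / fact n) * f n"
  by (simp add: egf_def)

lemma sum_Pow_card:
  fixes F :: "nat \<Rightarrow> 'b::comm_semiring_1"
  assumes "finite S"
  shows "(\<Sum>A\<in>Pow S. F (card A)) = (\<Sum>m\<le>card S. of_nat (card S choose m) * F m)"
proof -
  have "(\<Sum>A\<in>Pow S. F (card A)) = (\<Sum>m\<le>card S. \<Sum>A | A \<in> Pow S \<and> card A = m. F (card A))"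
    by (rule sum.group[symmetric]) (use assms card_mono in auto)
  also have "\<dots> = (\<Sum>m\<le>card S. of_nat (card S choose m) * F m)"
    using assms by (intro sum.cong) (simp_all add: n_subsets)
  finally show ?thesis .
qed

text \<open>The binomial coefficient produced by the factorials counts the subsets of each size, so
  the product distributes the points over two sets.\<close>

lemma egf_mult: "egf f * egf g = egf (\<lambda>n. \<Sum>A\<in>Pow {1..n}. f (card A) * g (n - card A))"
proof (rule fps_ext)
  fix n :: nat
  have "scalar (1 / fact m) * f m * (scalar (1 / fact (n - m)) * g (n - m))
      = scalar (1 / fact n) * (of_nat (n choose m) * (f m * g (n - m)))" if "m \<le> n" for m
  proof -
    have "scalar (1 / fact m) * scalar (1 / fact (n - m)) = scalar (1 / fact n) * of_nat (n choose m)"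
      unfolding scalar_of_nat[symmetric] scalar_mult using that by (simp add: binomial_fact)
    then show ?thesis by (simp only: mult_ac)
  qed
  then have "(\<Sum>m\<le>n. scalar (1 / fact m) * f m * (scalar (1 / fact (n - m)) * g (n - m)))
      = (\<Sum>m\<le>n. scalar (1 / fact n) * (of_nat (n choose m) * (f m * g (n - m))))"
    by (intro sum.cong) auto
  also have "\<dots> = scalar (1 / fact n) * (\<Sum>A\<in>Pow {1..n}. f (card A) * g (n - card A))"
    using sum_Pow_card[of "{1..n}" "\<lambda>m. f m * g (n - m)"] by (simp add: sum_distrib_left)
  finally show "fps_nth (egf f * egf g) n = fps_nth (egf (\<lambda>n. \<Sum>A\<in>Pow {1..n}. f (card A) * g (n - card A))) n"
    unfolding fps_mult_nth egf_nth atLeast0AtMost .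
qed

section \<open>Series of lists with a marked cycle\<close>

abbreviation ptd_nat :: "nat \<Rightarrow> nat \<Rightarrow> ppoly" where
  "ptd_nat i n \<equiv> ptd {1..n} i"

lemma ptd_eq_ptd_nat: "finite (A :: nat set) \<Longrightarrow> ptd A i = ptd_nat i (card A)"
  by (rule ptd_card_eq) auto

lemma ptd_eq_0:
  assumes "finite S" "card S < i"
  shows "ptd S i = 0"
proof -
  have "{x. x \<in> pointed S \<and> cycle_len x = i} = {}"
    using cycle_len_bounds(2)[OF assms(1)] assms(2) by fastforce
  then show ?thesis by (simp only: ptd_def sum.empty)
qed

lemma partial_F3: "of_nat i * partial i F3 = egf (ptd_nat i)"
proof (rule fps_ext)
  fix n :: nat
  let ?S = "{1..n}"
  have "fps_nth (of_nat i * partial i F3) n = of_nat i * partial_ppoly i (fps_nth F3 n)"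
    by (simp add: fps_of_nat[symmetric] partial_def)
  also have "fps_nth F3 n = (\<Sum>ds\<in>planar ?S. scalar (1 / fact n * (1 / fact (length ds))) * mon (orbits (prodl ds) ?S))"
    unfolding F3_nth wt_def sum_distrib_left mult.assoc[symmetric] scalar_mult ..
  also have "of_nat i * partial_ppoly i \<dots>
      = (\<Sum>ds\<in>planar ?S. of_nat i * partial_ppoly i (scalar (1 / fact n * (1 / fact (length ds))) * mon (orbits (prodl ds) ?S)))"
    by (simp only: partial_ppoly_sum sum_distrib_left)
  also have "\<dots> = (\<Sum>ds\<in>planar ?S. scalar (1 / fact n * (1 / fact (length ds)))
      * (\<Sum>a | a \<in> ?S \<and> card (orbit (prodl ds) a) = i. mon (orbits (prodl ds) (?S - orbit (prodl ds) a))))"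
    by (intro sum.cong refl partial_scalar_mon planarD(3)) auto
  also have "\<dots> = scalar (1 / fact n) * (\<Sum>ds\<in>planar ?S. \<Sum>a | a \<in> ?S \<and> cycle_len (ds, a) = i. val ?S (ds, a))"
    by (simp only: sum_distrib_left val_def wt_def rest_def cycle_len_def fst_conv snd_conv
      scalar_mult[symmetric] mult.assoc)
  also have "(\<Sum>ds\<in>planar ?S. \<Sum>a | a \<in> ?S \<and> cycle_len (ds, a) = i. val ?S (ds, a))
      = (\<Sum>x\<in>(SIGMA ds:planar ?S. {a. a \<in> ?S \<and> cycle_len (ds, a) = i}). val ?S x)"
    by (rule sum_Sigma[symmetric]) (auto simp: finite_planar)
  also have "(SIGMA ds:planar ?S. {a. a \<in> ?S \<and> cycle_len (ds, a) = i}) = {x. x \<in> pointed ?S \<and> cycle_len x = i}"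
    by (auto simp: pointed_def)
  finally show "fps_nth (of_nat i * partial i F3) n = fps_nth (egf (ptd_nat i)) n"
    by (simp add: egf_def ptd_def)
qed

lemma egf_ptd_mult2:
  "fps_nth (egf (ptd_nat i) * egf (ptd_nat j)) n
    = scalar (1 / fact n) * (\<Sum>A\<in>Pow {1..n}. ptd A i * ptd ({1..n} - A) j)"
proof -
  have "ptd_nat i (card A) * ptd_nat j (n - card A) = ptd A i * ptd ({1..n} - A) j" if "A \<in> Pow {1..n}" for A
  proof -
    have "A \<subseteq> {1..n}" using that by simp
    moreover from this have "finite A" by (rule finite_subset) simp
    ultimately have "finite A" "card ({1..n} - A) = n - card A" by (simp_all add: card_Diff_subset)
    then show ?thesis using ptd_eq_ptd_nat[of A i] ptd_eq_ptd_nat[of "{1..n} - A" j] by simp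
  qed
  then show ?thesis unfolding egf_mult by (simp add: egf_def)
qed

lemma egf_ptd_mult3:
  "fps_nth (egf (ptd_nat i) * egf (ptd_nat j) * egf (ptd_nat k)) n
    = scalar (1 / fact n) * (\<Sum>A\<in>Pow {1..n}. \<Sum>B\<in>Pow ({1..n} - A). ptd A i * ptd B j * ptd ({1..n} - A - B) k)"
proof -
  \<comment> \<open>The subsets are taken in different sets, but these have the same size
    \<open>n - card A\<close>, and the terms depend on sizes only.\<close>
  have inner: "(\<Sum>B\<in>Pow {1..n - card A}. ptd_nat j (card B) * ptd_nat k (n - card A - card B))
      = (\<Sum>B\<in>Pow ({1..n} - A). ptd B j * ptd ({1..n} - A - B) k)"
    and outer: "finite A" if "A \<in> Pow {1..n}" for A
  proof -
    show A: "finite A" by (rule finite_subset[of _ "{1..n}"]) (use that in auto)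
    then have card: "card ({1..n} - A) = n - card A" using that by (simp add: card_Diff_subset)
    have "(\<Sum>B\<in>Pow ({1..n} - A). ptd B j * ptd ({1..n} - A - B) k)
        = (\<Sum>B\<in>Pow ({1..n} - A). ptd_nat j (card B) * ptd_nat k (n - card A - card B))"
    proof (rule sum.cong)
      fix B assume "B \<in> Pow ({1..n} - A)"
      then have B: "B \<subseteq> {1..n} - A" by simp
      then have finB: "finite B" by (rule finite_subset) simp
      have "card ({1..n} - A - B) = n - card A - card B"
        by (simp only: card_Diff_subset[OF finB B] card)
      then show "ptd B j * ptd ({1..n} - A - B) k = ptd_nat j (card B) * ptd_nat k (n - card A - card B)"
        using ptd_eq_ptd_nat[of B j] ptd_eq_ptd_nat[of "{1..n} - A - B" k] finB by simp
    qed simp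
    then show "(\<Sum>B\<in>Pow {1..n - card A}. ptd_nat j (card B) * ptd_nat k (n - card A - card B))
      = (\<Sum>B\<in>Pow ({1..n} - A). ptd B j * ptd ({1..n} - A - B) k)"
      using sum_Pow_card[of "{1..n} - A" "\<lambda>m. ptd_nat j m * ptd_nat k (n - card A - m)"]
        sum_Pow_card[of "{1..n - card A}" "\<lambda>m. ptd_nat j m * ptd_nat k (n - card A - m)"] card by simp
  qed
  have "fps_nth (egf (ptd_nat i) * (egf (ptd_nat j) * egf (ptd_nat k))) n
      = scalar (1 / fact n) * (\<Sum>A\<in>Pow {1..n}. ptd_nat i (card A) *
          (\<Sum>B\<in>Pow {1..n - card A}. ptd_nat j (card B) * ptd_nat k (n - card A - card B)))"
    unfolding egf_mult by (simp add: egf_def)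
  also have "\<dots> = scalar (1 / fact n) * (\<Sum>A\<in>Pow {1..n}. \<Sum>B\<in>Pow ({1..n} - A). ptd A i * ptd B j * ptd ({1..n} - A - B) k)"
  proof (intro arg_cong2[where f = "(*)"] refl sum.cong)
    fix A assume A: "A \<in> Pow {1..n}"
    show "ptd_nat i (card A) * (\<Sum>B\<in>Pow {1..n - card A}. ptd_nat j (card B) * ptd_nat k (n - card A - card B))
        = (\<Sum>B\<in>Pow ({1..n} - A). ptd A i * ptd B j * ptd ({1..n} - A - B) k)"
      unfolding inner[OF A] by (simp only: ptd_eq_ptd_nat[OF outer[OF A], of i] sum_distrib_left mult.assoc)
  qed
  finally show ?thesis by (simp only: mult.assoc)
qed

text \<open>Each numerical coefficient is made up of the indices of the derivatives next to it.
  Distributed over them, it turns every derivative into a series with a marked cycle.\<close>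

lemma join_cut_term:
  "of_nat (i + j + k) * p_fps i * p_fps j * p_fps k * partial (i + j + k) F3
    + of_nat (i * j * k) * p_fps (i + j + k) * partial i F3 * partial j F3 * partial k F3
    + of_nat (3 * (i + j) * k) * p_fps i * p_fps (j + k) * partial (i + j) F3 * partial k F3
  = fps_const (p_var i * p_var j * p_var k) * egf (ptd_nat (i + j + k))
    + fps_const (p_var (i + j + k)) * (egf (ptd_nat i) * egf (ptd_nat j) * egf (ptd_nat k))
    + 3 * (fps_const (p_var i * p_var (j + k)) * (egf (ptd_nat (i + j)) * egf (ptd_nat k)))"
proof -
  have 1: "of_nat (i + j + k) * p_fps i * p_fps j * p_fps k * partial (i + j + k) F3
      = fps_const (p_var i * p_var j * p_var k) * (of_nat (i + j + k) * partial (i + j + k) F3)"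
    by (simp only: fps_const_mult[symmetric] mult_ac)
  have 2: "of_nat (i * j * k) * p_fps (i + j + k) * partial i F3 * partial j F3 * partial k F3
      = p_fps (i + j + k) * (of_nat i * partial i F3 * (of_nat j * partial j F3) * (of_nat k * partial k F3))"
    by (simp only: of_nat_mult mult_ac)
  have 3: "of_nat (3 * (i + j) * k) * p_fps i * p_fps (j + k) * partial (i + j) F3 * partial k F3
      = 3 * (fps_const (p_var i * p_var (j + k)) * (of_nat (i + j) * partial (i + j) F3 * (of_nat k * partial k F3)))"
    by (simp only: fps_const_mult[symmetric] of_nat_mult of_nat_numeral mult_ac)
  show ?thesis unfolding 1 2 3 partial_F3 ..
qed

text \<open>The infinite sums are introduced through \<open>has_sum\<close>, so their convergence is
  part of the claim. It holds because the coefficient of \<open>z ^ n\<close> involves only indices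
  up to \<open>n\<close>.\<close>

theorem theorem5p36:
  "\<exists>A B :: ppoly fps.
     ((\<lambda>(i, j, k).
          of_nat (i + j + k) * p_fps i * p_fps j * p_fps k * partial (i + j + k) F3
        + of_nat (i * j * k) * p_fps (i + j + k) * partial i F3 * partial j F3 * partial k F3
        + of_nat (3 * (i + j) * k) * p_fps i * p_fps (j + k) * partial (i + j) F3 * partial k F3)
        has_sum A) ({1..} \<times> {1..} \<times> {1..})
   \<and> ((\<lambda>i. p_fps i * partial i F3) has_sum B) {1..}
   \<and> scalar_fps (1/3) * A - scalar_fps (1/2) * (fps_X * fps_deriv F3 + B - 2 * F3) = 0"
proof -
  let ?S = "\<lambda>n. {1..n::nat}" and ?W = "\<lambda>n ds. wt ds * mon (orbits (prodl ds) {1..n::nat})"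
  let ?f = "\<lambda>(i, j, k).
          of_nat (i + j + k) * p_fps i * p_fps j * p_fps k * partial (i + j + k) F3
        + of_nat (i * j * k) * p_fps (i + j + k) * partial i F3 * partial j F3 * partial k F3
        + of_nat (3 * (i + j) * k) * p_fps i * p_fps (j + k) * partial (i + j) F3 * partial k F3"
  let ?h = "\<lambda>n (i, j, k). p_var i * p_var j * p_var k * ptd (?S n) (i + j + k)
      + p_var (i + j + k) * (\<Sum>A\<in>Pow (?S n). \<Sum>B\<in>Pow (?S n - A). ptd A i * ptd B j * ptd (?S n - A - B) k)
      + 3 * (p_var i * p_var (j + k) * (\<Sum>A\<in>Pow (?S n). ptd A (i + j) * ptd (?S n - A) k))"
  \<comment> \<open>The expected values: the recursion counts a planar list once for each first
    factor and each rotation of it, and the Euler operator in the variables counts its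
    cycles.\<close>
  define A where "A = Abs_fps (\<lambda>n. scalar (1 / fact n) * (\<Sum>ds\<in>planar (?S n). of_nat (3 * length ds) * ?W n ds))"
  define B where "B = Abs_fps (\<lambda>n. scalar (1 / fact n) * (\<Sum>ds\<in>planar (?S n). of_nat (card (orbits (prodl ds) (?S n))) * ?W n ds))"
  have f_nth: "fps_nth (?f t) n = scalar (1 / fact n) * ?h n t" for t n
  proof -
    obtain i j k where t: "t = (i, j, k)" by (cases t)
    have three: "fps_nth (3 * X) n = 3 * fps_nth X n" for X :: "ppoly fps"
      by (metis fps_mult_left_const_nth fps_numeral_fps_const)
    show ?thesis
      unfolding t prod.case join_cut_term fps_add_nth three fps_mult_left_const_nth egf_ptd_mult2 egf_ptd_mult3 egf_nth
      by (simp only: distrib_left mult_ac)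
  qed
  have "(?f has_sum A) ({1..} \<times> {1..} \<times> {1..})"
  proof (rule has_sum_fpsI[where X = "\<lambda>n. {1..n} \<times> {1..n} \<times> {1..n}"])
    fix n :: nat and t :: "nat \<times> nat \<times> nat"
    assume t: "t \<in> {1..} \<times> {1..} \<times> {1..} - {1..n} \<times> {1..n} \<times> {1..n}"
    obtain i j k where ijk: "t = (i, j, k)" by (cases t)
    \<comment> \<open>An index above \<open>n\<close> asks for a marked cycle longer than the set
      that contains it, so every product has a zero factor.\<close>
    have big: "n < i \<or> n < j \<or> n < k" using t ijk by auto
    have card: "card C \<le> n" "finite C" if "C \<subseteq> ?S n" for C
      using card_mono[OF _ that] finite_subset[OF that] by auto
    have triple: "ptd A i * ptd B j * ptd (?S n - A - B) k = 0" if "A \<in> Pow (?S n)" "B \<in> Pow (?S n - A)" for A B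
    proof -
      have "A \<subseteq> ?S n" "B \<subseteq> ?S n" "?S n - A - B \<subseteq> ?S n" using that by auto
      then have "ptd A i = 0 \<or> ptd B j = 0 \<or> ptd (?S n - A - B) k = 0"
        using big card[of A] card[of B] card[of "?S n - A - B"] ptd_eq_0[of A i] ptd_eq_0[of B j]
          ptd_eq_0[of "?S n - A - B" k] by linarith
      then show ?thesis by auto
    qed
    have pair: "ptd A (i + j) * ptd (?S n - A) k = 0" if "A \<in> Pow (?S n)" for A
    proof -
      have "A \<subseteq> ?S n" "?S n - A \<subseteq> ?S n" using that by auto
      then have "ptd A (i + j) = 0 \<or> ptd (?S n - A) k = 0"
        using big card[of A] card[of "?S n - A"] ptd_eq_0[of A "i + j"] ptd_eq_0[of "?S n - A" k] by linarith
      then show ?thesis by auto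
    qed
    have "ptd (?S n) (i + j + k) = 0" using big by (intro ptd_eq_0) auto
    moreover have "(\<Sum>A\<in>Pow (?S n). \<Sum>B\<in>Pow (?S n - A). ptd A i * ptd B j * ptd (?S n - A - B) k) = 0"
      by (intro sum.neutral ballI triple)
    moreover have "(\<Sum>A\<in>Pow (?S n). ptd A (i + j) * ptd (?S n - A) k) = 0"
      by (intro sum.neutral ballI pair)
    ultimately have "?h n t = 0" unfolding ijk by simp
    then show "fps_nth (?f t) n = 0" unfolding f_nth by simp
  next
    fix n
    have "fps_nth A n = scalar (1 / fact n) * (\<Sum>t\<in>{1..n} \<times> {1..n} \<times> {1..n}. ?h n t)"
      using planar_recursion[of "?S n" n] by (simp add: A_def mult.assoc del: foldr.simps)
    then show "fps_nth A n = (\<Sum>t\<in>{1..n} \<times> {1..n} \<times> {1..n}. fps_nth (?f t) n)"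
      unfolding f_nth sum_distrib_left .
  qed auto
  moreover have "((\<lambda>i. p_fps i * partial i F3) has_sum B) {1..}"
  proof -
    have nth: "fps_nth (p_fps i * partial i F3) n
        = scalar (1 / fact n) * (\<Sum>ds\<in>planar (?S n). of_nat (card {X \<in> orbits (prodl ds) (?S n). card X = i}) * ?W n ds)" for i n
    proof -
      have "fps_nth (p_fps i * partial i F3) n
          = p_var i * partial_ppoly i (\<Sum>ds\<in>planar (?S n). scalar (1 / fact n * (1 / fact (length ds))) * mon (orbits (prodl ds) (?S n)))"
        unfolding partial_def fps_mult_left_const_nth fps_nth_Abs_fps F3_nth wt_def sum_distrib_left mult.assoc[symmetric] scalar_mult ..
      also have "\<dots> = (\<Sum>ds\<in>planar (?S n). of_nat (card {X \<in> orbits (prodl ds) (?S n). card X = i})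
          * (scalar (1 / fact n * (1 / fact (length ds))) * mon (orbits (prodl ds) (?S n))))"
        unfolding partial_ppoly_sum sum_distrib_left by (intro sum.cong refl p_var_partial_scalar_mon) simp
      also have "\<dots> = scalar (1 / fact n) * (\<Sum>ds\<in>planar (?S n). of_nat (card {X \<in> orbits (prodl ds) (?S n). card X = i}) * ?W n ds)"
        unfolding sum_distrib_left wt_def scalar_mult[symmetric] by (intro sum.cong refl) (simp only: mult_ac)
      finally show ?thesis .
    qed
    have le: "card X \<le> n \<and> 1 \<le> card X" if ds: "ds \<in> planar (?S n)" and X: "X \<in> orbits (prodl ds) (?S n)" for ds X n
    proof -
      obtain a where a: "a \<in> ?S n" "X = orbit (prodl ds) a" using X by (auto simp: orbits_def)
      then have "X \<subseteq> ?S n" using orbit_subset_of_permutes[OF planarD(3)[OF ds] a(1)] by simp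
      then show ?thesis
        using card_mono[of "?S n" X] card_orbit_pos[OF _ planarD(3)[OF ds], of a] a(2) by simp
    qed
    show ?thesis
    proof (rule has_sum_fpsI[where X = "\<lambda>n. {1..n}"])
      fix n i :: nat assume i: "i \<in> {1..} - {1..n}"
      have "card {X \<in> orbits (prodl ds) (?S n). card X = i} = 0" if "ds \<in> planar (?S n)" for ds
      proof -
        have "{X \<in> orbits (prodl ds) (?S n). card X = i} = {}" using le[OF that] i by fastforce
        then show ?thesis by (simp only: card.empty)
      qed
      then show "fps_nth (p_fps i * partial i F3) n = 0" unfolding nth by simp
    next
      fix n
      \<comment> \<open>The Euler operator multiplies a monomial by its degree; here the degree is
        the number of cycles, sorted by length.\<close>
      have card_sum: "(\<Sum>i\<in>{1..n}. card {X \<in> orbits (prodl ds) (?S n). card X = i}) = card (orbits (prodl ds) (?S n))"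
        if "ds \<in> planar (?S n)" for ds
      proof -
        have "(\<Sum>i\<in>{1..n}. \<Sum>X | X \<in> orbits (prodl ds) (?S n) \<and> card X = i. 1 :: nat) = (\<Sum>X\<in>orbits (prodl ds) (?S n). 1)"
          by (rule sum.group) (use le[OF that] finite_orbits in auto)
        then show ?thesis by simp
      qed
      have "of_nat (card (orbits (prodl ds) (?S n))) * ?W n ds
          = (\<Sum>i\<in>{1..n}. of_nat (card {X \<in> orbits (prodl ds) (?S n). card X = i}) * ?W n ds)"
        if "ds \<in> planar (?S n)" for ds
        unfolding card_sum[OF that, symmetric] of_nat_sum sum_distrib_right ..
      then have "fps_nth B n = scalar (1 / fact n) * (\<Sum>ds\<in>planar (?S n). \<Sum>i\<in>{1..n}.
          of_nat (card {X \<in> orbits (prodl ds) (?S n). card X = i}) * ?W n ds)"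
        unfolding B_def fps_nth_Abs_fps by (intro arg_cong2[where f = "(*)"] refl sum.cong)
      also have "\<dots> = (\<Sum>i\<in>{1..n}. fps_nth (p_fps i * partial i F3) n)"
        unfolding nth sum_distrib_left by (rule sum.swap)
      finally show "fps_nth B n = (\<Sum>i\<in>{1..n}. fps_nth (p_fps i * partial i F3) n)" .
    qed auto
  qed
  moreover have "scalar_fps (1/3) * A - scalar_fps (1/2) * (fps_X * fps_deriv F3 + B - 2 * F3) = 0"
  proof (rule fps_ext)
    fix n
    have two: "fps_nth (2 * F3) n = 2 * fps_nth F3 n"
      by (metis fps_mult_left_const_nth fps_numeral_fps_const)
    have deriv: "fps_nth (fps_X * fps_deriv F3) n = of_nat n * fps_nth F3 n"
      by (cases n) simp_all
    have len: "of_nat n * T + of_nat (card (orbits (prodl ds) (?S n))) * T - 2 * T = of_nat (2 * length ds) * T"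
      if "ds \<in> planar (?S n)" for ds and T :: ppoly
    proof -
      have "2 * length ds + 2 = n + card (orbits (prodl ds) (?S n))" using that by (simp add: planar_iff)
      then have "(of_nat n :: ppoly) + of_nat (card (orbits (prodl ds) (?S n))) = of_nat (2 * length ds) + 2"
        by (metis of_nat_add of_nat_numeral)
      then show ?thesis by (simp only: distrib_right[symmetric] left_diff_distrib[symmetric] add_diff_cancel_right')
    qed
    have "fps_nth (fps_X * fps_deriv F3 + B - 2 * F3) n
        = scalar (1 / fact n) * (\<Sum>ds\<in>planar (?S n). of_nat n * ?W n ds + of_nat (card (orbits (prodl ds) (?S n))) * ?W n ds - 2 * ?W n ds)"
      unfolding fps_sub_nth fps_add_nth two deriv F3_nth B_def fps_nth_Abs_fps
        sum.distrib sum_subtractf sum_distrib_left[symmetric]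
      by (simp only: distrib_left right_diff_distrib mult.left_commute)
    also have "\<dots> = scalar (1 / fact n) * (\<Sum>ds\<in>planar (?S n). of_nat (2 * length ds) * ?W n ds)"
      by (intro arg_cong2[where f = "(*)"] refl sum.cong len)
    finally have rhs: "fps_nth (fps_X * fps_deriv F3 + B - 2 * F3) n
        = scalar (1 / fact n) * (\<Sum>ds\<in>planar (?S n). of_nat (2 * length ds) * ?W n ds)" .
    \<comment> \<open>Used with \<open>r\<close> equal to 3 and to 2: both parts of the equation
      reduce to the planar lists counted with their number of factors, and so they cancel.\<close>
    have half: "scalar (1/m) * (scalar c * (\<Sum>ds\<in>planar (?S n). of_nat (r * length ds) * ?W n ds))
        = scalar c * (\<Sum>ds\<in>planar (?S n). of_nat (length ds) * ?W n ds)"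
      if "m = of_nat r" "r \<noteq> 0" for m c r
    proof -
      have "scalar (1/m) * of_nat (r * k) = of_nat k" for k
        unfolding scalar_of_nat[symmetric] scalar_mult using that by simp
      then have "scalar (1/m) * (of_nat (r * k) * T) = of_nat k * T" for k and T :: ppoly
        by (simp only: mult.assoc[symmetric])
      then have "scalar (1/m) * (\<Sum>ds\<in>planar (?S n). of_nat (r * length ds) * ?W n ds)
          = (\<Sum>ds\<in>planar (?S n). of_nat (length ds) * ?W n ds)" by (simp only: sum_distrib_left)
      then show ?thesis by (simp only: mult.left_commute[of "scalar (1/m)"])
    qed
    have third: "scalar (1/3) * (scalar (1 / fact n) * (\<Sum>ds\<in>planar (?S n). of_nat (3 * length ds) * ?W n ds))
        = scalar (1 / fact n) * (\<Sum>ds\<in>planar (?S n). of_nat (length ds) * ?W n ds)"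
      by (rule half) simp_all
    have second: "scalar (1/2) * (scalar (1 / fact n) * (\<Sum>ds\<in>planar (?S n). of_nat (2 * length ds) * ?W n ds))
        = scalar (1 / fact n) * (\<Sum>ds\<in>planar (?S n). of_nat (length ds) * ?W n ds)"
      by (rule half) simp_all
    have "fps_nth (scalar_fps (1/3) * A - scalar_fps (1/2) * (fps_X * fps_deriv F3 + B - 2 * F3)) n
        = scalar (1/3) * fps_nth A n - scalar (1/2) * fps_nth (fps_X * fps_deriv F3 + B - 2 * F3) n"
      by (simp only: fps_sub_nth[of "scalar_fps (1/3) * A"] fps_mult_left_const_nth)
    also have "scalar (1/3) * fps_nth A n = scalar (1 / fact n) * (\<Sum>ds\<in>planar (?S n). of_nat (length ds) * ?W n ds)"
      unfolding A_def fps_nth_Abs_fps by (rule third)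
    also have "scalar (1/2) * fps_nth (fps_X * fps_deriv F3 + B - 2 * F3) n
        = scalar (1 / fact n) * (\<Sum>ds\<in>planar (?S n). of_nat (length ds) * ?W n ds)"
      unfolding rhs by (rule second)
    finally show "fps_nth (scalar_fps (1/3) * A - scalar_fps (1/2) * (fps_X * fps_deriv F3 + B - 2 * F3)) n = fps_nth 0 n"
      by (simp only: diff_self fps_zero_nth)
  qed
  ultimately show ?thesis by blast
qed

end
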